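(* Let $\mathcal{P}$ be a finite chiral $n$-polytope ($n\ge3$), and for $s\ge2$ and $k\in\{1,2,n-1\}$ let $\mathcal{Q}(s,k)$ be the directly regular $n$-polytope $\{4,3^{n-3},4\}_{(s^k,0^{n-k-1})}$. If $|X(\mathcal{P})|$ does not divide $2^{n+k-2}(n-1)!$, then there are infinitely many values of $s$ such that $\mathcal{P}\diamond\mathcal{Q}(s,k)$ is chiral.
   Context: All polytopes are abstract polytopes. A regular polytope is directly regular if its rotation group $\Gamma^+(\mathcal{P})$, generated by $\sigma_i=\rho_{i-1}\rho_i$ ($\rho_0,\dots,\rho_{n-1}$ the standard generating involutions relative to a base flag), has index $2$ in the automorphism group. A polytope is chiral if its automorphism group has two orbits on flags, adjacent flags lying in distinct orbits; then $\Gamma^+(\mathcal{P})$ is the full automorphism group, generated by standard rotations $\sigma_1,\dots,\sigma_{n-1}$. The cubic toroid $\{4,3^{n-3},4\}_{(s^k,0^{n-k-1})}$ ($s\ge2$, $k\in\{1,2,n-1\}$) is the regular $n$-polytope obtained as the quotient of the regular cubic tessellation $\{4,3^{n-3},4\}$ of Euclidean $(n-1)$-space (unit cubes with integer vertices) by the translation group generated by the translation by the vector $(s,\dots,s,0,\dots,0)$ (with $k$ entries $s$ and $n-k-1$ zeros) together with its images under all signed permutations of coordinates; it is directly regular and its rotation group has order $2^{n+k-2}(n-1)!\,s^{n-1}$. Let $W^+=\langle \sigma_1,\dots,\sigma_{n-1}\mid (\sigma_i\cdots\sigma_j)^2=1,\ 1\le i<j\le n-1\rangle$; each chiral or directly regular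 $n$-polytope has $\Gamma^+=W^+/M$ for a normal subgroup $M$. Let $w\mapsto\overline{w}$ be the automorphism of $W^+$ with $\sigma_1\mapsto\sigma_1^{-1}$, $\sigma_2\mapsto\sigma_1^2\sigma_2$, $\sigma_j\mapsto\sigma_j$ ($j\ge3$). Chirality group: $X(\mathcal{P})=M\overline M/M$ for $\Gamma^+(\mathcal{P})=W^+/M$. Mix: if $\Gamma^+(\mathcal{P})=W^+/M$ and $\Gamma^+(\mathcal{Q})=W^+/K$, the mix $\mathcal{P}\diamond\mathcal{Q}$ is the (flag-connected pre-)polytope whose rotation group is the subgroup of $\Gamma^+(\mathcal{P})\times\Gamma^+(\mathcal{Q})$ generated by $(\sigma_i,\sigma_i')$, isomorphic to $W^+/N$ with $N=M\cap K$; it is chiral if $\overline N\ne N$ and directly regular otherwise (polytopality is not asserted). *)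

theory Defs
  imports Complex_Main "HOL-Algebra.Elementary_Groups" "HOL-Combinatorics.Permutations"
begin

section \<open>Abstract polytopes\<close>

text \<open>
  A poset is given by its (reflexive) order relation \<open>r\<close>; its elements, the faces, are
  \<open>Field r\<close>. Flags are maximal chains, and include the least and the greatest face.
\<close>

definition flags :: "'a rel \<Rightarrow> 'a set set" where
  "flags r = {\<Phi> \<in> Chains r. \<forall>C \<in> Chains r. \<Phi> \<subseteq> C \<longrightarrow> C = \<Phi>}"

definition strictly_below :: "'a rel \<Rightarrow> 'a \<Rightarrow> 'a \<Rightarrow> bool" where
  "strictly_below r F G \<longleftrightarrow> (F, G) \<in> r \<and> F \<noteq> G"

text \<open>
  The rank of a face is one less than the length of a longest chain of faces strictly below it,
  so that the least face has rank \<open>-1\<close> and vertices have rank \<open>0\<close>. (A junk value results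
  if these lengths are unbounded, which does not happen in a polytope.)
\<close>

definition face_rank :: "'a rel \<Rightarrow> 'a \<Rightarrow> int" where
  "face_rank r F =
     int (Max (card ` {C \<in> Chains r. \<forall>G \<in> C. strictly_below r G F})) - 1"

definition adjacent :: "'a rel \<Rightarrow> nat \<Rightarrow> 'a set \<Rightarrow> 'a set \<Rightarrow> bool" where
  "adjacent r i \<Phi> \<Psi> \<longleftrightarrow>
     \<Phi> \<in> flags r \<and> \<Psi> \<in> flags r \<and> \<Phi> \<noteq> \<Psi> \<and>
     {F \<in> \<Phi>. face_rank r F \<noteq> int i} = {F \<in> \<Psi>. face_rank r F \<noteq> int i}"

definition strongly_flag_connected :: "nat \<Rightarrow> 'a rel \<Rightarrow> bool" where
  "strongly_flag_connected n r \<longleftrightarrow>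
     (\<forall>\<Phi> \<in> flags r. \<forall>\<Psi> \<in> flags r.
        (\<lambda>A B. (\<exists>i<n. adjacent r i A B) \<and> \<Phi> \<inter> \<Psi> \<subseteq> A \<and> \<Phi> \<inter> \<Psi> \<subseteq> B)\<^sup>*\<^sup>* \<Phi> \<Psi>)"

definition diamond_condition :: "'a rel \<Rightarrow> bool" where
  "diamond_condition r \<longleftrightarrow>
     (\<forall>F G. (F, G) \<in> r \<and> face_rank r G = face_rank r F + 2 \<longrightarrow>
        card {H. strictly_below r F H \<and> strictly_below r H G} = 2)"

definition abstract_polytope :: "nat \<Rightarrow> 'a rel \<Rightarrow> bool" where
  "abstract_polytope n r \<longleftrightarrow>
     partial_order_on (Field r) r \<and>
     (\<exists>F \<in> Field r. \<forall>G \<in> Field r. (F, G) \<in> r) \<and>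
     (\<exists>F \<in> Field r. \<forall>G \<in> Field r. (G, F) \<in> r) \<and>
     (\<forall>\<Phi> \<in> flags r. card \<Phi> = n + 2) \<and>
     strongly_flag_connected n r \<and>
     diamond_condition r"

text \<open>
  Automorphisms act on the right: the product of \<open>f\<close> and \<open>g\<close> is \<open>f\<close> followed by \<open>g\<close>.
  They are extensional functions on the set of faces, so that they are determined by their
  values there.
\<close>

definition automorphism_group :: "'a rel \<Rightarrow> ('a \<Rightarrow> 'a) monoid" where
  "automorphism_group r =
     \<lparr>carrier = {f \<in> extensional (Field r). bij_betw f (Field r) (Field r) \<and>
                   (\<forall>F \<in> Field r. \<forall>G \<in> Field r. (F, G) \<in> r \<longleftrightarrow> (f F, f G) \<in> r)},
      monoid.mult = (\<lambda>f g. compose (Field r) g f),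
      one = (\<lambda>F \<in> Field r. F)\<rparr>"

definition flag_orbit :: "'a rel \<Rightarrow> 'a set \<Rightarrow> 'a set set" where
  "flag_orbit r \<Phi> = {\<gamma> ` \<Phi> | \<gamma>. \<gamma> \<in> carrier (automorphism_group r)}"

definition chiral_polytope :: "nat \<Rightarrow> 'a rel \<Rightarrow> bool" where
  "chiral_polytope n r \<longleftrightarrow>
     abstract_polytope n r \<and>
     card (flag_orbit r ` flags r) = 2 \<and>
     (\<forall>i<n. \<forall>\<Phi> \<Psi>. adjacent r i \<Phi> \<Psi> \<longrightarrow> flag_orbit r \<Phi> \<noteq> flag_orbit r \<Psi>)"

definition adjacent_flag :: "'a rel \<Rightarrow> nat \<Rightarrow> 'a set \<Rightarrow> 'a set" where
  "adjacent_flag r i \<Phi> = (THE \<Psi>. adjacent r i \<Phi> \<Psi>)"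

text \<open>
  The standard rotation \<open>\<sigma>\<^sub>i\<close> (\<open>1 \<le> i \<le> n - 1\<close>) relative to the base flag \<open>\<Phi>\<close> is the
  automorphism that maps \<open>\<Phi>\<close> to the \<open>(i-1)\<close>-adjacent flag of its \<open>i\<close>-adjacent flag. In a
  regular polytope this is \<open>\<rho>\<^sub>i\<^sub>-\<^sub>1 \<rho>\<^sub>i\<close>, where \<open>\<rho>\<^sub>j\<close> maps \<open>\<Phi>\<close> to its \<open>j\<close>-adjacent flag;
  in a chiral polytope, which has no such \<open>\<rho>\<^sub>j\<close>, it is the usual choice of \<open>\<sigma>\<^sub>i\<close>.
\<close>

definition std_rotation :: "'a rel \<Rightarrow> 'a set \<Rightarrow> nat \<Rightarrow> 'a \<Rightarrow> 'a" where
  "std_rotation r \<Phi> i =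
     (THE \<gamma>. \<gamma> \<in> carrier (automorphism_group r) \<and>
             \<gamma> ` \<Phi> = adjacent_flag r (i - 1) (adjacent_flag r i \<Phi>))"

definition rotation_group :: "nat \<Rightarrow> 'a rel \<Rightarrow> 'a set \<Rightarrow> ('a \<Rightarrow> 'a) monoid" where
  "rotation_group n r \<Phi> =
     subgroup_generated (automorphism_group r) (std_rotation r \<Phi> ` {1..n-1})"


section \<open>Groups given by generators and relators\<close>

text \<open>
  A word is a list of letters \<open>(x, b)\<close>, where \<open>(x, True)\<close> stands for the generator \<open>x\<close> and
  \<open>(x, False)\<close> for its inverse.
\<close>

inductive_set pres_rel :: "'g set \<Rightarrow> ('g \<times> bool) list set \<Rightarrow> ('g \<times> bool) list rel"
  for S :: "'g set" and R :: "('g \<times> bool) list set" where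
  refl: "w \<in> lists (S \<times> UNIV) \<Longrightarrow> (w, w) \<in> pres_rel S R"
| sym: "(u, v) \<in> pres_rel S R \<Longrightarrow> (v, u) \<in> pres_rel S R"
| trans: "(u, v) \<in> pres_rel S R \<Longrightarrow> (v, w) \<in> pres_rel S R \<Longrightarrow> (u, w) \<in> pres_rel S R"
| cancel: "u \<in> lists (S \<times> UNIV) \<Longrightarrow> v \<in> lists (S \<times> UNIV) \<Longrightarrow> x \<in> S \<Longrightarrow>
    (u @ [(x, b), (x, \<not> b)] @ v, u @ v) \<in> pres_rel S R"
| relator: "u \<in> lists (S \<times> UNIV) \<Longrightarrow> v \<in> lists (S \<times> UNIV) \<Longrightarrow> w \<in> R \<Longrightarrow>
    (u @ w @ v, u @ v) \<in> pres_rel S R"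

definition presented_group ::
    "'g set \<Rightarrow> ('g \<times> bool) list set \<Rightarrow> ('g \<times> bool) list set monoid" where
  "presented_group S R =
     \<lparr>carrier = lists (S \<times> UNIV) // pres_rel S R,
      monoid.mult = (\<lambda>A B. \<Union>u \<in> A. \<Union>v \<in> B. pres_rel S R `` {u @ v}),
      one = pres_rel S R `` {[]}\<rparr>"

definition word_value :: "('h, 'm) monoid_scheme \<Rightarrow> ('g \<Rightarrow> 'h) \<Rightarrow> ('g \<times> bool) list \<Rightarrow> 'h" where
  "word_value G g w =
     foldr (\<lambda>(x, b) y. (if b then g x else inv\<^bsub>G\<^esub> (g x)) \<otimes>\<^bsub>G\<^esub> y) w \<one>\<^bsub>G\<^esub>"

text \<open>
  The homomorphism from a presented group to \<open>G\<close> that sends each generator \<open>x\<close> to \<open>g x\<close>,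
  meaningful if the relators have value \<open>\<one>\<close> under \<open>g\<close>: then all words of a class have the
  same value.
\<close>

definition presented_hom ::
    "('h, 'm) monoid_scheme \<Rightarrow> ('g \<Rightarrow> 'h) \<Rightarrow> ('g \<times> bool) list set \<Rightarrow> 'h" where
  "presented_hom G g A = the_elem (word_value G g ` A)"


section \<open>The group \<open>W\<^sup>+\<close>, chirality groups and mixes\<close>

definition Wplus_relators :: "nat \<Rightarrow> (nat \<times> bool) list set" where
  "Wplus_relators n =
     {map (\<lambda>l. (l, True)) ([i..<Suc j] @ [i..<Suc j]) | i j. 1 \<le> i \<and> i < j \<and> j \<le> n - 1}"

definition Wplus :: "nat \<Rightarrow> (nat \<times> bool) list set monoid" where
  "Wplus n = presented_group {1..n-1} (Wplus_relators n)"

definition Wplus_gen :: "nat \<Rightarrow> nat \<Rightarrow> (nat \<times> bool) list set" where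
  "Wplus_gen n i = pres_rel {1..n-1} (Wplus_relators n) `` {[(i, True)]}"

definition Wplus_bar :: "nat \<Rightarrow> (nat \<times> bool) list set \<Rightarrow> (nat \<times> bool) list set" where
  "Wplus_bar n = presented_hom (Wplus n)
     (\<lambda>i. if i = 1 then inv\<^bsub>Wplus n\<^esub> (Wplus_gen n 1)
          else if i = 2 then (Wplus_gen n 1 [^]\<^bsub>Wplus n\<^esub> (2::nat)) \<otimes>\<^bsub>Wplus n\<^esub> Wplus_gen n 2
          else Wplus_gen n i)"

text \<open>
  For a group \<open>G\<close> generated by the \<open>g i\<close>, this is the normal subgroup \<open>M\<close> of \<open>W\<^sup>+\<close> such that
  \<open>G = W\<^sup>+/M\<close>, with \<open>g i\<close> corresponding to the coset of the \<open>i\<close>-th generator.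
\<close>

definition Wplus_kernel ::
    "nat \<Rightarrow> ('h, 'm) monoid_scheme \<Rightarrow> (nat \<Rightarrow> 'h) \<Rightarrow> (nat \<times> bool) list set set" where
  "Wplus_kernel n G g = kernel (Wplus n) G (presented_hom G g)"

definition rotation_kernel :: "nat \<Rightarrow> 'a rel \<Rightarrow> 'a set \<Rightarrow> (nat \<times> bool) list set set" where
  "rotation_kernel n r \<Phi> = Wplus_kernel n (rotation_group n r \<Phi>) (std_rotation r \<Phi>)"

definition chirality_group ::
    "nat \<Rightarrow> 'a rel \<Rightarrow> 'a set \<Rightarrow> (nat \<times> bool) list set set monoid" where
  "chirality_group n r \<Phi> =
     (let M = rotation_kernel n r \<Phi>
      in (Wplus n)\<lparr>carrier := M <#>\<^bsub>Wplus n\<^esub> (Wplus_bar n ` M)\<rparr> Mod M)"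

definition mix_generator ::
    "'a rel \<Rightarrow> 'a set \<Rightarrow> 'b rel \<Rightarrow> 'b set \<Rightarrow> nat \<Rightarrow> ('a \<Rightarrow> 'a) \<times> ('b \<Rightarrow> 'b)" where
  "mix_generator r \<Phi> q \<Psi> i = (std_rotation r \<Phi> i, std_rotation q \<Psi> i)"

definition mix_rotation_group ::
    "nat \<Rightarrow> 'a rel \<Rightarrow> 'a set \<Rightarrow> 'b rel \<Rightarrow> 'b set \<Rightarrow> (('a \<Rightarrow> 'a) \<times> ('b \<Rightarrow> 'b)) monoid" where
  "mix_rotation_group n r \<Phi> q \<Psi> =
     subgroup_generated (rotation_group n r \<Phi> \<times>\<times> rotation_group n q \<Psi>)
       (mix_generator r \<Phi> q \<Psi> ` {1..n-1})"

text \<open>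
  The mix is a flag-connected pre-polytope, in general not a polytope, and is determined by its
  rotation group with the distinguished generators. Its chirality is by definition a property
  of the corresponding normal subgroup of \<open>W\<^sup>+\<close>.
\<close>

definition mix_kernel ::
    "nat \<Rightarrow> 'a rel \<Rightarrow> 'a set \<Rightarrow> 'b rel \<Rightarrow> 'b set \<Rightarrow> (nat \<times> bool) list set set" where
  "mix_kernel n r \<Phi> q \<Psi> =
     Wplus_kernel n (mix_rotation_group n r \<Phi> q \<Psi>) (mix_generator r \<Phi> q \<Psi>)"

definition mix_chiral :: "nat \<Rightarrow> 'a rel \<Rightarrow> 'a set \<Rightarrow> 'b rel \<Rightarrow> 'b set \<Rightarrow> bool" where
  "mix_chiral n r \<Phi> q \<Psi> \<longleftrightarrow> Wplus_bar n ` mix_kernel n r \<Phi> q \<Psi> \<noteq> mix_kernel n r \<Phi> q \<Psi>"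


section \<open>Cubic toroids\<close>

text \<open>
  Euclidean \<open>d\<close>-space, with coordinates indexed by \<open>1, \<dots>, d\<close>.
\<close>

definition espace :: "nat \<Rightarrow> (nat \<Rightarrow> real) set" where
  "espace d = {x. \<forall>i. i \<notin> {1..d} \<longrightarrow> x i = 0}"

text \<open>
  The face of a unit cube with integer vertices that has least vertex \<open>a\<close> and extends in the
  coordinate directions \<open>J\<close>; its dimension is \<open>card J\<close>.
\<close>

definition unit_cube :: "nat \<Rightarrow> (nat \<Rightarrow> int) \<Rightarrow> nat set \<Rightarrow> (nat \<Rightarrow> real) set" where
  "unit_cube d a J =
     {x \<in> espace d. \<forall>i \<in> {1..d}.
        of_int (a i) \<le> x i \<and> x i \<le> of_int (a i) + (if i \<in> J then 1 else 0)}"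

text \<open>
  The faces of the cubic tessellation of \<open>d\<close>-space, an abstract \<open>(d+1)\<close>-polytope under
  inclusion. The least face is the empty set and the greatest face is the whole space.
\<close>

definition cubic_faces :: "nat \<Rightarrow> (nat \<Rightarrow> real) set set" where
  "cubic_faces d = {{}, espace d} \<union> {unit_cube d a J | a J. J \<subseteq> {1..d}}"

definition signed_permute ::
    "(nat \<Rightarrow> nat) \<Rightarrow> (nat \<Rightarrow> real) \<Rightarrow> (nat \<Rightarrow> real) \<Rightarrow> nat \<Rightarrow> real" where
  "signed_permute \<pi> e v = (\<lambda>i. e i * v (\<pi> i))"

definition toroid_vector :: "nat \<Rightarrow> nat \<Rightarrow> nat \<Rightarrow> real" where
  "toroid_vector s k = (\<lambda>i. if i \<in> {1..k} then real s else 0)"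

definition toroid_vectors :: "nat \<Rightarrow> nat \<Rightarrow> nat \<Rightarrow> (nat \<Rightarrow> real) set" where
  "toroid_vectors d s k =
     {signed_permute \<pi> e (toroid_vector s k) | \<pi> e. \<pi> permutes {1..d} \<and> range e \<subseteq> {1, -1}}"

inductive_set toroid_lattice :: "nat \<Rightarrow> nat \<Rightarrow> nat \<Rightarrow> (nat \<Rightarrow> real) set"
  for d s k :: nat where
  zero: "(\<lambda>i. 0) \<in> toroid_lattice d s k"
| add: "u \<in> toroid_lattice d s k \<Longrightarrow> v \<in> toroid_vectors d s k \<Longrightarrow>
    (\<lambda>i. u i + v i) \<in> toroid_lattice d s k"
| diff: "u \<in> toroid_lattice d s k \<Longrightarrow> v \<in> toroid_vectors d s k \<Longrightarrow>
    (\<lambda>i. u i - v i) \<in> toroid_lattice d s k"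

definition translate :: "(nat \<Rightarrow> real) \<Rightarrow> (nat \<Rightarrow> real) set \<Rightarrow> (nat \<Rightarrow> real) set" where
  "translate v F = (\<lambda>x i. x i + v i) ` F"

definition translation_class ::
    "nat \<Rightarrow> nat \<Rightarrow> nat \<Rightarrow> (nat \<Rightarrow> real) set \<Rightarrow> (nat \<Rightarrow> real) set set" where
  "translation_class d s k F = (\<lambda>v. translate v F) ` toroid_lattice d s k"

text \<open>
  The toroid \<open>{4,3\<^sup>n\<^sup>-\<^sup>3,4}\<close> with subscript \<open>(s\<^sup>k,0\<^sup>n\<^sup>-\<^sup>k\<^sup>-\<^sup>1)\<close>: the quotient of the cubic
  tessellation of \<open>(n-1)\<close>-space by the group of translations by lattice vectors. Its faces are
  the orbits, and two orbits are incident if they have incident representatives.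
\<close>

definition cubic_toroid :: "nat \<Rightarrow> nat \<Rightarrow> nat \<Rightarrow> (nat \<Rightarrow> real) set set rel" where
  "cubic_toroid n s k =
     {(translation_class (n - 1) s k F, translation_class (n - 1) s k G) | F G.
        F \<in> cubic_faces (n - 1) \<and> G \<in> cubic_faces (n - 1) \<and> F \<subseteq> G}"

end

theory Submission
  imports Defs "HOL-Combinatorics.Multiset_Permutations"
begin

text \<open>
  Let \<open>\<Gamma>\<^sup>+(P) = W\<^sup>+/M\<close> and \<open>\<Gamma>\<^sup>+(Q) = W\<^sup>+/K\<close>, with projections \<open>\<phi>\<close> and \<open>\<psi>\<close>. If the mix is not chiral, then
  the bar automorphism preserves \<open>M \<inter> K\<close>, so \<open>\<psi>(m) \<mapsto> \<phi>(bar m)\<close> is a well-defined homomorphism from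
  \<open>\<psi>(M)\<close> onto \<open>\<phi>(bar M)\<close>, a copy of \<open>X(P)\<close>. Hence \<open>|X(P)|\<close> divides \<open>|\<Gamma>\<^sup>+(Q)|\<close>, which divides \<open>|Aut(Q)|\<close>.
  Automorphisms act freely on flags, and those of the toroid act transitively, so \<open>|Aut(Q)|\<close> is its
  number of flags: with \<open>d = n - 1\<close>, there are \<open>2\<^sup>k\<^sup>-\<^sup>1 s\<^sup>d\<close> vertices (the index of the lattice in the integer
  lattice), each in \<open>2\<^sup>d d!\<close> flags. If \<open>s \<equiv> 1\<close> modulo \<open>|X(P)|\<close>, then the factor \<open>s\<^sup>d\<close> is coprime to
  \<open>|X(P)|\<close> and can be dropped.
\<close>

text \<open>The obstacle is that the standard rotations are \<open>THE\<close> terms over a concrete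
  poset. Before there is a homomorphism from W+ to talk about, each rotation must exist and be
  unique: for \<open>P\<close> this comes from its two flag orbits, for the toroid from scratch. The
  faces of the toroid are orbits of point sets, so its order, ranks, diamonds, flag connectedness
  and flag transitivity all have to be derived. The two polytopes then meet in the locale
  \<open>rotary_flag\<close>. The geometry is reduced to integer vectors modulo a lattice. The
  quotient looks locally like the tessellation because a nonzero lattice vector has an entry of
  absolute value at least \<open>s\<close>, and \<open>s \<ge> 2\<close>. The number in the
  divisibility hypothesis is the order of the full automorphism group without its factor
  \<open>s ^ d\<close>. That order is obtained as a flag count, and the rotation group enters
  through Lagrange, so its index is never computed.\<close>

section \<open>Words, classes and homomorphisms of a presented group\<close>

locale group_presentation =
  fixes S :: "'g set" and R :: "('g \<times> bool) list set"
  assumes relators_in_lists: "R \<subseteq> lists (S \<times> UNIV)"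
begin

definition words where "words = lists (S \<times> (UNIV :: bool set))"

lemma Nil_words [simp]: "[] \<in> words"
  by (simp add: words_def)

lemma Cons_words [simp]: "(x, b) # w \<in> words \<longleftrightarrow> x \<in> S \<and> w \<in> words"
  by (simp add: words_def)

lemma append_words [simp]: "u @ v \<in> words \<longleftrightarrow> u \<in> words \<and> v \<in> words"
  by (auto simp: words_def)

lemmas pres_rel_intros = pres_rel.intros[where S = S, folded words_def]

lemmas pres_rel_induct =
  pres_rel.induct[where S = S and R = R, folded words_def, consumes 1, case_names refl sym trans cancel relator]

lemma words_subset: "R \<subseteq> words"
  using relators_in_lists by (simp add: words_def)

lemma rev_inverse_words [simp]: "rev (map (\<lambda>(x, b). (x, \<not> b)) w) \<in> words \<longleftrightarrow> w \<in> words"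
  by (induction w) auto

definition word_class :: "('g \<times> bool) list \<Rightarrow> ('g \<times> bool) list set"
  where "word_class w = pres_rel S R `` {w}"

text \<open>The relator rule itself does not ask that \<open>w\<close> be a word over
  \<open>S\<close>; the locale assumption supplies this.\<close>

lemma pres_rel_in_lists:
  "(u, v) \<in> pres_rel S R \<Longrightarrow> u \<in> words \<and> v \<in> words"
proof (induction rule: pres_rel_induct)
  case (relator u v w)
  then show ?case using words_subset by auto
qed auto

lemma equiv_pres_rel: "equiv (words) (pres_rel S R)"
proof (rule equivI)
  show "pres_rel S R \<subseteq> words \<times> words" using pres_rel_in_lists by auto
  show "refl_on words (pres_rel S R)" by (auto simp: refl_on_def intro: pres_rel_intros(1))
  show "sym (pres_rel S R)" by (rule symI) (rule pres_rel_intros(2))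
  show "trans (pres_rel S R)" by (rule transI) (rule pres_rel_intros(3))
qed

lemma pres_rel_context:
  assumes "(u, v) \<in> pres_rel S R" "a \<in> words" "b \<in> words"
  shows "(a @ u @ b, a @ v @ b) \<in> pres_rel S R"
  using assms(1)
proof (induction rule: pres_rel_induct)
  case (refl w)
  then show ?case using assms by (intro pres_rel_intros(1)) auto
next
  case (cancel u v x c)
  then show ?case
    using pres_rel_intros(4)[where u = "a @ u" and v = "v @ b" and x = x and b = c] assms by auto
next
  case (relator u v w)
  then show ?case
    using pres_rel_intros(5)[where u = "a @ u" and v = "v @ b" and w = w] assms by auto
next
  case (sym u v)
  show ?case by (rule pres_rel_intros(2)[OF sym.IH])
next
  case (trans u v w)
  show ?case by (rule pres_rel_intros(3)[OF trans.IH])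
qed

lemma pres_rel_append:
  assumes "(u, u') \<in> pres_rel S R" "(v, v') \<in> pres_rel S R"
  shows "(u @ v, u' @ v') \<in> pres_rel S R"
  using pres_rel_context[OF assms(1), of "[]" v] pres_rel_context[OF assms(2), of u' "[]"]
    pres_rel_in_lists[OF assms(1)] pres_rel_in_lists[OF assms(2)]
  by simp (rule pres_rel_intros(3))

lemma word_class_eq_iff:
  assumes "u \<in> words" "v \<in> words"
  shows "word_class u = word_class v \<longleftrightarrow> (u, v) \<in> pres_rel S R"
  using assms equiv_pres_rel by (simp add: word_class_def eq_equiv_class_iff)

lemma presented_group_carrierE:
  assumes "A \<in> carrier (presented_group S R)"
  obtains w where "w \<in> words" "A = word_class w"
  using assms by (auto simp: presented_group_def word_class_def words_def[symmetric] elim: quotientE)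

lemma word_class_in_carrier [simp, intro]:
  "w \<in> words \<Longrightarrow> word_class w \<in> carrier (presented_group S R)"
  by (auto simp: presented_group_def word_class_def words_def[symmetric] intro: quotientI)

text \<open>The product of two classes is a union over all pairs of members. By congruence every
  pair contributes the same class, and since both classes are nonempty the union collapses to
  it.\<close>

lemma word_class_mult:
  assumes "u \<in> words" "v \<in> words"
  shows "word_class u \<otimes>\<^bsub>presented_group S R\<^esub> word_class v = word_class (u @ v)"
proof -
  have *: "pres_rel S R `` {u' @ v'} = word_class (u @ v)"
    if "u' \<in> word_class u" "v' \<in> word_class v" for u' v'
  proof -
    have "(u @ v, u' @ v') \<in> pres_rel S R"
      using that by (intro pres_rel_append) (simp_all add: word_class_def)
    then show ?thesis
      unfolding word_class_def by (rule equiv_class_eq[OF equiv_pres_rel, symmetric])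
  qed
  have "u \<in> word_class u" "v \<in> word_class v"
    using assms by (simp_all add: word_class_def pres_rel_intros(1))
  then have ne: "word_class u \<noteq> {}" "word_class v \<noteq> {}" by auto
  have "word_class u \<otimes>\<^bsub>presented_group S R\<^esub> word_class v
      = (\<Union>u'\<in>word_class u. \<Union>v'\<in>word_class v. pres_rel S R `` {u' @ v'})"
    by (simp add: presented_group_def)
  also have "\<dots> = (\<Union>u'\<in>word_class u. \<Union>v'\<in>word_class v. word_class (u @ v))"
    by (intro SUP_cong HOL.refl *)
  also have "\<dots> = word_class (u @ v)" using ne by simp
  finally show ?thesis .
qed

lemma one_presented_group: "\<one>\<^bsub>presented_group S R\<^esub> = word_class []"
  by (simp add: presented_group_def word_class_def)

lemma word_inverse:
  assumes "w \<in> words"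
  shows "(rev (map (\<lambda>(x, b). (x, \<not> b)) w) @ w, []) \<in> pres_rel S R"
  using assms
proof (induction w)
  case Nil
  then show ?case by (auto intro: pres_rel_intros(1))
next
  case (Cons l w)
  obtain x b where l: "l = (x, b)" by (cases l)
  let ?i = "rev (map (\<lambda>(x, b). (x, \<not> b)) w)"
  \<comment> \<open>The double negation puts the cancelling pair into the shape of the rule
    \<open>cancel\<close>, with \<open>\<not> b\<close> as its sign.\<close>
  have "(?i @ [(x, \<not> b), (x, \<not> \<not> b)] @ w, ?i @ w) \<in> pres_rel S R"
    using Cons.prems l by (intro pres_rel_intros(4)) auto
  then show ?case using Cons l by simp (rule pres_rel_intros(3))
qed

lemma group_presented_group: "group (presented_group S R)"
proof (rule groupI)
  let ?W = "presented_group S R"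
  show "A \<otimes>\<^bsub>?W\<^esub> B \<in> carrier ?W" if "A \<in> carrier ?W" "B \<in> carrier ?W" for A B
    using that by (auto elim!: presented_group_carrierE simp: word_class_mult)
  show "\<one>\<^bsub>?W\<^esub> \<in> carrier ?W" by (simp add: one_presented_group)
  show "A \<otimes>\<^bsub>?W\<^esub> B \<otimes>\<^bsub>?W\<^esub> C = A \<otimes>\<^bsub>?W\<^esub> (B \<otimes>\<^bsub>?W\<^esub> C)"
    if "A \<in> carrier ?W" "B \<in> carrier ?W" "C \<in> carrier ?W" for A B C
    using that by (auto elim!: presented_group_carrierE simp: word_class_mult)
  show "\<one>\<^bsub>?W\<^esub> \<otimes>\<^bsub>?W\<^esub> A = A" if "A \<in> carrier ?W" for A
    using that by (auto elim!: presented_group_carrierE simp: one_presented_group word_class_mult)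
  show "\<exists>B\<in>carrier ?W. B \<otimes>\<^bsub>?W\<^esub> A = \<one>\<^bsub>?W\<^esub>" if A: "A \<in> carrier ?W" for A
  proof -
    obtain w where w: "w \<in> words" "A = word_class w"
      using A by (rule presented_group_carrierE)
    let ?i = "rev (map (\<lambda>(x, b). (x, \<not> b)) w)"
    have "word_class (?i @ w) = word_class []"
      using word_inverse[OF w(1)] unfolding word_class_def by (rule equiv_class_eq[OF equiv_pres_rel])
    then show ?thesis
      using w by (intro bexI[of _ "word_class ?i"]) (auto simp: word_class_mult one_presented_group)
  qed
qed

end

lemma word_value_Nil [simp]: "word_value G g [] = \<one>\<^bsub>G\<^esub>"
  by (simp add: word_value_def)

lemma word_value_Cons [simp]:
  "word_value G g ((x, b) # w) = (if b then g x else inv\<^bsub>G\<^esub> (g x)) \<otimes>\<^bsub>G\<^esub> word_value G g w"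
  by (simp add: word_value_def)

text \<open>The hypotheses of von Dyck's theorem: values for the generators under which every
  relator becomes trivial.\<close>

locale presented_group_map = group_presentation S R + group G
  for S :: "'g set" and R and G (structure) +
  fixes g
  assumes gen_closed: "x \<in> S \<Longrightarrow> g x \<in> carrier G"
    and relator_value: "w \<in> R \<Longrightarrow> word_value G g w = \<one>"
begin

lemma word_value_closed [simp, intro]:
  "w \<in> words \<Longrightarrow> word_value G g w \<in> carrier G"
proof (induction w)
  case (Cons l w)
  then show ?case by (cases l) (auto intro: gen_closed)
qed auto

lemma word_value_append:
  "u \<in> words \<Longrightarrow> v \<in> words \<Longrightarrow>
   word_value G g (u @ v) = word_value G g u \<otimes> word_value G g v"
proof (induction u)
  case (Cons l u)
  then show ?case by (cases l) (auto simp: m_assoc gen_closed)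
qed auto

lemma word_value_cong:
  "(u, v) \<in> pres_rel S R \<Longrightarrow> word_value G g u = word_value G g v"
proof (induction rule: pres_rel_induct)
  case (cancel u v x b)
  then have "word_value G g ([(x, b), (x, \<not> b)] @ v) = word_value G g v"
    using word_value_closed[of v] gen_closed[of x] by (auto simp flip: m_assoc)
  moreover have "[(x, b), (x, \<not> b)] @ v \<in> words" using cancel by simp
  ultimately show ?case
    using cancel by (simp only: word_value_append)
next
  case (relator u v w)
  then have "w \<in> words" using words_subset by auto
  with relator show ?case
    by (simp add: word_value_append relator_value)
qed auto

text \<open>\<open>presented_hom\<close> applies \<open>the_elem\<close> to the image of a class, so
  this image has to be a singleton: it is nonempty, and constant by
  \<open>word_value_cong\<close>.\<close>

lemma presented_hom_word_class:
  assumes "w \<in> words"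
  shows "presented_hom G g (word_class w) = word_value G g w"
proof -
  have "(w, w) \<in> pres_rel S R" using assms by (rule pres_rel_intros(1))
  then have ne: "word_class w \<noteq> {}" by (auto simp: word_class_def)
  have "word_value G g ` word_class w = (\<lambda>_. word_value G g w) ` word_class w"
    by (rule image_cong[OF HOL.refl]) (simp add: word_class_def word_value_cong)
  also have "\<dots> = {word_value G g w}" using ne by (simp add: image_constant_conv)
  finally have "word_value G g ` word_class w = {word_value G g w}" .
  then show ?thesis by (simp add: presented_hom_def)
qed

lemma presented_hom_hom: "presented_hom G g \<in> hom (presented_group S R) G"
proof (rule homI)
  show "presented_hom G g A \<in> carrier G" if "A \<in> carrier (presented_group S R)" for A
    using that by (auto elim!: presented_group_carrierE simp: presented_hom_word_class)
  show "presented_hom G g (A \<otimes>\<^bsub>presented_group S R\<^esub> B) = presented_hom G g A \<otimes> presented_hom G g B"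
    if "A \<in> carrier (presented_group S R)" "B \<in> carrier (presented_group S R)" for A B
    using that
    by (auto elim!: presented_group_carrierE
        simp: presented_hom_word_class word_class_mult word_value_append)
qed

end

section \<open>Counting images and cosets of homomorphisms\<close>

text \<open>Both images are in bijection with the common partition of \<open>S\<close> into fibres;
  \<open>inv_into\<close> picks a point of each fibre.\<close>

lemma card_image_cong_kernel:
  assumes "\<And>a b. a \<in> S \<Longrightarrow> b \<in> S \<Longrightarrow> f a = f b \<longleftrightarrow> g a = g b"
  shows "card (f ` S) = card (g ` S)"
proof -
  have "inj_on (\<lambda>y. g (inv_into S f y)) (f ` S)"
    by (rule inj_onI) (metis assms f_inv_into_f inv_into_into)
  moreover have "g (inv_into S f (f a)) = g a" if "a \<in> S" for a
    by (metis assms f_inv_into_f imageI inv_into_into that)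
  then have "(\<lambda>y. g (inv_into S f y)) ` f ` S = g ` S" by (auto simp: image_image)
  ultimately show ?thesis by (metis card_image)
qed

context group_hom
begin

lemma kernel_coset_eq:
  assumes "a \<in> carrier G"
  shows "kernel G H h #> a = {x \<in> carrier G. h x = h a}"
proof (intro equalityI subsetI)
  fix x assume x: "x \<in> {x \<in> carrier G. h x = h a}"
  then have "x \<otimes> inv a \<in> kernel G H h" "x = (x \<otimes> inv a) \<otimes> a"
    using assms by (auto simp: kernel_def G.m_assoc)
  then show "x \<in> kernel G H h #> a" unfolding r_coset_def by blast
qed (use assms in \<open>auto simp: r_coset_def kernel_def\<close>)

lemma kernel_coset_eq_iff:
  assumes "a \<in> carrier G" "b \<in> carrier G"
  shows "kernel G H h #> a = kernel G H h #> b \<longleftrightarrow> h a = h b"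
  using assms by (auto simp: kernel_coset_eq)

text \<open>The fibres are the cosets of the kernel, so by Lagrange the size of the image is the
  index of the kernel.\<close>

lemma card_image_dvd_order:
  assumes "finite (carrier G)"
  shows "card (h ` carrier G) dvd order G"
proof -
  have "card (h ` carrier G) = card ((\<lambda>a. kernel G H h #> a) ` carrier G)"
    by (rule card_image_cong_kernel) (simp add: kernel_coset_eq_iff)
  also have "(\<lambda>a. kernel G H h #> a) ` carrier G = rcosets kernel G H h"
    by (auto simp: RCOSETS_def)
  finally have "card (h ` carrier G) * card (kernel G H h) = order G"
    using G.lagrange[OF subgroup_kernel] by simp
  then show ?thesis by (metis dvd_triv_left)
qed

end

text \<open>
  The surjection \<open>\<psi>(M) \<rightarrow> \<phi>(T(M))\<close>, \<open>\<psi>(m) \<mapsto> \<phi>(T(m))\<close> is well defined since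
  \<open>T\<close> maps \<open>M \<inter> K\<close> into \<open>M\<close>.
\<close>

lemma card_kernel_image_dvd_order:
  assumes \<phi>: "group_hom W G \<phi>" and \<psi>: "group_hom W L \<psi>" and T: "T \<in> hom W W"
    and inv: "T ` (kernel W G \<phi> \<inter> kernel W L \<psi>) \<subseteq> kernel W G \<phi>"
    and fin: "finite (carrier L)"
  shows "card (\<phi> ` T ` kernel W G \<phi>) dvd order L"
proof -
  interpret \<phi>: group_hom W G \<phi> by (rule \<phi>)
  interpret \<psi>: group_hom W L \<psi> by (rule \<psi>)
  interpret T: group_hom W W T by unfold_locales (rule T)
  let ?M = "kernel W G \<phi>"
  let ?A = "L\<lparr>carrier := \<psi> ` ?M\<rparr>"
  have M: "subgroup ?M W" by (rule \<phi>.subgroup_kernel)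
  have A: "subgroup (\<psi> ` ?M) L" by (rule \<psi>.subgroup_img_is_subgroup[OF M])
  have gA: "group ?A" using A \<psi>.H.group_axioms by (rule subgroup.subgroup_is_group)
  \<comment> \<open>A preimage in the kernel of \<open>\<phi>\<close> is chosen arbitrarily;
    \<open>eq\<close> shows that the value does not depend on it.\<close>
  define f where "f a = \<phi> (T (inv_into ?M \<psi> a))" for a
  have sub: "m \<in> carrier W" if "m \<in> ?M" for m using that by (simp add: kernel_def)
  \<comment> \<open>The quotient of \<open>x\<close> by \<open>y\<close> lies in both kernels, so
    \<open>T\<close> sends it into the kernel of \<open>\<phi>\<close>.\<close>
  have eq: "\<phi> (T x) = \<phi> (T y)" if xy: "x \<in> ?M" "y \<in> ?M" "\<psi> x = \<psi> y" for x y
  proof -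
    have c: "x \<in> carrier W" "y \<in> carrier W" using sub xy by blast+
    then have Tc: "T x \<in> carrier W" "T y \<in> carrier W" by simp_all
    have "x \<otimes>\<^bsub>W\<^esub> inv\<^bsub>W\<^esub> y \<in> ?M"
      using xy M by (simp add: subgroup.m_closed subgroup.m_inv_closed)
    moreover
    have "\<psi> (x \<otimes>\<^bsub>W\<^esub> inv\<^bsub>W\<^esub> y) = \<one>\<^bsub>L\<^esub>" using c xy(3) by simp
    then have "x \<otimes>\<^bsub>W\<^esub> inv\<^bsub>W\<^esub> y \<in> kernel W L \<psi>" using c by (simp add: kernel_def)
    ultimately have "T (x \<otimes>\<^bsub>W\<^esub> inv\<^bsub>W\<^esub> y) \<in> ?M"
      using inv by blast
    then have "\<phi> (T x) \<otimes>\<^bsub>G\<^esub> inv\<^bsub>G\<^esub> (\<phi> (T y)) = \<one>\<^bsub>G\<^esub>"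
      using c Tc by (simp add: kernel_def)
    then have "inv\<^bsub>G\<^esub> (inv\<^bsub>G\<^esub> (\<phi> (T y))) = \<phi> (T x)"
      using Tc by (intro \<phi>.H.inv_equality) simp_all
    then show ?thesis using Tc by simp
  qed
  have f: "f (\<psi> m) = \<phi> (T m)" if "m \<in> ?M" for m
    unfolding f_def by (rule eq) (use that in \<open>auto intro: inv_into_into simp: f_inv_into_f\<close>)
  interpret f: group_hom ?A G f
  proof (intro group_hom.intro gA \<phi>.H.group_axioms group_hom_axioms.intro homI)
    show "f x \<in> carrier G" if x: "x \<in> carrier ?A" for x
    proof -
      obtain m where "m \<in> ?M" "x = \<psi> m" using x by auto
      moreover from this have "m \<in> carrier W" using sub by blast
      ultimately show ?thesis by (simp add: f)
    qed
    show "f (x \<otimes>\<^bsub>?A\<^esub> y) = f x \<otimes>\<^bsub>G\<^esub> f y" if xy: "x \<in> carrier ?A" "y \<in> carrier ?A" for x y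
    proof -
      obtain m m' where m: "m \<in> ?M" "m' \<in> ?M" "x = \<psi> m" "y = \<psi> m'" using xy by auto
      have "f (\<psi> (m \<otimes>\<^bsub>W\<^esub> m')) = \<phi> (T (m \<otimes>\<^bsub>W\<^esub> m'))"
        using m M by (intro f) (simp add: subgroup.m_closed)
      moreover have "m \<in> carrier W" "m' \<in> carrier W" using m sub by blast+
      ultimately show ?thesis using m by (simp add: f)
    qed
  qed
  have "f ` carrier ?A = \<phi> ` T ` ?M" by (auto simp: f image_image)
  moreover have "finite (carrier ?A)" using A fin finite_subset[OF subgroup.subset] by auto
  ultimately have "card (\<phi> ` T ` ?M) dvd order ?A" using f.card_image_dvd_order by simp
  also have "order ?A = card (\<psi> ` ?M)" by (simp add: order_def)
  also have "\<dots> dvd order L"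
    using \<psi>.H.lagrange[OF A] by (metis dvd_triv_right)
  finally show ?thesis .
qed

lemma order_kernel_quotient:
  assumes \<phi>: "group_hom W G \<phi>" and "C \<subseteq> carrier W"
  shows "order (W\<lparr>carrier := kernel W G \<phi> <#>\<^bsub>W\<^esub> C\<rparr> Mod kernel W G \<phi>) = card (\<phi> ` C)"
proof -
  interpret \<phi>: group_hom W G \<phi> by (rule \<phi>)
  let ?M = "kernel W G \<phi>" and ?D = "kernel W G \<phi> <#>\<^bsub>W\<^esub> C"
  have D: "?D \<subseteq> carrier W"
    using assms(2) by (auto simp: set_mult_def kernel_def)
  have "carrier (W\<lparr>carrier := ?D\<rparr> Mod ?M) = (\<lambda>a. ?M #>\<^bsub>W\<^esub> a) ` ?D"
    by (auto simp: FactGroup_def RCOSETS_def r_coset_def)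
  then have "order (W\<lparr>carrier := ?D\<rparr> Mod ?M) = card ((\<lambda>a. ?M #>\<^bsub>W\<^esub> a) ` ?D)"
    by (simp add: order_def)
  also have "\<dots> = card (\<phi> ` ?D)"
    by (rule card_image_cong_kernel, rule \<phi>.kernel_coset_eq_iff) (use D in auto)
  also have "\<phi> ` ?D = \<phi> ` C"
  proof (intro equalityI subsetI)
    fix y assume "y \<in> \<phi> ` C"
    then obtain c where c: "c \<in> C" "y = \<phi> c" by blast
    then have "\<one>\<^bsub>W\<^esub> \<otimes>\<^bsub>W\<^esub> c \<in> ?D" unfolding set_mult_def by (force simp: kernel_def)
    then show "y \<in> \<phi> ` ?D" using c assms(2) by (metis \<phi>.G.l_one image_eqI subsetD)
  next
    fix y assume "y \<in> \<phi> ` ?D"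
    then obtain m c where "m \<in> ?M" "c \<in> C" "y = \<phi> (m \<otimes>\<^bsub>W\<^esub> c)"
      unfolding set_mult_def by blast
    then show "y \<in> \<phi> ` C" using assms(2) by (auto simp: kernel_def subset_iff)
  qed
  finally show ?thesis .
qed

section \<open>The group \<open>W\<^sup>+\<close>\<close>

(* Otherwise the simplifier rewrites the parameter {1..n-1} of the interpretation below. *)
declare One_nat_def [simp del]

abbreviation rotation_word :: "nat \<Rightarrow> nat \<Rightarrow> (nat \<times> bool) list"
  where "rotation_word i j \<equiv> map (\<lambda>l. (l, True)) [i..<Suc j]"

interpretation Wplus: group_presentation "{1..n-1}" "Wplus_relators n" for n
  by unfold_locales (auto simp: Wplus_relators_def)

lemma group_Wplus: "group (Wplus n)"
  unfolding Wplus_def by (rule Wplus.group_presented_group)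

text \<open>Each relator is the square of a rotation word, spelled out as one list. The hypothesis
  states it as a square in \<open>G\<close>, the form in which it is verified for rotations.\<close>

lemma Wplus_map_intro:
  assumes "group G" and g: "\<And>i. 1 \<le> i \<Longrightarrow> i \<le> n - 1 \<Longrightarrow> g i \<in> carrier G"
    and rel: "\<And>i j. 1 \<le> i \<Longrightarrow> i < j \<Longrightarrow> j \<le> n - 1 \<Longrightarrow>
      word_value G g (rotation_word i j) \<otimes>\<^bsub>G\<^esub> word_value G g (rotation_word i j) = \<one>\<^bsub>G\<^esub>"
  shows "presented_group_map {1..n-1} (Wplus_relators n) G g"
proof -
  interpret G: group G by fact
  \<comment> \<open>Multiplicativity of \<open>word_value\<close> is proved by hand, because the
    locale that provides it also assumes that relators are trivial, which is the goal.\<close>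
  have app: "word_value G g (map (\<lambda>l. (l, True)) (u @ v))
      = word_value G g (map (\<lambda>l. (l, True)) u) \<otimes>\<^bsub>G\<^esub> word_value G g (map (\<lambda>l. (l, True)) v)
      \<and> word_value G g (map (\<lambda>l. (l, True)) u) \<in> carrier G"
    if "set u \<subseteq> {1..n-1}" "set v \<subseteq> {1..n-1}" for u v
  proof -
    have cl: "word_value G g (map (\<lambda>l. (l, True)) u) \<in> carrier G" if "set u \<subseteq> {1..n-1}" for u
      using that by (induction u) (auto intro!: G.m_closed g)
    show ?thesis
      using that by (induction u) (auto simp: G.m_assoc cl g)
  qed
  show ?thesis
  proof unfold_locales
    show "g i \<in> carrier G" if "i \<in> {1..n-1}" for i using that g by simp
    fix w assume "w \<in> Wplus_relators n"
    then obtain i j where ij: "1 \<le> i" "i < j" "j \<le> n - 1"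
      and w: "w = map (\<lambda>l. (l, True)) ([i..<Suc j] @ [i..<Suc j])"
      by (auto simp: Wplus_relators_def)
    have "set [i..<Suc j] \<subseteq> {1..n-1}" using ij by auto
    from app[OF this this] rel[OF ij] show "word_value G g w = \<one>\<^bsub>G\<^esub>"
      unfolding w by simp
  qed
qed

lemma word_value_rotation_word:
  assumes "i \<le> j"
  shows "word_value G g (rotation_word i j) = g i \<otimes>\<^bsub>G\<^esub> word_value G g (rotation_word (Suc i) j)"
  using assms by (simp add: upt_conv_Cons del: upt_Suc)

lemma word_value_cong_gens:
  "(\<And>x b. (x, b) \<in> set w \<Longrightarrow> g x = g' x) \<Longrightarrow> word_value G g w = word_value G g' w"
proof (induction w)
  case (Cons l w)
  obtain x b where "l = (x, b)" by (cases l)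
  moreover have "g x = g' x" if "l = (x, b)" using Cons.prems[of x b] that by simp
  moreover have "word_value G g w = word_value G g' w" by (rule Cons.IH) (use Cons.prems in auto)
  ultimately show ?case by simp
qed simp

lemma Wplus_gen_conv: "Wplus_gen n i = Wplus.word_class n [(i, True)]"
  by (simp add: Wplus_gen_def Wplus.word_class_def)

lemma Wplus_gen_closed: "1 \<le> i \<Longrightarrow> i \<le> n - 1 \<Longrightarrow> Wplus_gen n i \<in> carrier (Wplus n)"
  unfolding Wplus_gen_conv Wplus_def by (rule Wplus.word_class_in_carrier) simp

lemma word_value_Wplus_gen:
  assumes "set w \<subseteq> {1..n-1}"
  shows "word_value (Wplus n) (Wplus_gen n) (map (\<lambda>l. (l, True)) w)
    = Wplus.word_class n (map (\<lambda>l. (l, True)) w)"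
  using assms
proof (induction w)
  case Nil
  then show ?case by (simp add: Wplus_def Wplus.one_presented_group)
next
  case (Cons x w)
  have "map (\<lambda>l. (l, True)) w \<in> Wplus.words n"
    using Cons.prems by (auto simp: Wplus.words_def)
  then show ?case
    using Cons by (simp add: Wplus_gen_conv Wplus_def Wplus.word_class_mult)
qed

lemma Wplus_rotation_relation:
  assumes "1 \<le> i" "i < j" "j \<le> n - 1"
  shows "word_value (Wplus n) (Wplus_gen n) (rotation_word i j) \<otimes>\<^bsub>Wplus n\<^esub>
    word_value (Wplus n) (Wplus_gen n) (rotation_word i j) = \<one>\<^bsub>Wplus n\<^esub>"
proof -
  have s: "set [i..<Suc j] \<subseteq> {1..n-1}" using assms by auto
  have w: "rotation_word i j \<in> Wplus.words n"
    using assms by (auto simp: Wplus.words_def)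
  have "rotation_word i j @ rotation_word i j \<in> Wplus_relators n"
    unfolding Wplus_relators_def using assms by (intro CollectI exI[of _ i] exI[of _ j]) simp
  then have "(rotation_word i j @ rotation_word i j, []) \<in> pres_rel {1..n-1} (Wplus_relators n)"
    using Wplus.pres_rel_intros(5)[where u = "[]" and v = "[]"] by fastforce
  then show ?thesis
    unfolding word_value_Wplus_gen[OF s] using w
    by (simp only: Wplus_def Wplus.word_class_mult Wplus.one_presented_group
        Wplus.word_class_eq_iff Wplus.append_words Wplus.Nil_words)
qed

text \<open>The images \<open>y\<close> must satisfy the relations. Rotation words starting at 3 or
  later are unchanged, and so are those starting at 1 and reaching at least 2, since the inverse of
  \<sigma>_1 cancels against the square in front of \<sigma>_2. For those starting at 2, put a =
  \<sigma>_1 and t = \<sigma>_2...\<sigma>_j: from tt = 1 and atat = 1 follows ata = t, hence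
  (aat)(aat) = a(ata)at = atat = 1.\<close>

lemma Wplus_bar_hom:
  assumes "n \<ge> 3"
  shows "Wplus_bar n \<in> hom (Wplus n) (Wplus n)"
proof -
  interpret W: group "Wplus n" by (rule group_Wplus)
  let ?x = "Wplus_gen n"
  define y where "y = (\<lambda>i. if i = 1 then inv\<^bsub>Wplus n\<^esub> (Wplus_gen n 1)
          else if i = 2 then (Wplus_gen n 1 [^]\<^bsub>Wplus n\<^esub> (2::nat)) \<otimes>\<^bsub>Wplus n\<^esub> Wplus_gen n 2
          else Wplus_gen n i)"
  define r where "r i j = word_value (Wplus n) ?x (rotation_word i j)" for i j
  define q where "q i j = word_value (Wplus n) y (rotation_word i j)" for i j
  have x: "?x i \<in> carrier (Wplus n)" if "1 \<le> i" "i \<le> n - 1" for i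
    using that by (rule Wplus_gen_closed)
  have x12: "?x 1 \<in> carrier (Wplus n)" "?x 2 \<in> carrier (Wplus n)" using x assms by auto
  have y12: "y 1 = inv\<^bsub>Wplus n\<^esub> (?x 1)" "y 2 = ?x 1 \<otimes>\<^bsub>Wplus n\<^esub> ?x 1 \<otimes>\<^bsub>Wplus n\<^esub> ?x 2"
    using x12 by (simp_all add: y_def W.nat_pow_Suc numeral_2_eq_2)
  have y: "y i \<in> carrier (Wplus n)" if "1 \<le> i" "i \<le> n - 1" for i
    using that x x12 by (simp add: y_def)
  have rr: "r i j \<otimes>\<^bsub>Wplus n\<^esub> r i j = \<one>\<^bsub>Wplus n\<^esub>" if "1 \<le> i" "i < j" "j \<le> n - 1" for i j
    unfolding r_def using that by (rule Wplus_rotation_relation)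
  have r: "r i j \<in> carrier (Wplus n)" if "1 \<le> i" "j \<le> n - 1" for i j
  proof -
    have s: "set [i..<Suc j] \<subseteq> {1..n-1}" using that by auto
    show ?thesis
      unfolding r_def word_value_Wplus_gen[OF s] unfolding Wplus_def
      by (rule Wplus.word_class_in_carrier) (use that in \<open>auto simp: Wplus.words_def\<close>)
  qed
  have q3: "q i j = r i j" if "3 \<le> i" for i j
    unfolding q_def r_def using that by (intro word_value_cong_gens) (auto simp: y_def)
  have q2: "q 2 j = ?x 1 \<otimes>\<^bsub>Wplus n\<^esub> (?x 1 \<otimes>\<^bsub>Wplus n\<^esub> r 2 j)" if "2 \<le> j" "j \<le> n - 1" for j
  proof -
    have "q 2 j = y 2 \<otimes>\<^bsub>Wplus n\<^esub> q 3 j" "r 2 j = ?x 2 \<otimes>\<^bsub>Wplus n\<^esub> r 3 j"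
      using that word_value_rotation_word[of 2 j] by (simp_all add: q_def r_def del: upt_Suc)
    then show ?thesis using that x12 r[of 3 j] by (simp add: q3 y12 W.m_assoc)
  qed
  have r1: "r 1 j = ?x 1 \<otimes>\<^bsub>Wplus n\<^esub> r 2 j" if "2 \<le> j" for j
    using that word_value_rotation_word[of 1 j] by (simp add: r_def del: upt_Suc)
  have q1: "q 1 j = r 1 j" if "2 \<le> j" "j \<le> n - 1" for j
  proof -
    have "q 1 j = y 1 \<otimes>\<^bsub>Wplus n\<^esub> q 2 j"
      using that word_value_rotation_word[of 1 j] by (simp add: q_def del: upt_Suc)
    then show ?thesis
      using that x12 r[of 2 j] by (simp add: q2 r1 y12 flip: W.m_assoc)
  qed
  have qq: "q i j \<otimes>\<^bsub>Wplus n\<^esub> q i j = \<one>\<^bsub>Wplus n\<^esub>" if ij: "1 \<le> i" "i < j" "j \<le> n - 1" for i j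
  proof -
    consider "i = 1" | "i = 2" | "3 \<le> i" using ij by linarith
    then show ?thesis
    proof cases
      case 1
      then show ?thesis using ij q1[of j] rr[of 1 j] by simp
    next
      case 2
      let ?a = "?x 1" and ?t = "r 2 j"
      have cl: "?a \<in> carrier (Wplus n)" "?t \<in> carrier (Wplus n)"
        using x12 r[of 2 j] ij by auto
      have tt: "?t \<otimes>\<^bsub>Wplus n\<^esub> ?t = \<one>\<^bsub>Wplus n\<^esub>" using rr[of 2 j] ij 2 by simp
      have atat: "?a \<otimes>\<^bsub>Wplus n\<^esub> ?t \<otimes>\<^bsub>Wplus n\<^esub> ?a \<otimes>\<^bsub>Wplus n\<^esub> ?t = \<one>\<^bsub>Wplus n\<^esub>"
        using rr[of 1 j] ij 2 cl by (simp add: r1 W.m_assoc)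
      \<comment> \<open>Both \<open>atat\<close> and \<open>tt\<close> are trivial; the last factor
        \<open>t\<close> is cancelled.\<close>
      then have ata: "?a \<otimes>\<^bsub>Wplus n\<^esub> ?t \<otimes>\<^bsub>Wplus n\<^esub> ?a = ?t"
        using cl tt by (metis W.m_closed W.right_cancel)
      have "q i j \<otimes>\<^bsub>Wplus n\<^esub> q i j
          = ?a \<otimes>\<^bsub>Wplus n\<^esub> (?a \<otimes>\<^bsub>Wplus n\<^esub> ?t \<otimes>\<^bsub>Wplus n\<^esub> ?a) \<otimes>\<^bsub>Wplus n\<^esub> ?a \<otimes>\<^bsub>Wplus n\<^esub> ?t"
        using 2 ij cl by (simp add: q2 W.m_assoc)
      also have "\<dots> = \<one>\<^bsub>Wplus n\<^esub>" unfolding ata by (rule tt)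
      finally show ?thesis .
    next
      case 3
      then show ?thesis using ij q3 rr by simp
    qed
  qed
  interpret presented_group_map "{1..n-1}" "Wplus_relators n" "Wplus n" y
    by (rule Wplus_map_intro) (use y qq in \<open>auto simp: q_def W.group_axioms simp del: upt_Suc\<close>)
  show ?thesis
    using presented_hom_hom unfolding Wplus_bar_def y_def[symmetric] by (simp add: Wplus_def)
qed

lemma Wplus_kernel_hom:
  assumes "presented_group_map {1..n-1} (Wplus_relators n) G g"
  shows "group_hom (Wplus n) G (presented_hom G g)"
proof -
  interpret presented_group_map "{1..n-1}" "Wplus_relators n" G g by fact
  show ?thesis
    using presented_hom_hom group_Wplus
    by (intro group_hom.intro group_axioms group_hom_axioms.intro) (auto simp: Wplus_def)
qed

text \<open>A word is evaluated coordinate by coordinate, also inside the generated subgroup, and a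
  pair is trivial exactly if both coordinates are. This is N = M \<inter> K for the mix.\<close>

lemma Wplus_kernel_mix:
  assumes "presented_group_map {1..n-1} (Wplus_relators n) G g"
    and "presented_group_map {1..n-1} (Wplus_relators n) H h"
  shows "Wplus_kernel n (subgroup_generated (G \<times>\<times> H) ((\<lambda>i. (g i, h i)) ` {1..n-1})) (\<lambda>i. (g i, h i))
    = Wplus_kernel n G g \<inter> Wplus_kernel n H h"
proof -
  interpret G: presented_group_map "{1..n-1}" "Wplus_relators n" G g by fact
  interpret H: presented_group_map "{1..n-1}" "Wplus_relators n" H h by fact
  interpret GH: group "G \<times>\<times> H" by (rule DirProd_group[OF G.group_axioms H.group_axioms])
  let ?p = "\<lambda>i. (g i, h i)"
  let ?K = "subgroup_generated (G \<times>\<times> H) (?p ` {1..n-1})"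
  interpret K: group ?K by simp
  have p: "?p i \<in> carrier ?K" if "i \<in> {1..n-1}" for i
  proof -
    have "?p ` {1..n-1} \<subseteq> carrier (G \<times>\<times> H)" using G.gen_closed H.gen_closed by auto
    then have "?p ` {1..n-1} \<subseteq> carrier ?K" by (rule GH.subgroup_generated_subset_carrier_subset)
    then show ?thesis using that by blast
  qed
  have val: "word_value ?K ?p w = (word_value G g w, word_value H h w)"
    if "w \<in> Wplus.words n" for w
    using that
  proof (induction w)
    case (Cons l w)
    obtain x b where l: "l = (x, b)" by (cases l)
    have x: "x \<in> {1..n-1}" using Cons.prems l by simp
    have "inv\<^bsub>?K\<^esub> (?p x) = (inv\<^bsub>G\<^esub> (g x), inv\<^bsub>H\<^esub> (h x))"
      using p[OF x] G.gen_closed[OF x] H.gen_closed[OF x]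
      by (simp add: GH.inv_subgroup_generated inv_DirProd G.group_axioms H.group_axioms)
    then show ?case using Cons l by simp
  qed (simp add: one_DirProd)
  interpret presented_group_map "{1..n-1}" "Wplus_relators n" ?K ?p
  proof unfold_locales
    fix w assume w: "w \<in> Wplus_relators n"
    then have "w \<in> Wplus.words n" using Wplus.words_subset by blast
    then show "word_value ?K ?p w = \<one>\<^bsub>?K\<^esub>"
      using val G.relator_value[OF w] H.relator_value[OF w] by (simp add: one_DirProd)
  qed (rule p)
  have "presented_hom ?K ?p A = \<one>\<^bsub>?K\<^esub> \<longleftrightarrow> presented_hom G g A = \<one>\<^bsub>G\<^esub> \<and> presented_hom H h A = \<one>\<^bsub>H\<^esub>"
    if A: "A \<in> carrier (Wplus n)" for A
  proof -
    obtain w where "w \<in> Wplus.words n" "A = Wplus.word_class n w"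
      using A unfolding Wplus_def by (rule Wplus.presented_group_carrierE)
    then show ?thesis
      by (simp add: presented_hom_word_class G.presented_hom_word_class H.presented_hom_word_class
          val one_DirProd)
  qed
  then show ?thesis by (auto simp: Wplus_kernel_def kernel_def)
qed

declare One_nat_def [simp]

section \<open>Automorphism groups\<close>

abbreviation Aut :: "'a rel \<Rightarrow> ('a \<Rightarrow> 'a) monoid" where "Aut \<equiv> automorphism_group"

lemma mem_automorphism_group:
  "f \<in> carrier (Aut r) \<longleftrightarrow>
     f \<in> extensional (Field r) \<and> bij_betw f (Field r) (Field r) \<and>
     (\<forall>F \<in> Field r. \<forall>G \<in> Field r. (F, G) \<in> r \<longleftrightarrow> (f F, f G) \<in> r)"
  by (simp add: automorphism_group_def)

lemma mult_automorphism_group: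
  "f \<otimes>\<^bsub>Aut r\<^esub> g = compose (Field r) g f"
  by (simp add: automorphism_group_def)

lemma one_automorphism_group: "\<one>\<^bsub>Aut r\<^esub> = (\<lambda>F \<in> Field r. F)"
  by (simp add: automorphism_group_def)

lemma automorphism_bij: "f \<in> carrier (Aut r) \<Longrightarrow> bij_betw f (Field r) (Field r)"
  by (simp add: mem_automorphism_group)

lemma automorphism_Field: "f \<in> carrier (Aut r) \<Longrightarrow> F \<in> Field r \<Longrightarrow> f F \<in> Field r"
  using automorphism_bij bij_betwE by fastforce

lemma automorphism_le_iff:
  "f \<in> carrier (Aut r) \<Longrightarrow> F \<in> Field r \<Longrightarrow> G \<in> Field r \<Longrightarrow>
     (f F, f G) \<in> r \<longleftrightarrow> (F, G) \<in> r"
  by (simp add: mem_automorphism_group)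

lemma automorphism_inj:
  "f \<in> carrier (Aut r) \<Longrightarrow> F \<in> Field r \<Longrightarrow> G \<in> Field r \<Longrightarrow> f F = f G \<longleftrightarrow> F = G"
  using automorphism_bij[of f r] by (auto simp: bij_betw_def inj_on_def)

lemma group_automorphism_group: "group (Aut r)"
proof (rule groupI)
  let ?A = "Aut r"
  show "f \<otimes>\<^bsub>?A\<^esub> g \<in> carrier ?A" if "f \<in> carrier ?A" "g \<in> carrier ?A" for f g
  proof -
    have "bij_betw (compose (Field r) g f) (Field r) (Field r)"
      using that by (blast intro: bij_betw_compose automorphism_bij)
    then show ?thesis
      using that by (simp add: mult_automorphism_group mem_automorphism_group[of "compose _ _ _"]
          compose_eq automorphism_le_iff automorphism_Field)
  qed
  show "\<one>\<^bsub>?A\<^esub> \<in> carrier ?A"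
    by (auto simp: mem_automorphism_group one_automorphism_group bij_betw_def inj_on_def)
  show "f \<otimes>\<^bsub>?A\<^esub> g \<otimes>\<^bsub>?A\<^esub> h = f \<otimes>\<^bsub>?A\<^esub> (g \<otimes>\<^bsub>?A\<^esub> h)"
    if "f \<in> carrier ?A" "g \<in> carrier ?A" "h \<in> carrier ?A" for f g h
    using that by (auto simp: mult_automorphism_group compose_def fun_eq_iff automorphism_Field)
  show "\<one>\<^bsub>?A\<^esub> \<otimes>\<^bsub>?A\<^esub> f = f" if "f \<in> carrier ?A" for f
    using that by (auto simp: mult_automorphism_group one_automorphism_group
        mem_automorphism_group compose_def fun_eq_iff extensional_def)
  show "\<exists>g\<in>carrier ?A. g \<otimes>\<^bsub>?A\<^esub> f = \<one>\<^bsub>?A\<^esub>" if f: "f \<in> carrier ?A" for f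
  proof
    \<comment> \<open>The inverse map has to be cut down to \<open>Field r\<close>, because
      automorphisms are extensional.\<close>
    let ?g = "\<lambda>F \<in> Field r. inv_into (Field r) f F"
    have img: "f ` Field r = Field r" using automorphism_bij[OF f] by (simp add: bij_betw_def)
    show "?g \<otimes>\<^bsub>?A\<^esub> f = \<one>\<^bsub>?A\<^esub>"
      using img by (simp add: mult_automorphism_group one_automorphism_group compose_id_inv_into)
    have "bij_betw ?g (Field r) (Field r)"
      using bij_betw_inv_into[OF automorphism_bij[OF f]] by simp
    moreover have "(F, G) \<in> r \<longleftrightarrow> (inv_into (Field r) f F, inv_into (Field r) f G) \<in> r"
      if "F \<in> Field r" "G \<in> Field r" for F G
    proof -
      have "inv_into (Field r) f F \<in> Field r" "inv_into (Field r) f G \<in> Field r"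
        using that img by (simp_all add: inv_into_into)
      then show ?thesis
        using automorphism_le_iff[OF f, of "inv_into (Field r) f F" "inv_into (Field r) f G"] that img
        by (simp add: f_inv_into_f)
    qed
    ultimately show "?g \<in> carrier ?A" by (simp add: mem_automorphism_group)
  qed
qed

lemma finite_automorphism_group:
  assumes "finite (Field r)"
  shows "finite (carrier (Aut r))"
proof -
  have "carrier (Aut r) \<subseteq> Field r \<rightarrow>\<^sub>E Field r"
  proof
    fix f assume "f \<in> carrier (Aut r)"
    then show "f \<in> Field r \<rightarrow>\<^sub>E Field r"
      using automorphism_Field[of f r] by (simp add: PiE_def Pi_def mem_automorphism_group)
  qed
  then show ?thesis using assms by (meson finite_PiE finite_subset)
qed

section \<open>Flags\<close>

text \<open>What is needed for a rank function that behaves well on flags. It is separated from the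
  diamond condition because for the toroid that condition is proved with the help of ranks.\<close>

locale flag_graded_poset =
  fixes n :: nat and r :: "'a rel"
  assumes finite_Field: "finite (Field r)"
    and partial_order: "partial_order_on (Field r) r"
    and card_flag: "\<Phi> \<in> flags r \<Longrightarrow> card \<Phi> = n + 2"
begin

lemma le_refl: "F \<in> Field r \<Longrightarrow> (F, F) \<in> r"
  using partial_order by (auto simp: partial_order_on_def preorder_on_def refl_on_def)

lemma le_trans: "(F, G) \<in> r \<Longrightarrow> (G, H) \<in> r \<Longrightarrow> (F, H) \<in> r"
  using partial_order unfolding partial_order_on_def preorder_on_def by (blast dest: transD)

lemma le_antisym: "(F, G) \<in> r \<Longrightarrow> (G, F) \<in> r \<Longrightarrow> F = G"
  using partial_order unfolding partial_order_on_def by (blast dest: antisymD)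

lemma chain_Field: "C \<in> Chains r \<Longrightarrow> C \<subseteq> Field r"
  by (auto simp: Chains_def Field_def)

lemma finite_chain: "C \<in> Chains r \<Longrightarrow> finite C"
  using chain_Field finite_Field finite_subset by blast

lemma flag_chain: "\<Phi> \<in> flags r \<Longrightarrow> \<Phi> \<in> Chains r"
  by (simp add: flags_def)

lemma finite_flag: "\<Phi> \<in> flags r \<Longrightarrow> finite \<Phi>"
  by (simp add: flag_chain finite_chain)

lemma flag_Field: "\<Phi> \<in> flags r \<Longrightarrow> F \<in> \<Phi> \<Longrightarrow> F \<in> Field r"
  using flag_chain chain_Field by blast

lemma chain_extends_to_flag:
  assumes "C \<in> Chains r"
  obtains \<Phi> where "\<Phi> \<in> flags r" "C \<subseteq> \<Phi>"
proof -
  let ?S = "{D \<in> Chains r. C \<subseteq> D}"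
  have "?S \<subseteq> Pow (Field r)" using chain_Field by blast
  then have "finite ?S" using finite_Field by (meson finite_Pow_iff finite_subset)
  moreover have "C \<in> ?S" using assms by simp
  ultimately obtain \<Phi> where \<Phi>: "\<Phi> \<in> ?S" "\<And>D. D \<in> ?S \<Longrightarrow> \<Phi> \<subseteq> D \<Longrightarrow> D = \<Phi>"
    using finite_has_maximal[of ?S] by (metis (no_types, lifting) empty_iff)
  then have "\<Phi> \<in> flags r" by (auto simp: flags_def)
  with \<Phi> that show ?thesis by blast
qed

lemma card_chain_le: "C \<in> Chains r \<Longrightarrow> card C \<le> n + 2"
  by (metis card_flag card_mono chain_extends_to_flag finite_flag)

lemma chain_is_flag:
  assumes "C \<in> Chains r" "card C = n + 2"
  shows "C \<in> flags r"
  by (metis assms card_flag card_subset_eq chain_extends_to_flag finite_flag)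

lemma face_in_flag:
  assumes "F \<in> Field r"
  obtains \<Phi> where "\<Phi> \<in> flags r" "F \<in> \<Phi>"
proof -
  have "{F} \<in> Chains r" using assms by (simp add: Chains_def le_refl)
  then show ?thesis using chain_extends_to_flag that by blast
qed

text \<open>\<open>face_rank\<close> is a maximum over all chains below \<open>F\<close>, inside the
  flag or not. Any such chain can be topped up with the part of the flag from \<open>F\<close>
  upwards, and no chain has more than \<open>n + 2\<close> elements, so the flag attains the
  maximum.\<close>

lemma rank_in_flag:
  assumes \<Phi>: "\<Phi> \<in> flags r" and F: "F \<in> \<Phi>"
  shows "face_rank r F = int (card {G \<in> \<Phi>. strictly_below r G F}) - 1"
proof -
  let ?B = "{C \<in> Chains r. \<forall>G \<in> C. strictly_below r G F}"
  let ?L = "{G \<in> \<Phi>. strictly_below r G F}" and ?U = "{G \<in> \<Phi>. (F, G) \<in> r}"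
  have ch: "(G, H) \<in> r \<or> (H, G) \<in> r" if "G \<in> \<Phi>" "H \<in> \<Phi>" for G H
    using flag_chain[OF \<Phi>] that by (auto simp: Chains_def)
  have fin: "finite ?L" "finite ?U" using finite_flag[OF \<Phi>] by auto
  \<comment> \<open>\<open>F\<close> itself is counted in \<open>?U\<close>, which is defined by the
    reflexive order.\<close>
  have "\<Phi> = ?L \<union> ?U" "?L \<inter> ?U = {}"
    using ch F by (auto simp: strictly_below_def intro: le_antisym)
  then have sum: "card ?L + card ?U = n + 2"
    using card_Un_disjoint[OF fin] card_flag[OF \<Phi>] by metis
  have "?B \<subseteq> Pow (Field r)" using chain_Field by blast
  then have finB: "finite (card ` ?B)" using finite_Field by (meson finite_Pow_iff finite_subset finite_imageI)
  have "Max (card ` ?B) = card ?L"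
  proof (rule Max_eqI[OF finB])
    have "?L \<in> ?B" using flag_chain[OF \<Phi>] by (auto simp: Chains_def)
    then show "card ?L \<in> card ` ?B" by blast
    fix k assume "k \<in> card ` ?B"
    then obtain C where C: "C \<in> Chains r" "\<forall>G \<in> C. strictly_below r G F" "k = card C" by blast
    have CU: "(G, H) \<in> r" if "G \<in> C" "H \<in> ?U" for G H
      using that C(2) le_trans by (auto simp: strictly_below_def)
    have "C \<union> ?U \<in> Chains r"
      using C(1) CU ch unfolding Chains_def by blast
    moreover have "C \<inter> ?U = {}"
      using C(2) by (auto simp: strictly_below_def intro: le_antisym)
    ultimately show "k \<le> card ?L"
      using card_chain_le[of "C \<union> ?U"] card_Un_disjoint[of C ?U] fin finite_chain[OF C(1)] sum C(3)
      by simp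
  qed
  then show ?thesis by (simp add: face_rank_def)
qed

lemma rank_strict_mono_in_flag:
  assumes \<Phi>: "\<Phi> \<in> flags r" and "F \<in> \<Phi>" "G \<in> \<Phi>" "strictly_below r F G"
  shows "face_rank r F < face_rank r G"
proof -
  have "{H \<in> \<Phi>. strictly_below r H F} \<subset> {H \<in> \<Phi>. strictly_below r H G}"
    using assms by (auto simp: strictly_below_def dest: le_antisym le_trans)
  then have "card {H \<in> \<Phi>. strictly_below r H F} < card {H \<in> \<Phi>. strictly_below r H G}"
    using finite_flag[OF \<Phi>] by (intro psubset_card_mono) auto
  then show ?thesis using assms by (simp add: rank_in_flag)
qed

lemma flag_linear:
  assumes "\<Phi> \<in> flags r" "F \<in> \<Phi>" "G \<in> \<Phi>"
  shows "strictly_below r F G \<or> F = G \<or> strictly_below r G F"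
  using flag_chain[OF assms(1)] assms by (auto simp: Chains_def strictly_below_def)

lemma rank_less_iff:
  assumes "\<Phi> \<in> flags r" "F \<in> \<Phi>" "G \<in> \<Phi>"
  shows "face_rank r F < face_rank r G \<longleftrightarrow> strictly_below r F G"
  using flag_linear[OF assms] rank_strict_mono_in_flag assms by force

lemma rank_eq_iff:
  assumes "\<Phi> \<in> flags r" "F \<in> \<Phi>" "G \<in> \<Phi>"
  shows "face_rank r F = face_rank r G \<longleftrightarrow> F = G"
  using flag_linear[OF assms] rank_strict_mono_in_flag assms by force

text \<open>The \<open>n + 2\<close> faces of a flag have distinct ranks, and only
  \<open>n + 2\<close> ranks are available.\<close>

lemma ranks_of_flag:
  assumes \<Phi>: "\<Phi> \<in> flags r"
  shows "face_rank r ` \<Phi> = {-1..int n}"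
proof (rule card_subset_eq)
  have "card {G \<in> \<Phi>. strictly_below r G F} < n + 2" if "F \<in> \<Phi>" for F
  proof -
    have "{G \<in> \<Phi>. strictly_below r G F} \<subset> \<Phi>" using that by (auto simp: strictly_below_def)
    then show ?thesis using psubset_card_mono[OF finite_flag[OF \<Phi>]] card_flag[OF \<Phi>] by metis
  qed
  then show "face_rank r ` \<Phi> \<subseteq> {-1..int n}" using \<Phi> by (force simp: rank_in_flag)
  have "inj_on (face_rank r) \<Phi>" using rank_eq_iff[OF \<Phi>] by (auto intro: inj_onI)
  then show "card (face_rank r ` \<Phi>) = card {-1..int n}"
    using card_flag[OF \<Phi>] by (simp add: card_image)
qed simp

definition flag_face :: "'a set \<Rightarrow> int \<Rightarrow> 'a" where
  "flag_face \<Phi> k = (THE F. F \<in> \<Phi> \<and> face_rank r F = k)"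

lemma flag_face:
  assumes "\<Phi> \<in> flags r" "-1 \<le> k" "k \<le> int n"
  shows "flag_face \<Phi> k \<in> \<Phi>" "face_rank r (flag_face \<Phi> k) = k"
proof -
  have "k \<in> face_rank r ` \<Phi>" using ranks_of_flag assms by simp
  then obtain F where "F \<in> \<Phi>" "face_rank r F = k" by auto
  then have "\<exists>!F. F \<in> \<Phi> \<and> face_rank r F = k" using rank_eq_iff[OF assms(1)] by auto
  from theI'[OF this] show "flag_face \<Phi> k \<in> \<Phi>" "face_rank r (flag_face \<Phi> k) = k"
    by (simp_all add: flag_face_def)
qed

lemma flag_face_rank:
  assumes "\<Phi> \<in> flags r" "F \<in> \<Phi>"
  shows "flag_face \<Phi> (face_rank r F) = F" "-1 \<le> face_rank r F" "face_rank r F \<le> int n"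
proof -
  have b: "face_rank r F \<in> {-1..int n}" using ranks_of_flag[OF assms(1)] assms(2) by blast
  then show "-1 \<le> face_rank r F" "face_rank r F \<le> int n" by simp_all
  show "flag_face \<Phi> (face_rank r F) = F"
    using flag_face[OF assms(1), of "face_rank r F"] b assms rank_eq_iff by simp
qed

lemma flag_face_eqI:
  "\<Phi> \<in> flags r \<Longrightarrow> F \<in> \<Phi> \<Longrightarrow> face_rank r F = k \<Longrightarrow> flag_face \<Phi> k = F"
  using flag_face_rank(1) by blast

lemma flag_eqI:
  assumes "\<Phi> \<in> flags r" "\<Psi> \<in> flags r"
    and "\<And>k. -1 \<le> k \<Longrightarrow> k \<le> int n \<Longrightarrow> flag_face \<Phi> k = flag_face \<Psi> k"
  shows "\<Phi> = \<Psi>"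
proof -
  have "A \<subseteq> B" if "A \<in> flags r" "B \<in> flags r"
    "\<And>k. -1 \<le> k \<Longrightarrow> k \<le> int n \<Longrightarrow> flag_face A k = flag_face B k" for A B
    using that flag_face_rank flag_face(1) by (metis subsetI)
  then show ?thesis using assms by (metis subset_antisym)
qed

text \<open>Reading adjacency rank by rank allows flags to be compared through
  \<open>flag_eqI\<close>, without deleting faces from sets.\<close>

lemma adjacent_iff_flag_face:
  assumes i: "i < n"
  shows "adjacent r i \<Phi> \<Psi> \<longleftrightarrow> \<Phi> \<in> flags r \<and> \<Psi> \<in> flags r \<and> \<Phi> \<noteq> \<Psi> \<and>
    (\<forall>k. -1 \<le> k \<and> k \<le> int n \<and> k \<noteq> int i \<longrightarrow> flag_face \<Phi> k = flag_face \<Psi> k)"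
proof (cases "\<Phi> \<in> flags r \<and> \<Psi> \<in> flags r")
  case True
  have sub: "{F \<in> A. face_rank r F \<noteq> int i} \<subseteq> {F \<in> B. face_rank r F \<noteq> int i}"
    if "A \<in> flags r" "B \<in> flags r"
      "\<forall>k. -1 \<le> k \<and> k \<le> int n \<and> k \<noteq> int i \<longrightarrow> flag_face A k = flag_face B k" for A B
  proof
    fix F assume "F \<in> {F \<in> A. face_rank r F \<noteq> int i}"
    then have F: "F \<in> A" "face_rank r F \<noteq> int i" by auto
    then have "flag_face B (face_rank r F) = F" "-1 \<le> face_rank r F" "face_rank r F \<le> int n"
      using that flag_face_rank[OF that(1) F(1)] by auto
    then have "F \<in> B" using flag_face(1)[OF that(2)] by metis
    then show "F \<in> {F \<in> B. face_rank r F \<noteq> int i}" using F(2) by simp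
  qed
  have faces: "flag_face A k = flag_face B k"
    if "A \<in> flags r" "B \<in> flags r" "-1 \<le> k" "k \<le> int n" "k \<noteq> int i"
      "{F \<in> A. face_rank r F \<noteq> int i} = {F \<in> B. face_rank r F \<noteq> int i}" for A B k
  proof -
    have "flag_face A k \<in> {F \<in> A. face_rank r F \<noteq> int i}" using flag_face[OF that(1,3,4)] that(5) by simp
    then have "flag_face A k \<in> B" unfolding that(6) by blast
    then show ?thesis using flag_face_eqI[OF that(2)] flag_face(2)[OF that(1,3,4)] by metis
  qed
  have "{F \<in> \<Phi>. face_rank r F \<noteq> int i} = {F \<in> \<Psi>. face_rank r F \<noteq> int i} \<longleftrightarrow>
    (\<forall>k. -1 \<le> k \<and> k \<le> int n \<and> k \<noteq> int i \<longrightarrow> flag_face \<Phi> k = flag_face \<Psi> k)"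
    (is "?eq \<longleftrightarrow> ?faces")
  proof
    assume ?eq
    then show ?faces using faces True by blast
  next
    assume f: ?faces
    then have "\<forall>k. -1 \<le> k \<and> k \<le> int n \<and> k \<noteq> int i \<longrightarrow> flag_face \<Psi> k = flag_face \<Phi> k" by simp
    with f show ?eq using sub True by (intro subset_antisym) blast+
  qed
  then show ?thesis unfolding adjacent_def using True by blast
qed (auto simp: adjacent_def)

end

section \<open>Adjacent flags\<close>

text \<open>The diamond condition makes adjacent flags exist and be unique; connectedness of the
  flag graph makes automorphisms act freely on flags.\<close>

locale flag_connected_poset = flag_graded_poset +
  assumes diamond: "diamond_condition r"
    and flag_connected: "\<Phi> \<in> flags r \<Longrightarrow> \<Psi> \<in> flags r \<Longrightarrow>
      (\<lambda>A B. \<exists>i<n. adjacent r i A B)\<^sup>*\<^sup>* \<Phi> \<Psi>"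

lemma abstract_polytope_flag_connected_poset:
  assumes "abstract_polytope n r" "finite (Field r)"
  shows "flag_connected_poset n r"
proof
  fix \<Phi> \<Psi> assume \<Phi>: "\<Phi> \<in> flags r" "\<Psi> \<in> flags r"
  have "(\<lambda>A B. (\<exists>i<n. adjacent r i A B) \<and> \<Phi> \<inter> \<Psi> \<subseteq> A \<and> \<Phi> \<inter> \<Psi> \<subseteq> B)\<^sup>*\<^sup>* \<Phi> \<Psi>"
    using assms(1) \<Phi> unfolding abstract_polytope_def strongly_flag_connected_def by blast
  then show "(\<lambda>A B. \<exists>i<n. adjacent r i A B)\<^sup>*\<^sup>* \<Phi> \<Psi>"
    by (rule rtranclp_mono[THEN predicate2D, OF predicate2I, rotated]) blast
qed (use assms in \<open>auto simp: abstract_polytope_def\<close>)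

context flag_connected_poset
begin

lemma flag_face_between:
  assumes \<Phi>: "\<Phi> \<in> flags r" and i: "i < n"
  shows "strictly_below r (flag_face \<Phi> (int i - 1)) (flag_face \<Phi> (int i))"
    and "strictly_below r (flag_face \<Phi> (int i)) (flag_face \<Phi> (int i + 1))"
  using i by (simp_all add: flag_face[OF \<Phi>] flip: rank_less_iff[OF \<Phi>])

lemma card_between:
  assumes \<Phi>: "\<Phi> \<in> flags r" and i: "i < n"
  shows "card {H. strictly_below r (flag_face \<Phi> (int i - 1)) H \<and>
    strictly_below r H (flag_face \<Phi> (int i + 1))} = 2"
proof -
  have "(flag_face \<Phi> (int i - 1), flag_face \<Phi> (int i + 1)) \<in> r"
    using flag_face_between[OF assms] le_trans by (auto simp: strictly_below_def)
  then show ?thesis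
    using diamond i flag_face(2)[OF \<Phi>] unfolding diamond_condition_def by simp
qed

text \<open>The \<open>i\<close>-face is exchanged for the other element \<open>H\<close> of its
  diamond. The result is a chain of \<open>n + 2\<close> faces and therefore a flag.\<close>

lemma adjacent_exists:
  assumes \<Phi>: "\<Phi> \<in> flags r" and i: "i < n"
  shows "\<exists>\<Psi>. adjacent r i \<Phi> \<Psi>"
proof -
  let ?f = "flag_face \<Phi>"
  let ?S = "{H. strictly_below r (?f (int i - 1)) H \<and> strictly_below r H (?f (int i + 1))}"
  have mem: "?f k \<in> \<Phi>" "face_rank r (?f k) = k" if "-1 \<le> k" "k \<le> int n" for k
    using flag_face[OF \<Phi> that] by auto
  have "?f (int i) \<in> ?S" using flag_face_between[OF assms] by simp
  moreover have "card ?S = 2" by (rule card_between[OF assms])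
  ultimately obtain H where H: "H \<in> ?S" "H \<noteq> ?f (int i)"
    by (auto simp: card_2_iff)
  have HF: "H \<in> Field r" using H(1) by (auto simp: strictly_below_def Field_def)
  have low: "(G, H) \<in> r" if "G \<in> \<Phi>" "face_rank r G < int i" for G
  proof -
    have "(G, ?f (int i - 1)) \<in> r"
      using rank_less_iff[OF \<Phi> that(1) mem(1)[of "int i - 1"]] rank_eq_iff[OF \<Phi> that(1) mem(1)[of "int i - 1"]]
        that(2) mem(2)[of "int i - 1"] i le_refl[OF flag_Field[OF \<Phi> that(1)]]
      by (cases "face_rank r G = int i - 1") (auto simp: strictly_below_def)
    then show ?thesis using H(1) le_trans by (auto simp: strictly_below_def)
  qed
  have up: "(H, G) \<in> r" if "G \<in> \<Phi>" "face_rank r G > int i" for G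
  proof -
    have "(?f (int i + 1), G) \<in> r"
      using rank_less_iff[OF \<Phi> mem(1)[of "int i + 1"] that(1)] rank_eq_iff[OF \<Phi> mem(1)[of "int i + 1"] that(1)]
        that(2) mem(2)[of "int i + 1"] i le_refl[OF flag_Field[OF \<Phi> that(1)]]
      by (cases "face_rank r G = int i + 1") (auto simp: strictly_below_def)
    then show ?thesis using H(1) le_trans by (auto simp: strictly_below_def)
  qed
  \<comment> \<open>Inside the flag, \<open>H\<close> would have a rank strictly between
    \<open>i - 1\<close> and \<open>i + 1\<close>, so it would be the old
    \<open>i\<close>-face.\<close>
  have "H \<notin> \<Phi>"
  proof
    assume h: "H \<in> \<Phi>"
    then have "face_rank r (?f (int i - 1)) < face_rank r H" "face_rank r H < face_rank r (?f (int i + 1))"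
      using H(1) mem(1) i by (auto intro!: rank_strict_mono_in_flag[OF \<Phi>])
    then have "face_rank r H = int i" using mem(2)[of "int i - 1"] mem(2)[of "int i + 1"] i by simp
    then show False using H(2) flag_face_eqI[OF \<Phi> h] by simp
  qed
  let ?R = "\<Phi> - {?f (int i)}"
  have ne: "face_rank r G < int i \<or> face_rank r G > int i" if "G \<in> ?R" for G
    using that flag_face_rank(1)[OF \<Phi>, of G] by (metis DiffD1 DiffD2 insertI1 linorder_neqE)
  have "insert H ?R \<in> Chains r"
    using flag_chain[OF \<Phi>] low up ne le_refl[OF HF] unfolding Chains_def by blast
  moreover have "card (insert H ?R) = n + 2"
    using \<open>H \<notin> \<Phi>\<close> mem(1)[of "int i"] i finite_flag[OF \<Phi>] card_flag[OF \<Phi>]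
    by (simp add: card_Diff_singleton)
  ultimately have \<Psi>: "insert H ?R \<in> flags r" by (rule chain_is_flag)
  have "flag_face \<Phi> k = flag_face (insert H ?R) k" if "-1 \<le> k" "k \<le> int n" "k \<noteq> int i" for k
  proof -
    have "flag_face \<Phi> k \<in> insert H ?R"
      using mem[OF that(1,2)] mem(2)[of "int i"] that(3) i by auto
    then show ?thesis using flag_face_eqI[OF \<Psi>] mem(2)[OF that(1,2)] by metis
  qed
  moreover have "\<Phi> \<noteq> insert H ?R" using \<open>H \<notin> \<Phi>\<close> by auto
  ultimately show ?thesis using adjacent_iff_flag_face[OF i] \<Phi> \<Psi> by blast
qed

lemma adjacent_face_ne:
  assumes "adjacent r i \<Phi> \<Psi>" "i < n"
  shows "flag_face \<Psi> (int i) \<noteq> flag_face \<Phi> (int i)"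
  using assms flag_eqI[of \<Phi> \<Psi>] unfolding adjacent_iff_flag_face[OF assms(2)] by metis

text \<open>Both \<open>A'\<close> and \<open>B'\<close> replace the \<open>i\<close>-face by the other face of the same diamond.\<close>

lemma adjacent_face_eq:
  assumes A: "adjacent r i A A'" and B: "adjacent r i B B'" and i: "i < n"
    and eq: "\<And>k. k \<in> {int i - 1, int i, int i + 1} \<Longrightarrow> flag_face A k = flag_face B k"
  shows "flag_face A' (int i) = flag_face B' (int i)"
proof -
  let ?S = "{H. strictly_below r (flag_face A (int i - 1)) H \<and>
    strictly_below r H (flag_face A (int i + 1))}"
  have A': "A \<in> flags r" "A' \<in> flags r" "flag_face A' (int i - 1) = flag_face A (int i - 1)"
    "flag_face A' (int i + 1) = flag_face A (int i + 1)"
    using A i unfolding adjacent_iff_flag_face[OF i] by auto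
  have B': "B \<in> flags r" "B' \<in> flags r" "flag_face B' (int i - 1) = flag_face A (int i - 1)"
    "flag_face B' (int i + 1) = flag_face A (int i + 1)"
    using B i eq unfolding adjacent_iff_flag_face[OF i] by auto
  have "flag_face A (int i) \<in> ?S" "flag_face A' (int i) \<in> ?S" "flag_face B' (int i) \<in> ?S"
    using flag_face_between[OF A'(1) i] flag_face_between[OF A'(2) i]
      flag_face_between[OF B'(2) i] A' B' by simp_all
  moreover have "flag_face A' (int i) \<noteq> flag_face A (int i)"
    using adjacent_face_ne[OF A i] .
  moreover have "flag_face B' (int i) \<noteq> flag_face A (int i)"
    using adjacent_face_ne[OF B i] eq by simp
  moreover obtain x y where "?S = {x, y}"
    using card_between[OF A'(1) i] by (auto simp: card_2_iff)
  ultimately show ?thesis by (metis insertE singletonD)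
qed

lemma adjacent_unique:
  assumes A: "adjacent r i \<Phi> A" and B: "adjacent r i \<Phi> B" and i: "i < n"
  shows "A = B"
proof (rule flag_eqI)
  show "A \<in> flags r" "B \<in> flags r" using A B by (auto simp: adjacent_def)
  show "flag_face A k = flag_face B k" if "-1 \<le> k" "k \<le> int n" for k
    using A B that adjacent_face_eq[OF A B i] unfolding adjacent_iff_flag_face[OF i]
    by (cases "k = int i") metis+
qed

lemma adjacent_flag:
  assumes "\<Phi> \<in> flags r" "i < n"
  shows "adjacent r i \<Phi> (adjacent_flag r i \<Phi>)"
proof -
  have "\<exists>!\<Psi>. adjacent r i \<Phi> \<Psi>" using adjacent_exists[OF assms] adjacent_unique assms(2) by blast
  then show ?thesis unfolding adjacent_flag_def by (rule theI')
qed

lemma adjacent_flag_eqI: "adjacent r i \<Phi> \<Psi> \<Longrightarrow> i < n \<Longrightarrow> adjacent_flag r i \<Phi> = \<Psi>"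
  using adjacent_flag adjacent_unique by (metis adjacent_def)

lemma adjacent_flag_in_flags [intro]: "\<Phi> \<in> flags r \<Longrightarrow> i < n \<Longrightarrow> adjacent_flag r i \<Phi> \<in> flags r"
  using adjacent_flag by (metis adjacent_def)

lemma adjacent_symmetric: "adjacent r i \<Phi> \<Psi> \<Longrightarrow> adjacent r i \<Psi> \<Phi>"
  by (auto simp: adjacent_def)

lemma adjacent_flag_involution:
  "\<Phi> \<in> flags r \<Longrightarrow> i < n \<Longrightarrow> adjacent_flag r i (adjacent_flag r i \<Phi>) = \<Phi>"
  by (simp add: adjacent_flag adjacent_flag_eqI adjacent_symmetric)

lemma adjacent_flag_face:
  assumes "\<Phi> \<in> flags r" "i < n" "-1 \<le> k" "k \<le> int n" "k \<noteq> int i"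
  shows "flag_face (adjacent_flag r i \<Phi>) k = flag_face \<Phi> k"
  using adjacent_flag[OF assms(1,2)] assms unfolding adjacent_iff_flag_face[OF assms(2)] by simp

text \<open>The diamond at rank \<open>i\<close> involves the ranks \<open>i - 1\<close> to
  \<open>i + 1\<close> only, and these are untouched by a change at rank
  \<open>j \<ge> i + 2\<close>; the same holds with the roles exchanged.\<close>

lemma adjacent_flag_commute:
  assumes \<Phi>: "\<Phi> \<in> flags r" and ij: "i + 2 \<le> j" "j < n"
  shows "adjacent_flag r i (adjacent_flag r j \<Phi>) = adjacent_flag r j (adjacent_flag r i \<Phi>)"
proof (rule flag_eqI)
  have i: "i < n" and j: "j < n" using ij by auto
  let ?A = "adjacent_flag r i \<Phi>" and ?B = "adjacent_flag r j \<Phi>"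
  have A: "?A \<in> flags r" "adjacent r i \<Phi> ?A" and B: "?B \<in> flags r" "adjacent r j \<Phi> ?B"
    using \<Phi> i j adjacent_flag by auto
  show "adjacent_flag r i ?B \<in> flags r" "adjacent_flag r j ?A \<in> flags r" using A B i j by auto
  fix k :: int assume k: "-1 \<le> k" "k \<le> int n"
  note ff = adjacent_flag_face[OF \<Phi> i] adjacent_flag_face[OF \<Phi> j]
    adjacent_flag_face[OF A(1) j] adjacent_flag_face[OF B(1) i]
  consider "k = int i" | "k = int j" | "k \<noteq> int i" "k \<noteq> int j" by blast
  then show "flag_face (adjacent_flag r i ?B) k = flag_face (adjacent_flag r j ?A) k"
  proof cases
    case 1
    have "flag_face (adjacent_flag r i ?B) (int i) = flag_face ?A (int i)"
      by (rule adjacent_face_eq[OF adjacent_flag[OF B(1) i] A(2) i]) (use ij ff in auto)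
    then show ?thesis using 1 ij ff(3)[of k] k by simp
  next
    case 2
    have "flag_face (adjacent_flag r j ?A) (int j) = flag_face ?B (int j)"
      by (rule adjacent_face_eq[OF adjacent_flag[OF A(1) j] B(2) j]) (use ij ff in auto)
    then show ?thesis using 2 ij ff(4)[of k] k by simp
  next
    case 3
    then show ?thesis using ff k by simp
  qed
qed

section \<open>The action of automorphisms on flags\<close>

lemma automorphism_flag:
  assumes \<gamma>: "\<gamma> \<in> carrier (Aut r)" and \<Phi>: "\<Phi> \<in> flags r"
  shows "\<gamma> ` \<Phi> \<in> flags r"
proof (rule chain_is_flag)
  have sub: "\<Phi> \<subseteq> Field r" using flag_Field[OF \<Phi>] by blast
  then have "(\<gamma> a, \<gamma> b) \<in> r \<longleftrightarrow> (a, b) \<in> r" if "a \<in> \<Phi>" "b \<in> \<Phi>" for a b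
    using that automorphism_le_iff[OF \<gamma>] by blast
  then show "\<gamma> ` \<Phi> \<in> Chains r" using flag_chain[OF \<Phi>] by (simp add: Chains_def)
  have "inj_on \<gamma> \<Phi>" using automorphism_bij[OF \<gamma>] sub by (auto simp: bij_betw_def intro: inj_on_subset)
  then show "card (\<gamma> ` \<Phi>) = n + 2" using card_flag[OF \<Phi>] by (simp add: card_image)
qed

text \<open>By \<open>rank_in_flag\<close> the rank can be read off in any flag through
  \<open>F\<close>, and an automorphism carries this flag to one through the image of
  \<open>F\<close>.\<close>

lemma automorphism_rank:
  assumes \<gamma>: "\<gamma> \<in> carrier (Aut r)" and F: "F \<in> Field r"
  shows "face_rank r (\<gamma> F) = face_rank r F"
proof -
  obtain \<Phi> where \<Phi>: "\<Phi> \<in> flags r" "F \<in> \<Phi>" using F by (rule face_in_flag)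
  have sub: "\<Phi> \<subseteq> Field r" using flag_Field[OF \<Phi>(1)] by blast
  have "strictly_below r (\<gamma> G) (\<gamma> F) \<longleftrightarrow> strictly_below r G F" if "G \<in> \<Phi>" for G
    using that sub F automorphism_le_iff[OF \<gamma>] automorphism_inj[OF \<gamma>]
    by (simp add: strictly_below_def subset_iff)
  then have "{G \<in> \<gamma> ` \<Phi>. strictly_below r G (\<gamma> F)} = \<gamma> ` {G \<in> \<Phi>. strictly_below r G F}" by auto
  moreover have "inj_on \<gamma> {G \<in> \<Phi>. strictly_below r G F}"
    using automorphism_bij[OF \<gamma>] sub by (auto simp: bij_betw_def intro: inj_on_subset)
  ultimately show ?thesis
    using rank_in_flag[OF \<Phi>] rank_in_flag[OF automorphism_flag[OF \<gamma> \<Phi>(1)], of "\<gamma> F"] \<Phi>(2)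
    by (simp add: card_image)
qed

lemma automorphism_flag_face:
  assumes \<gamma>: "\<gamma> \<in> carrier (Aut r)" and \<Phi>: "\<Phi> \<in> flags r" and k: "-1 \<le> k" "k \<le> int n"
  shows "flag_face (\<gamma> ` \<Phi>) k = \<gamma> (flag_face \<Phi> k)"
  using flag_face[OF \<Phi> k] flag_Field[OF \<Phi>]
  by (intro flag_face_eqI automorphism_flag[OF \<gamma> \<Phi>]) (auto simp: automorphism_rank[OF \<gamma>])

lemma automorphism_adjacent_flag:
  assumes \<gamma>: "\<gamma> \<in> carrier (Aut r)" and \<Phi>: "\<Phi> \<in> flags r" and i: "i < n"
  shows "\<gamma> ` adjacent_flag r i \<Phi> = adjacent_flag r i (\<gamma> ` \<Phi>)"
proof (rule adjacent_flag_eqI[symmetric])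
  let ?\<Psi> = "adjacent_flag r i \<Phi>"
  have \<Psi>: "?\<Psi> \<in> flags r" "\<Phi> \<noteq> ?\<Psi>" using adjacent_flag[OF \<Phi> i] by (auto simp: adjacent_def)
  have "\<gamma> ` \<Phi> \<noteq> \<gamma> ` ?\<Psi>"
    using \<Psi>(2) automorphism_bij[OF \<gamma>] flag_Field[OF \<Phi>] flag_Field[OF \<Psi>(1)]
    by (metis bij_betw_def inj_on_image_eq_iff subsetI)
  then show "adjacent r i (\<gamma> ` \<Phi>) (\<gamma> ` ?\<Psi>)"
    unfolding adjacent_iff_flag_face[OF i]
    using automorphism_flag[OF \<gamma>] \<Phi> \<Psi> by (simp add: automorphism_flag_face[OF \<gamma>] adjacent_flag_face i)
qed (rule i)

lemma automorphism_fixes_flags: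
  assumes \<gamma>: "\<gamma> \<in> carrier (Aut r)" and \<Phi>: "\<Phi> \<in> flags r" "\<gamma> ` \<Phi> = \<Phi>" and \<Psi>: "\<Psi> \<in> flags r"
  shows "\<gamma> ` \<Psi> = \<Psi>"
  using flag_connected[OF \<Phi>(1) \<Psi>]
proof (induction rule: rtranclp_induct)
  case (step A B)
  then obtain i where i: "i < n" "adjacent r i A B" by blast
  then have "A \<in> flags r" "B = adjacent_flag r i A" using adjacent_flag_eqI by (auto simp: adjacent_def)
  then show ?case using automorphism_adjacent_flag[OF \<gamma> _ i(1)] step.IH by metis
qed (rule \<Phi>(2))

text \<open>Fixing one flag propagates along adjacencies to all flags. Every face lies in a flag,
  and ranks are preserved, so every face is fixed.\<close>

lemma automorphism_fixes_flag_is_one: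
  assumes \<gamma>: "\<gamma> \<in> carrier (Aut r)" and \<Phi>: "\<Phi> \<in> flags r" "\<gamma> ` \<Phi> = \<Phi>"
  shows "\<gamma> = \<one>\<^bsub>Aut r\<^esub>"
proof -
  have "\<gamma> F = F" if F: "F \<in> Field r" for F
  proof -
    obtain \<Psi> where \<Psi>: "\<Psi> \<in> flags r" "F \<in> \<Psi>" using F by (rule face_in_flag)
    have "\<gamma> F \<in> \<Psi>" using automorphism_fixes_flags[OF \<gamma> \<Phi> \<Psi>(1)] \<Psi>(2) by blast
    then show ?thesis using rank_eq_iff[OF \<Psi>(1)] \<Psi>(2) automorphism_rank[OF \<gamma> F] by blast
  qed
  then show ?thesis
    using \<gamma> by (auto simp: one_automorphism_group mem_automorphism_group extensional_def fun_eq_iff)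
qed

lemma mult_automorphism_image:
  assumes "\<Phi> \<in> flags r"
  shows "(f \<otimes>\<^bsub>Aut r\<^esub> g) ` \<Phi> = g ` f ` \<Phi>"
proof -
  have "(f \<otimes>\<^bsub>Aut r\<^esub> g) F = g (f F)" if "F \<in> \<Phi>" for F
    using flag_Field[OF assms that] by (simp add: mult_automorphism_group compose_eq)
  then show ?thesis by (simp add: image_image cong: image_cong)
qed

lemma one_automorphism_image:
  assumes "\<Phi> \<in> flags r"
  shows "\<one>\<^bsub>Aut r\<^esub> ` \<Phi> = \<Phi>"
proof -
  have "\<one>\<^bsub>Aut r\<^esub> F = F" if "F \<in> \<Phi>" for F
    using flag_Field[OF assms that] by (simp add: one_automorphism_group)
  then show ?thesis by simp
qed

lemma automorphism_eqI:
  assumes \<gamma>: "\<gamma> \<in> carrier (Aut r)" and \<delta>: "\<delta> \<in> carrier (Aut r)"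
    and \<Phi>: "\<Phi> \<in> flags r" and eq: "\<gamma> ` \<Phi> = \<delta> ` \<Phi>"
  shows "\<gamma> = \<delta>"
proof -
  interpret A: group "Aut r" by (rule group_automorphism_group)
  let ?\<delta>' = "inv\<^bsub>Aut r\<^esub> \<delta>"
  have "(\<gamma> \<otimes>\<^bsub>Aut r\<^esub> ?\<delta>') ` \<Phi> = (\<delta> \<otimes>\<^bsub>Aut r\<^esub> ?\<delta>') ` \<Phi>"
    using \<Phi> eq by (simp add: mult_automorphism_image)
  also have "\<dots> = \<Phi>" using \<delta> \<Phi> by (simp add: one_automorphism_image)
  finally have "\<gamma> \<otimes>\<^bsub>Aut r\<^esub> ?\<delta>' = \<one>\<^bsub>Aut r\<^esub>"
    using \<gamma> \<delta> \<Phi> by (intro automorphism_fixes_flag_is_one) auto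
  then show ?thesis using \<gamma> \<delta> by (metis A.inv_closed A.inv_equality A.inv_inv)
qed

text \<open>The action on flags is free by \<open>automorphism_eqI\<close>; if it is also
  transitive, evaluation at one flag is a bijection.\<close>

lemma order_automorphism_group_transitive:
  assumes \<Phi>: "\<Phi> \<in> flags r"
    and trans: "\<And>\<Psi>. \<Psi> \<in> flags r \<Longrightarrow> \<exists>\<gamma> \<in> carrier (Aut r). \<gamma> ` \<Phi> = \<Psi>"
  shows "order (Aut r) = card (flags r)"
proof -
  have "inj_on (\<lambda>\<gamma>. \<gamma> ` \<Phi>) (carrier (Aut r))"
    using automorphism_eqI \<Phi> by (intro inj_onI) blast
  moreover have "(\<lambda>\<gamma>. \<gamma> ` \<Phi>) ` carrier (Aut r) = flags r"
    using trans automorphism_flag \<Phi> by blast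
  ultimately show ?thesis unfolding order_def by (metis card_image)
qed

end

section \<open>Standard rotations at a base flag\<close>

text \<open>The common ground of chiral polytopes and toroids. Existence of rotations is assumed;
  their uniqueness follows from the free action, which gives the \<open>THE\<close> in
  \<open>std_rotation\<close> its meaning.\<close>

locale rotary_flag = flag_connected_poset +
  fixes \<Phi> :: "'a set"
  assumes base_flag: "\<Phi> \<in> flags r"
    and rotation_exists: "1 \<le> i \<Longrightarrow> i \<le> n - 1 \<Longrightarrow> \<exists>\<gamma> \<in> carrier (Aut r).
      \<gamma> ` \<Phi> = adjacent_flag r (i - 1) (adjacent_flag r i \<Phi>)"
begin

lemma std_rotation:
  assumes "1 \<le> i" "i \<le> n - 1"
  shows "std_rotation r \<Phi> i \<in> carrier (Aut r)"
    and "std_rotation r \<Phi> i ` \<Phi> = adjacent_flag r (i - 1) (adjacent_flag r i \<Phi>)"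
proof -
  have "\<exists>!\<gamma>. \<gamma> \<in> carrier (Aut r) \<and>
      \<gamma> ` \<Phi> = adjacent_flag r (i - 1) (adjacent_flag r i \<Phi>)"
    using rotation_exists[OF assms] automorphism_eqI[OF _ _ base_flag] by metis
  from theI'[OF this] show "std_rotation r \<Phi> i \<in> carrier (Aut r)"
    "std_rotation r \<Phi> i ` \<Phi> = adjacent_flag r (i - 1) (adjacent_flag r i \<Phi>)"
    by (simp_all add: std_rotation_def)
qed

text \<open>Automorphisms commute with passing to adjacent flags. So composing \<sigma>_i with the
  remaining word applies the adjacencies \<open>i - 1\<close>, \<open>i\<close>, \<open>i\<close>,
  \<open>j\<close>, and the two in the middle cancel: the product telescopes.\<close>

lemma rotation_word_image:
  assumes "1 \<le> i" "i \<le> j" "j \<le> n - 1"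
  shows "word_value (Aut r) (std_rotation r \<Phi>) (rotation_word i j) \<in> carrier (Aut r)
    \<and> word_value (Aut r) (std_rotation r \<Phi>) (rotation_word i j) ` \<Phi>
        = adjacent_flag r (i - 1) (adjacent_flag r j \<Phi>)"
  using assms(2,1,3)
proof (induction i rule: inc_induct)
  case base
  interpret A: group "Aut r" by (rule group_automorphism_group)
  show ?case using std_rotation base by simp
next
  case (step i)
  interpret A: group "Aut r" by (rule group_automorphism_group)
  let ?\<tau> = "word_value (Aut r) (std_rotation r \<Phi>) (rotation_word (Suc i) j)"
  have \<tau>: "?\<tau> \<in> carrier (Aut r)" "?\<tau> ` \<Phi> = adjacent_flag r i (adjacent_flag r j \<Phi>)"
    using step by auto
  have i: "i < n" "i - 1 < n" "j < n" using step by auto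
  note \<sigma> = std_rotation[of i]
  have "?\<tau> ` std_rotation r \<Phi> i ` \<Phi> = adjacent_flag r (i - 1) (adjacent_flag r i (?\<tau> ` \<Phi>))"
    using \<sigma> step i base_flag \<tau>(1) by (simp add: automorphism_adjacent_flag adjacent_flag_in_flags del: upt_Suc)
  also have "\<dots> = adjacent_flag r (i - 1) (adjacent_flag r j \<Phi>)"
    using i base_flag
    by (simp add: \<tau>(2) adjacent_flag_involution adjacent_flag_in_flags del: upt_Suc)
  finally have "?\<tau> ` std_rotation r \<Phi> i ` \<Phi> = adjacent_flag r (i - 1) (adjacent_flag r j \<Phi>)" .
  moreover have "word_value (Aut r) (std_rotation r \<Phi>) (rotation_word i j)
      = std_rotation r \<Phi> i \<otimes>\<^bsub>Aut r\<^esub> ?\<tau>"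
    using step by (intro word_value_rotation_word) simp
  ultimately show ?case
    using \<tau>(1) \<sigma>(1) step base_flag by (simp only: mult_automorphism_image) simp
qed

text \<open>The rotation word moves the base flag by the adjacencies \<open>j\<close> and
  \<open>i - 1\<close>. These ranks are at least 2 apart, so the adjacencies commute, and doing both
  twice returns to the base flag; the free action concludes.\<close>

lemma rotation_relation:
  assumes "1 \<le> i" "i < j" "j \<le> n - 1"
  shows "word_value (Aut r) (std_rotation r \<Phi>) (rotation_word i j) \<otimes>\<^bsub>Aut r\<^esub>
      word_value (Aut r) (std_rotation r \<Phi>) (rotation_word i j) = \<one>\<^bsub>Aut r\<^esub>"
proof -
  interpret A: group "Aut r" by (rule group_automorphism_group)
  let ?\<tau> = "word_value (Aut r) (std_rotation r \<Phi>) (rotation_word i j)"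
  have \<tau>: "?\<tau> \<in> carrier (Aut r)"
    "?\<tau> ` \<Phi> = adjacent_flag r (i - 1) (adjacent_flag r j \<Phi>)"
    using rotation_word_image[of i j] assms by auto
  obtain p where p: "i = Suc p" using assms by (cases i) auto
  have n: "p < n" "j < n" "p + 2 \<le> j" using assms p by auto
  have "(?\<tau> \<otimes>\<^bsub>Aut r\<^esub> ?\<tau>) ` \<Phi>
      = adjacent_flag r p (adjacent_flag r j (adjacent_flag r p (adjacent_flag r j \<Phi>)))"
    using \<tau> n base_flag p
    by (simp add: mult_automorphism_image automorphism_adjacent_flag adjacent_flag_in_flags del: upt_Suc)
  also have "\<dots> = \<Phi>"
    using n base_flag
    by (simp add: adjacent_flag_commute[OF _ n(3,2)] adjacent_flag_involution adjacent_flag_in_flags)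
  finally show ?thesis using \<tau>(1) base_flag by (intro automorphism_fixes_flag_is_one) auto
qed

lemma group_rotation_group: "group (rotation_group n r \<Phi>)"
  using group.group_subgroup_generated[OF group_automorphism_group] by (simp add: rotation_group_def)

lemma rotation_group_map:
  "presented_group_map {1..n-1} (Wplus_relators n) (rotation_group n r \<Phi>) (std_rotation r \<Phi>)"
proof (rule Wplus_map_intro[OF group_rotation_group])
  have sub: "std_rotation r \<Phi> ` {1..n-1} \<subseteq> carrier (Aut r)"
    using std_rotation(1) by auto
  show "std_rotation r \<Phi> i \<in> carrier (rotation_group n r \<Phi>)" if "1 \<le> i" "i \<le> n - 1" for i
    using group.subgroup_generated_subset_carrier_subset[OF group_automorphism_group sub] that
    by (auto simp: rotation_group_def)
  \<comment> \<open>These words contain no inverse letters, so only product and unit matter, which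
    the generated subgroup inherits.\<close>
  have "word_value (rotation_group n r \<Phi>) (std_rotation r \<Phi>) (map (\<lambda>l. (l, True)) w)
      = word_value (Aut r) (std_rotation r \<Phi>) (map (\<lambda>l. (l, True)) w)" for w
    by (induction w) (simp_all add: rotation_group_def)
  then show "word_value (rotation_group n r \<Phi>) (std_rotation r \<Phi>) (rotation_word i j)
      \<otimes>\<^bsub>rotation_group n r \<Phi>\<^esub> word_value (rotation_group n r \<Phi>) (std_rotation r \<Phi>) (rotation_word i j)
      = \<one>\<^bsub>rotation_group n r \<Phi>\<^esub>" if "1 \<le> i" "i < j" "j \<le> n - 1" for i j
    using rotation_relation[OF that] by (simp add: rotation_group_def del: upt_Suc)
qed

lemma rotation_group_order_dvd:
  "order (rotation_group n r \<Phi>) dvd order (Aut r)"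
proof -
  interpret A: group "Aut r" by (rule group_automorphism_group)
  have "subgroup (carrier (rotation_group n r \<Phi>)) (Aut r)"
    unfolding rotation_group_def by (rule A.subgroup_subgroup_generated)
  from A.lagrange[OF this] show ?thesis
    unfolding order_def[of "rotation_group n r \<Phi>"] by (metis dvd_triv_right)
qed

lemma finite_rotation_group: "finite (carrier (rotation_group n r \<Phi>))"
  using group.carrier_subgroup_generated_subset[OF group_automorphism_group]
    finite_automorphism_group[OF finite_Field] finite_subset
  unfolding rotation_group_def by blast

end

text \<open>Each adjacency changes the orbit and there are just two orbits, so after two adjacencies
  the flag is back in the orbit of \<open>\<Phi>\<close>.\<close>

lemma chiral_polytope_rotary_flag:
  assumes "chiral_polytope n r" "finite (Field r)" "\<Phi> \<in> flags r"
  shows "rotary_flag n r \<Phi>"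
proof -
  interpret flag_connected_poset n r
    using assms abstract_polytope_flag_connected_poset by (auto simp: chiral_polytope_def)
  show ?thesis
  proof
    fix i assume i: "1 \<le> i" "i \<le> n - 1"
    let ?A = "adjacent_flag r i \<Phi>"
    let ?B = "adjacent_flag r (i - 1) ?A"
    have n: "i < n" "i - 1 < n" using i by auto
    have fl: "?A \<in> flags r" "?B \<in> flags r" using assms(3) n by auto
    have "flag_orbit r \<Phi> \<noteq> flag_orbit r ?A" "flag_orbit r ?A \<noteq> flag_orbit r ?B"
      using assms(1) adjacent_flag n assms(3) fl unfolding chiral_polytope_def by blast+
    moreover obtain O1 O2 where "flag_orbit r ` flags r = {O1, O2}"
      using assms(1) by (auto simp: chiral_polytope_def card_2_iff)
    ultimately have "flag_orbit r ?B = flag_orbit r \<Phi>"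
      using assms(3) fl by (metis imageI insertE singletonD)
    moreover have "?B \<in> flag_orbit r ?B"
      unfolding flag_orbit_def
      using one_automorphism_image[OF fl(2)] group.is_monoid[OF group_automorphism_group]
      by (metis (mono_tags, lifting) mem_Collect_eq monoid.one_closed)
    ultimately have "?B \<in> flag_orbit r \<Phi>" by simp
    then show "\<exists>\<gamma> \<in> carrier (Aut r). \<gamma> ` \<Phi> = ?B"
      unfolding flag_orbit_def by blast
  qed (rule assms(3))
qed

section \<open>Orderings of a finite set\<close>

text \<open>A chain of subsets is refined to a complete one, given by the prefixes of a list. An
  element outside all proper members of the chain is placed last, and the rest is ordered by
  induction.\<close>

lemma nested_sets_ordering:
  assumes "finite A" "\<And>U. U \<in> \<U> \<Longrightarrow> U \<subseteq> A"
    and "\<And>U U'. U \<in> \<U> \<Longrightarrow> U' \<in> \<U> \<Longrightarrow> U \<subseteq> U' \<or> U' \<subseteq> U"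
  shows "\<exists>xs \<in> permutations_of_set A. \<forall>U \<in> \<U>. U = set (take (card U) xs)"
  using assms
proof (induction "card A" arbitrary: A \<U>)
  case 0
  then have "A = {}" by simp
  then have "U = {}" if "U \<in> \<U>" for U using 0(3)[OF that] by simp
  then show ?case using \<open>A = {}\<close> by (intro bexI[of _ "[]"]) auto
next
  case (Suc m)
  let ?P = "{U \<in> \<U>. U \<noteq> A}"
  \<comment> \<open>\<open>B\<close> is the largest member other than \<open>A\<close>, or empty if
    there is none.\<close>
  have "\<exists>B. B \<subset> A \<and> (\<forall>U \<in> ?P. U \<subseteq> B)"
  proof (cases "?P = {}")
    case True
    then show ?thesis using Suc.hyps(2) by (intro exI[of _ "{}"]) (auto simp: card_gt_0_iff[symmetric])
  next
    case False
    have "?P \<subseteq> Pow A" using Suc.prems(2) by blast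
    then have "finite ?P" by (rule finite_subset) (simp add: Suc.prems(1))
    from finite_has_maximal[OF this False] obtain B where B: "B \<in> ?P" "\<forall>U \<in> ?P. B \<subseteq> U \<longrightarrow> B = U" ..
    have "U \<subseteq> B" if U: "U \<in> ?P" for U
      using Suc.prems(3)[of U B] U B(1) bspec[OF B(2) U] by auto
    moreover have "B \<subset> A" using B(1) Suc.prems(2) by blast
    ultimately show ?thesis by blast
  qed
  then obtain B a where B: "\<And>U. U \<in> ?P \<Longrightarrow> U \<subseteq> B" "B \<subset> A" and a: "a \<in> A" "a \<notin> B" by blast
  have m: "m = card (A - {a})" using Suc.hyps(2) a(1) Suc.prems(1) by simp
  have "\<exists>xs \<in> permutations_of_set (A - {a}). \<forall>U \<in> ?P. U = set (take (card U) xs)"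
  proof (rule Suc.hyps(1)[OF m])
    show "finite (A - {a})" using Suc.prems(1) by simp
    show "U \<subseteq> A - {a}" if "U \<in> ?P" for U using B(1)[OF that] B(2) a by blast
    show "U \<subseteq> U' \<or> U' \<subseteq> U" if "U \<in> ?P" "U' \<in> ?P" for U U' using Suc.prems(3) that by blast
  qed
  then obtain xs where xs: "xs \<in> permutations_of_set (A - {a})"
    "\<And>U. U \<in> ?P \<Longrightarrow> U = set (take (card U) xs)" by blast
  have len: "length xs = m" using xs(1) m by (simp add: length_finite_permutations_of_set Suc.prems(1))
  have ys: "xs @ [a] \<in> permutations_of_set A"
    using xs(1) a(1) by (auto simp: permutations_of_set_def)
  moreover have "U = set (take (card U) (xs @ [a]))" if U: "U \<in> \<U>" for U
  proof (cases "U = A")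
    case True
    then show ?thesis using ys Suc.hyps(2) len by (auto simp: permutations_of_set_def)
  next
    case False
    then have P: "U \<in> ?P" using U by simp
    have "U \<subseteq> A - {a}" using B(1)[OF P] B(2) a by blast
    then have "card U \<le> length xs" using card_mono[of "A - {a}" U] Suc.prems(1) m len by simp
    then show ?thesis using xs(2)[OF P] by simp
  qed
  ultimately show ?case by blast
qed

text \<open>In a distinct list an entry is the only new element of the next longer prefix.\<close>

lemma set_take_eq_imp_eq:
  assumes "distinct xs" "distinct ys" "length xs = length ys"
    and "\<And>j. j \<le> length xs \<Longrightarrow> set (take j xs) = set (take j ys)"
  shows "xs = ys"
proof (rule nth_equalityI[OF assms(3)])
  fix j assume j: "j < length xs"
  have "set (take (Suc j) zs) - set (take j zs) = {zs ! j}" if "distinct zs" "j < length zs" for zs :: "'a list"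
  proof -
    have "zs ! j \<notin> set (take j zs)" using that by (simp add: in_set_conv_nth nth_eq_iff_index_eq)
    then show ?thesis using that(2) by (auto simp: take_Suc_conv_app_nth)
  qed
  from this[OF assms(1) j] this[of ys] have "{xs ! j} = {ys ! j}"
    using assms(2,3) assms(4)[of j] assms(4)[of "Suc j"] j by simp
  then show "xs ! j = ys ! j" by simp
qed

text \<open>Bubble sort: each entry of \<open>ys\<close> is moved to its place by swaps of
  neighbours. The already sorted prefix is the parameter \<open>a\<close>.\<close>

lemma adjacent_swaps_reach:
  assumes swap: "\<And>a x y b. P (a @ x # y # b) \<Longrightarrow> P (a @ y # x # b)"
    and "P xs" "mset xs = mset ys"
  shows "P ys"
proof -
  have bubble: "P (a @ y # u @ b)" if "P (a @ u @ y # b)" for a u y b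
    using that
  proof (induction u arbitrary: b rule: rev_induct)
    case (snoc z u)
    then have "P ((a @ u) @ z # y # b)" by simp
    then have "P ((a @ u) @ y # z # b)" by (rule swap)
    then have "P (a @ u @ y # (z # b))" by simp
    from snoc.IH[OF this] show ?case by simp
  qed simp
  have "P (a @ ys)" if "P (a @ xs)" "mset xs = mset ys" for a xs
    using that
  proof (induction ys arbitrary: a xs)
    case (Cons y ys)
    then have "y \<in> set xs" by (metis list.set_intros(1) mset_eq_setD)
    then obtain u v where xs: "xs = u @ y # v" by (auto simp: in_set_conv_decomp)
    have "P (a @ y # u @ v)" using Cons.prems(1) xs by (intro bubble) simp
    then have "P ((a @ [y]) @ u @ v)" by simp
    moreover have "mset (u @ v) = mset ys" using Cons.prems(2) xs by simp
    ultimately have "P ((a @ [y]) @ ys)" by (rule Cons.IH)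
    then show ?case by simp
  qed simp
  from this[of "[]" xs] assms(2,3) show ?thesis by simp
qed

section \<open>Faces of the cubic tessellation\<close>

text \<open>
  A proper face of the cubic tessellation is encoded by twice its centre \<open>c\<close>, an integer vector:
  the face extends in the directions of the odd coordinates of \<open>c\<close>.
\<close>

definition ivectors :: "nat \<Rightarrow> (nat \<Rightarrow> int) set" where
  "ivectors d = {c. \<forall>i. i \<notin> {1..d} \<longrightarrow> c i = 0}"

definition cube :: "nat \<Rightarrow> (nat \<Rightarrow> int) \<Rightarrow> (nat \<Rightarrow> real) set" where
  "cube d c = {x \<in> espace d. \<forall>i \<in> {1..d}. \<bar>2 * x i - of_int (c i)\<bar> \<le> of_bool (odd (c i))}"

text \<open>Inclusion of cubes in terms of doubled centres. In each direction the larger face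
  projects to a point (even coordinate) or a unit interval (odd coordinate), and the smaller one to
  the same set or to an endpoint of that interval.\<close>

definition face_le :: "nat \<Rightarrow> (nat \<Rightarrow> int) \<Rightarrow> (nat \<Rightarrow> int) \<Rightarrow> bool" where
  "face_le d c c' \<longleftrightarrow> (\<forall>i \<in> {1..d}. c i = c' i \<or> odd (c' i) \<and> \<bar>c i - c' i\<bar> = 1)"

definition odd_coords :: "nat \<Rightarrow> (nat \<Rightarrow> int) \<Rightarrow> nat set" where
  "odd_coords d c = {i \<in> {1..d}. odd (c i)}"

lemma ivectors_eqI:
  "c \<in> ivectors d \<Longrightarrow> c' \<in> ivectors d \<Longrightarrow> (\<And>i. i \<in> {1..d} \<Longrightarrow> c i = c' i) \<Longrightarrow> c = c'"
  unfolding ivectors_def by (rule ext) (metis (mono_tags, lifting) mem_Collect_eq)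

lemma ivectors_add: "c \<in> ivectors d \<Longrightarrow> c' \<in> ivectors d \<Longrightarrow> (\<lambda>i. c i + m * c' i) \<in> ivectors d"
  by (simp add: ivectors_def)

lemma unit_cube_eq_cube:
  assumes "J \<subseteq> {1..d}"
  shows "unit_cube d a J = cube d (\<lambda>i. if i \<in> {1..d} then 2 * a i + of_bool (i \<in> J) else 0)"
  unfolding unit_cube_def cube_def by (intro Collect_cong conj_cong ball_cong) auto

lemma cubic_faces_eq: "cubic_faces d = {{}, espace d} \<union> cube d ` ivectors d"
proof -
  have "{unit_cube d a J | a J. J \<subseteq> {1..d}} = cube d ` ivectors d"
  proof (intro equalityI subsetI)
    fix X assume "X \<in> {unit_cube d a J | a J. J \<subseteq> {1..d}}"
    then obtain a J where "X = unit_cube d a J" "J \<subseteq> {1..d}" by blast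
    then show "X \<in> cube d ` ivectors d" by (auto simp: unit_cube_eq_cube ivectors_def)
  next
    fix X assume "X \<in> cube d ` ivectors d"
    then obtain c where c: "c \<in> ivectors d" "X = cube d c" by blast
    let ?a = "\<lambda>i. c i div 2" and ?J = "odd_coords d c"
    have "(\<lambda>i. if i \<in> {1..d} then 2 * ?a i + of_bool (i \<in> ?J) else 0) = c"
      using c(1) by (auto simp: ivectors_def odd_coords_def fun_eq_iff)
    moreover have J: "?J \<subseteq> {1..d}" by (auto simp: odd_coords_def)
    ultimately have "X = unit_cube d ?a ?J" using unit_cube_eq_cube[OF J, of ?a] c(2) by simp
    then show "X \<in> {unit_cube d a J | a J. J \<subseteq> {1..d}}" using J by blast
  qed
  then show ?thesis by (simp add: cubic_faces_def)
qed

lemma centre_in_cube: "c \<in> ivectors d \<Longrightarrow> (\<lambda>i. of_int (c i) / 2) \<in> cube d c"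
  by (simp add: cube_def espace_def ivectors_def)

lemma face_le_neD:
  assumes "face_le d b c" "i \<in> {1..d}" "b i \<noteq> c i"
  shows "odd (c i)" "even (b i)" "\<bar>b i - c i\<bar> = 1"
proof -
  show *: "odd (c i)" "\<bar>b i - c i\<bar> = 1" using assms unfolding face_le_def by blast+
  then have "b i = c i + 1 \<or> b i = c i - 1" by linarith
  then show "even (b i)" using *(1) by auto
qed

text \<open>Inclusion is already decided by the centre of the smaller cube.\<close>

lemma cube_subset_iff:
  assumes "c \<in> ivectors d" "c' \<in> ivectors d"
  shows "cube d c \<subseteq> cube d c' \<longleftrightarrow> face_le d c c'"
proof
  assume "cube d c \<subseteq> cube d c'"
  then have *: "(\<lambda>i. of_int (c i) / 2) \<in> cube d c'" using centre_in_cube[OF assms(1)] by blast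
  show "face_le d c c'" unfolding face_le_def
  proof
    fix i assume i: "i \<in> {1..d}"
    have "\<bar>of_int (c i) - of_int (c' i) :: real\<bar> \<le> of_bool (odd (c' i))"
      using * i by (simp add: cube_def)
    then have "real_of_int \<bar>c i - c' i\<bar> \<le> of_int (of_bool (odd (c' i)))" by simp
    then have "\<bar>c i - c' i\<bar> \<le> of_bool (odd (c' i))" by linarith
    then show "c i = c' i \<or> odd (c' i) \<and> \<bar>c i - c' i\<bar> = 1"
      by (cases "odd (c' i)") (simp_all, linarith)
  qed
next
  assume le: "face_le d c c'"
  show "cube d c \<subseteq> cube d c'"
  proof
    fix x assume x: "x \<in> cube d c"
    have "\<bar>2 * x i - of_int (c' i)\<bar> \<le> of_bool (odd (c' i))" if i: "i \<in> {1..d}" for i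
    proof (cases "c i = c' i")
      case True
      have "\<bar>2 * x i - of_int (c i)\<bar> \<le> of_bool (odd (c i))" using x i unfolding cube_def by blast
      then show ?thesis by (simp only: True)
    next
      case False
      then have c: "odd (c' i)" "even (c i)" "\<bar>c i - c' i\<bar> = 1" using face_le_neD[OF le i] by blast+
      moreover have "\<bar>2 * x i - of_int (c i)\<bar> \<le> of_bool (odd (c i))" using x i unfolding cube_def by blast
      ultimately have "2 * x i = of_int (c i)" using c(2) by simp
      moreover have "\<bar>of_int (c i) - of_int (c' i) :: real\<bar> = 1"
        using c(3) by (metis of_int_1 of_int_abs of_int_diff)
      ultimately show ?thesis using c(1) by simp
    qed
    then show "x \<in> cube d c'" using x by (simp add: cube_def)
  qed
qed

lemma face_le_refl [simp]: "face_le d c c"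
  by (simp add: face_le_def)

text \<open>By parity: \<open>b i\<close> is odd if it differs from \<open>a i\<close>, and even if
  it differs from \<open>c i\<close>.\<close>

lemma face_le_between:
  "face_le d a b \<Longrightarrow> face_le d b c \<Longrightarrow> i \<in> {1..d} \<Longrightarrow> b i = a i \<or> b i = c i"
  unfolding face_le_def by (smt (verit, best) even_add odd_one)

lemma face_le_trans: "face_le d a b \<Longrightarrow> face_le d b c \<Longrightarrow> face_le d a c"
  using face_le_between[of d a b c] unfolding face_le_def by metis

lemma odd_coords_mono: "face_le d c c' \<Longrightarrow> odd_coords d c \<subseteq> odd_coords d c'"
proof
  fix i assume le: "face_le d c c'" and "i \<in> odd_coords d c"
  then have i: "i \<in> {1..d}" "odd (c i)" by (auto simp: odd_coords_def)
  then have "c i = c' i \<or> odd (c' i)" using le unfolding face_le_def by blast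
  then show "i \<in> odd_coords d c'" using i by (auto simp: odd_coords_def)
qed

lemma finite_odd_coords [simp]: "finite (odd_coords d c)"
  by (simp add: odd_coords_def)

lemma face_le_odd_coords_eq:
  assumes "face_le d c c'" "odd_coords d c = odd_coords d c'" "i \<in> {1..d}"
  shows "c i = c' i"
  using face_le_neD(1,2)[OF assms(1,3)] assms(2,3) by (auto simp: odd_coords_def)

lemma face_le_card_eq:
  assumes "face_le d c c'" "card (odd_coords d c') \<le> card (odd_coords d c)"
    "c \<in> ivectors d" "c' \<in> ivectors d"
  shows "c = c'"
proof (rule ivectors_eqI[OF assms(3,4)])
  have "odd_coords d c = odd_coords d c'"
    using assms(2) by (intro card_seteq odd_coords_mono[OF assms(1)]) simp_all
  then show "c i = c' i" if "i \<in> {1..d}" for i using face_le_odd_coords_eq[OF assms(1)] that by blast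
qed

lemma face_le_dist: "face_le d c c' \<Longrightarrow> i \<in> {1..d} \<Longrightarrow> \<bar>c i - c' i\<bar> \<le> 1"
  by (force simp: face_le_def)

text \<open>Translation by an integer vector \<open>w\<close> moves doubled centres by
  \<open>2 * w\<close>, which preserves differences and parities.\<close>

lemma face_le_shift:
  "face_le d (\<lambda>i. c i + 2 * w i) (\<lambda>i. c' i + 2 * w i) \<longleftrightarrow> face_le d c c'"
  by (simp add: face_le_def)

lemma odd_coords_shift [simp]: "odd_coords d (\<lambda>i. c i + 2 * w i) = odd_coords d c"
  by (simp add: odd_coords_def)

lemma cube_eq_iff:
  assumes "c \<in> ivectors d" "c' \<in> ivectors d"
  shows "cube d c = cube d c' \<longleftrightarrow> c = c'"
proof
  assume "cube d c = cube d c'"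
  then have "face_le d c c'" "face_le d c' c" using cube_subset_iff assms by blast+
  then show "c = c'" using assms odd_coords_mono face_le_card_eq by (meson card_mono finite_odd_coords)
qed simp

lemma espace_not_subset_cube:
  assumes "d \<ge> 1"
  shows "\<not> espace d \<subseteq> cube d c"
proof
  assume "espace d \<subseteq> cube d c"
  \<comment> \<open>Two test points suffice: with first coordinates \<open>c 1 + 2\<close> and
    \<open>c 1 - 2\<close> they give the deviations \<open>c 1 + 4\<close> and
    \<open>c 1 - 4\<close>, which cannot both have absolute value at most 1.\<close>
  moreover have "(\<lambda>i. if i = 1 then of_int (c 1) + 2 else 0) \<in> espace d" using assms by (simp add: espace_def)
  moreover have "1 \<in> {1..d}" using assms by simp
  ultimately have "\<bar>2 * (of_int (c 1) + 2) - of_int (c 1) :: real\<bar> \<le> of_bool (odd (c 1))"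
    unfolding cube_def by fastforce
  moreover have "(\<lambda>i. if i = 1 then of_int (c 1) - 2 else 0) \<in> espace d" using assms by (simp add: espace_def)
  ultimately have "\<bar>2 * (of_int (c 1) - 2) - of_int (c 1) :: real\<bar> \<le> of_bool (odd (c 1))"
    using \<open>espace d \<subseteq> cube d c\<close> \<open>1 \<in> {1..d}\<close> unfolding cube_def by fastforce
  with \<open>\<bar>2 * (of_int (c 1) + 2) - of_int (c 1) :: real\<bar> \<le> of_bool (odd (c 1))\<close>
  show False by (cases "odd (c 1)") auto
qed

section \<open>The lattice of a cubic toroid\<close>

locale cubic_toroid_params =
  fixes d s k :: nat
  assumes d: "d \<ge> 2" and s: "s \<ge> 2" and k: "k \<in> {1, 2, d}"
begin

definition L :: "(nat \<Rightarrow> int) set" where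
  "L = {w. (\<lambda>i. real_of_int (w i)) \<in> toroid_lattice d s k}"

lemma k_bounds: "1 \<le> k" "k \<le> d"
  using k d by auto

text \<open>Besides integrality this records the number of odd entries after division by
  \<open>s\<close>. The parity invariants of the lattice come from it.\<close>

lemma toroid_vector_integral:
  assumes "v \<in> toroid_vectors d s k"
  obtains u where "v = (\<lambda>i. real_of_int (int s * u i))" "u \<in> ivectors d"
    "\<And>i. \<bar>u i\<bar> \<le> 1" "card {i \<in> {1..d}. odd (u i)} = k"
proof -
  obtain \<pi> e where v: "v = signed_permute \<pi> e (toroid_vector s k)" and \<pi>: "\<pi> permutes {1..d}"
    and e: "range e \<subseteq> {1, -1}" using assms by (auto simp: toroid_vectors_def)
  define u where "u i = (if \<pi> i \<in> {1..k} then if e i = 1 then 1 else -1 else 0 :: int)" for i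
  have e': "e i = 1 \<or> e i = -1" for i using e by auto
  have "v i = real_of_int (int s * u i)" for i
    using e'[of i] by (auto simp: v u_def signed_permute_def toroid_vector_def)
  moreover have "u \<in> ivectors d"
  proof -
    have "u i = 0" if "i \<notin> {1..d}" for i
    proof -
      have "\<pi> i = i" using \<pi> that by (simp add: permutes_def)
      moreover have "i \<notin> {1..k}" using that k_bounds by auto
      ultimately show ?thesis by (simp add: u_def)
    qed
    then show ?thesis by (simp add: ivectors_def)
  qed
  moreover have "card {i \<in> {1..d}. odd (u i)} = k"
  proof -
    have "{i \<in> {1..d}. odd (u i)} = \<pi> -` {1..k}"
    proof -
      have "i \<in> {1..d}" if "\<pi> i \<in> {1..k}" for i
      proof -
        have "\<pi> i \<in> {1..d}" using that k_bounds by auto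
        then show ?thesis using permutes_in_image[OF \<pi>] by blast
      qed
      then show ?thesis by (auto simp: u_def split: if_splits)
    qed
    also have "card \<dots> = card {1..k}"
      using permutes_inj[OF \<pi>] permutes_surj[OF \<pi>] by (intro card_vimage_inj) auto
    finally show ?thesis by simp
  qed
  moreover have "\<bar>u i\<bar> \<le> 1" for i by (simp add: u_def)
  ultimately show ?thesis using that[of u] by presburger
qed

lemma L_zero: "(\<lambda>i. 0) \<in> L"
  using toroid_lattice.zero[of d s k] by (simp add: L_def)

lemma toroid_lattice_add:
  assumes "v \<in> toroid_lattice d s k" "u \<in> toroid_lattice d s k"
  shows "(\<lambda>i. u i + v i) \<in> toroid_lattice d s k"
  using assms(1)
proof (induction rule: toroid_lattice.induct)
  case zero
  then show ?case using assms(2) by simp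
next
  case (add v x)
  then show ?case using toroid_lattice.add[OF add.IH add.hyps(2)] by (simp add: add.assoc)
next
  case (diff v x)
  then show ?case using toroid_lattice.diff[OF diff.IH diff.hyps(2)] by (simp add: algebra_simps)
qed

lemma toroid_lattice_uminus:
  assumes "v \<in> toroid_lattice d s k"
  shows "(\<lambda>i. - v i) \<in> toroid_lattice d s k"
  using assms
proof (induction rule: toroid_lattice.induct)
  case zero
  then show ?case using toroid_lattice.zero by simp
next
  case (add v x)
  then show ?case using toroid_lattice.diff[OF add.IH add.hyps(2)] by simp
next
  case (diff v x)
  then show ?case using toroid_lattice.add[OF diff.IH diff.hyps(2)] by (simp add: algebra_simps)
qed

text \<open>After division by \<open>s\<close>, the lattice for \<open>k = 2\<close> lies in the
  vectors of even coordinate sum, and the one for \<open>k = d\<close> in the vectors whose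
  coordinates all have the same parity. These invariants bound the index from below in
  \<open>L_index\<close>.\<close>

lemma toroid_lattice_integral:
  assumes "v \<in> toroid_lattice d s k"
  shows "\<exists>u. v = (\<lambda>i. real_of_int (int s * u i)) \<and> u \<in> ivectors d \<and>
    (k = 2 \<longrightarrow> even (\<Sum>i\<in>{1..d}. u i)) \<and> (k = d \<longrightarrow> (\<exists>b. \<forall>i \<in> {1..d}. odd (u i) = b))"
proof -
  define good where "good v \<longleftrightarrow> (\<exists>u. v = (\<lambda>i. real_of_int (int s * u i)) \<and> u \<in> ivectors d \<and>
    (k = 2 \<longrightarrow> even (\<Sum>i\<in>{1..d}. u i)) \<and> (k = d \<longrightarrow> (\<exists>b. \<forall>i \<in> {1..d}. odd (u i) = b)))" for v
  \<comment> \<open>The factor \<open>m\<close> is 1 or -1 and covers addition and subtraction at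
    once; the parity argument uses only that it is odd.\<close>
  have step: "good (\<lambda>i. x i + real_of_int m * y i)"
    if IH: "good x" and y: "y \<in> toroid_vectors d s k" and m: "odd m" for x y m
  proof -
    obtain u where u: "x = (\<lambda>i. real_of_int (int s * u i))" "u \<in> ivectors d"
      "k = 2 \<longrightarrow> even (\<Sum>i\<in>{1..d}. u i)" "k = d \<longrightarrow> (\<exists>b. \<forall>i \<in> {1..d}. odd (u i) = b)"
      using IH unfolding good_def by (elim exE conjE)
    obtain w where w: "y = (\<lambda>i. real_of_int (int s * w i))" "w \<in> ivectors d"
      "card {i \<in> {1..d}. odd (w i)} = k" using y by (rule toroid_vector_integral)
    have eq: "(\<lambda>i. x i + real_of_int m * y i) = (\<lambda>i. real_of_int (int s * (u i + m * w i)))"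
      by (simp add: u(1) w(1) algebra_simps)
    have "even (\<Sum>i\<in>{1..d}. u i + m * w i)" if "k = 2"
    proof -
      have "even (\<Sum>i\<in>{1..d}. w i) \<longleftrightarrow> even (card {i \<in> {1..d}. odd (w i)})"
        by (rule even_sum_iff) simp
      then have "even (\<Sum>i\<in>{1..d}. w i)" using w(3) that by simp
      then show ?thesis using u(3) that by (simp add: sum.distrib flip: sum_distrib_left)
    qed
    moreover have "\<exists>b. \<forall>i \<in> {1..d}. odd (u i + m * w i) = b" if kd: "k = d"
    proof -
      have "{i \<in> {1..d}. odd (w i)} = {1..d}"
        by (rule card_subset_eq) (use w(3) kd in auto)
      then have w: "\<forall>i \<in> {1..d}. odd (w i)" by (metis (mono_tags, lifting) mem_Collect_eq)
      from u(4) kd have "\<exists>b. \<forall>i \<in> {1..d}. odd (u i) = b" by (rule mp)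
      then obtain b where "\<forall>i \<in> {1..d}. odd (u i) = b" ..
      then show ?thesis using m w by (intro exI[of _ "\<not> b"]) simp
    qed
    ultimately show ?thesis
      using eq ivectors_add[OF u(2) w(2), of m] unfolding good_def
      by (intro exI[of _ "\<lambda>i. u i + m * w i"] conjI impI) (assumption | simp)+
  qed
  have "good v"
    using assms
  proof (induction rule: toroid_lattice.induct)
    case zero
    show ?case unfolding good_def by (intro exI[of _ "\<lambda>_. 0"]) (auto simp: ivectors_def)
  next
    case (add x y)
    show ?case using step[OF add.IH add.hyps(2), of 1] by simp
  next
    case (diff x y)
    show ?case using step[OF diff.IH diff.hyps(2), of "-1"] by simp
  qed
  then show ?thesis unfolding good_def .
qed

lemma L_E:
  assumes "w \<in> L"
  obtains u where "w = (\<lambda>i. int s * u i)" "u \<in> ivectors d"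
    "k = 2 \<Longrightarrow> even (\<Sum>i\<in>{1..d}. u i)"
    "k = d \<Longrightarrow> \<exists>b. \<forall>i \<in> {1..d}. odd (u i) = b"
proof -
  have "(\<lambda>i. real_of_int (w i)) \<in> toroid_lattice d s k" using assms by (simp add: L_def)
  then obtain u where u: "(\<lambda>i. real_of_int (w i)) = (\<lambda>i. real_of_int (int s * u i))" "u \<in> ivectors d"
    "k = 2 \<longrightarrow> even (\<Sum>i\<in>{1..d}. u i)"
    "k = d \<longrightarrow> (\<exists>b. \<forall>i \<in> {1..d}. odd (u i) = b)" using toroid_lattice_integral by blast
  from u(1) have "w = (\<lambda>i. int s * u i)" by (metis (no_types, lifting) ext of_int_eq_iff)
  with u that show ?thesis by blast
qed

lemma L_ivectors: "w \<in> L \<Longrightarrow> w \<in> ivectors d"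
  by (erule L_E) (simp add: ivectors_def)

lemma L_dvd: "w \<in> L \<Longrightarrow> int s dvd w i"
  by (erule L_E) simp

text \<open>A nonzero entry is a multiple of \<open>s \<ge> 2\<close>. This is what keeps nearby
  faces from being identified.\<close>

lemma L_small:
  assumes "w \<in> L" "\<And>i. i \<in> {1..d} \<Longrightarrow> \<bar>w i\<bar> \<le> 1"
  shows "w = (\<lambda>i. 0)"
proof (rule ivectors_eqI[OF L_ivectors[OF assms(1)]])
  show "w i = 0" if "i \<in> {1..d}" for i
  proof (rule ccontr)
    assume "w i \<noteq> 0"
    then have "int s \<le> \<bar>w i\<bar>" using dvd_imp_le_int[OF _ L_dvd[OF assms(1), of i]] by simp
    then show False using assms(2)[OF that] s by linarith
  qed
qed (simp add: ivectors_def)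

lemma L_add: "w \<in> L \<Longrightarrow> w' \<in> L \<Longrightarrow> (\<lambda>i. w i + w' i) \<in> L"
  using toroid_lattice_add[of "\<lambda>i. real_of_int (w' i)" "\<lambda>i. real_of_int (w i)"] by (simp add: L_def)

lemma L_uminus: "w \<in> L \<Longrightarrow> (\<lambda>i. - w i) \<in> L"
  using toroid_lattice_uminus[of "\<lambda>i. real_of_int (w i)"] by (simp add: L_def)

lemma L_diff: "w \<in> L \<Longrightarrow> w' \<in> L \<Longrightarrow> (\<lambda>i. w i - w' i) \<in> L"
  using L_add[OF _ L_uminus, of w w'] by simp

lemma L_scale:
  assumes "w \<in> L"
  shows "(\<lambda>i. m * w i) \<in> L"
proof (induction m rule: int_induct[where k = 0])
  case base
  then show ?case using L_zero by simp
next
  case (step1 m)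
  then show ?case using L_add[OF step1.IH assms] by (simp add: algebra_simps)
next
  case (step2 m)
  then show ?case using L_diff[OF step2.IH assms] by (simp add: algebra_simps)
qed

lemma L_sum:
  assumes "finite A" "\<And>a. a \<in> A \<Longrightarrow> g a \<in> L"
  shows "(\<lambda>i. \<Sum>a\<in>A. g a i) \<in> L"
  using assms
proof (induction A rule: finite_induct)
  case empty
  then show ?case using L_zero by simp
next
  case (insert a A)
  then have "(\<lambda>i. g a i + (\<Sum>a\<in>A. g a i)) \<in> L" by (intro L_add) auto
  then show ?case using insert by simp
qed

lemma toroid_lattice_signed_permute:
  assumes p: "p permutes {1..d}" and e: "range e \<subseteq> {1, -1}"
    and v: "v \<in> toroid_lattice d s k"
  shows "signed_permute p e v \<in> toroid_lattice d s k"
proof -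
  have vec: "signed_permute p e x \<in> toroid_vectors d s k" if x: "x \<in> toroid_vectors d s k" for x
  proof -
    obtain \<pi> e' where x: "x = signed_permute \<pi> e' (toroid_vector s k)" "\<pi> permutes {1..d}"
      "range e' \<subseteq> {1, -1}" using x by (auto simp: toroid_vectors_def)
    have "signed_permute p e x = signed_permute (\<pi> \<circ> p) (\<lambda>i. e i * e' (p i)) (toroid_vector s k)"
      by (simp add: x(1) signed_permute_def fun_eq_iff)
    moreover have "(\<pi> \<circ> p) permutes {1..d}" using p x(2) by (rule permutes_compose)
    moreover have "e i * e' (p i) \<in> {1, -1}" for i
    proof -
      have "e i \<in> {1, -1}" "e' (p i) \<in> {1, -1}" using e x(3) by blast+
      then show ?thesis by auto
    qed
    then have "range (\<lambda>i. e i * e' (p i)) \<subseteq> {1, -1}" by blast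
    ultimately show ?thesis unfolding toroid_vectors_def by blast
  qed
  show ?thesis using v
  proof (induction rule: toroid_lattice.induct)
    case zero
    then show ?case using toroid_lattice.zero by (simp add: signed_permute_def)
  next
    case (add u x)
    then show ?case using toroid_lattice.add[OF add.IH vec[OF add.hyps(2)]]
      by (simp add: signed_permute_def distrib_left)
  next
    case (diff u x)
    then show ?case using toroid_lattice.diff[OF diff.IH vec[OF diff.hyps(2)]]
      by (simp add: signed_permute_def right_diff_distrib)
  qed
qed

lemma L_signed_permute:
  assumes p: "p permutes {1..d}" and e: "\<And>i. i \<in> {1..d} \<Longrightarrow> e i \<in> {1, -1 :: int}" and w: "w \<in> L"
  shows "(\<lambda>i. e i * w (p i)) \<in> L"
proof -
  \<comment> \<open>Signs are constrained only on the coordinates in use; elsewhere they are set to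
    1, since \<open>signed_permute\<close> is used with all signs in {1, -1}.\<close>
  let ?e = "\<lambda>i. if i \<in> {1..d} then real_of_int (e i) else 1"
  have "?e i \<in> {1, -1}" for i using e[of i] by (cases "i \<in> {1..d}") auto
  then have "range ?e \<subseteq> {1, -1}" by blast
  then have "signed_permute p ?e (\<lambda>i. real_of_int (w i)) \<in> toroid_lattice d s k"
    using w by (intro toroid_lattice_signed_permute[OF p]) (simp_all only: L_def mem_Collect_eq)
  moreover have "signed_permute p ?e (\<lambda>i. real_of_int (w i)) = (\<lambda>i. real_of_int (e i * w (p i)))"
  proof
    fix i
    show "signed_permute p ?e (\<lambda>i. real_of_int (w i)) i = real_of_int (e i * w (p i))"
    proof (cases "i \<in> {1..d}")
      case False
      then have "p i = i" using p by (simp add: permutes_def)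
      then have "w (p i) = 0" using False L_ivectors[OF w] by (simp add: ivectors_def)
      then show ?thesis by (simp add: signed_permute_def)
    qed (simp add: signed_permute_def)
  qed
  ultimately show ?thesis by (simp add: L_def)
qed

section \<open>Faces and incidence of a cubic toroid\<close>

abbreviation Q :: "(nat \<Rightarrow> real) set set rel" where "Q \<equiv> cubic_toroid (Suc d) s k"

text \<open>The empty face is fixed by all translations, so its orbit is a singleton; likewise the
  whole space below.\<close>

definition bottom :: "(nat \<Rightarrow> real) set set" where "bottom = {{}}"

definition whole :: "(nat \<Rightarrow> real) set set" where "whole = {espace d}"

definition cls :: "(nat \<Rightarrow> int) \<Rightarrow> (nat \<Rightarrow> real) set set" where
  "cls c = translation_class d s k (cube d c)"

lemma translate_cube:
  assumes "w \<in> ivectors d"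
  shows "translate (\<lambda>i. real_of_int (w i)) (cube d c) = cube d (\<lambda>i. c i + 2 * w i)"
proof (intro equalityI subsetI)
  fix x assume "x \<in> translate (\<lambda>i. real_of_int (w i)) (cube d c)"
  then show "x \<in> cube d (\<lambda>i. c i + 2 * w i)"
    using assms by (auto simp: translate_def cube_def espace_def ivectors_def algebra_simps)
next
  fix x assume x: "x \<in> cube d (\<lambda>i. c i + 2 * w i)"
  then have "(\<lambda>i. x i - real_of_int (w i)) \<in> cube d c"
    using assms by (auto simp: cube_def espace_def ivectors_def algebra_simps)
  moreover have "x = (\<lambda>i. (x i - real_of_int (w i)) + real_of_int (w i))" by simp
  ultimately show "x \<in> translate (\<lambda>i. real_of_int (w i)) (cube d c)"
    unfolding translate_def by (intro image_eqI)
qed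

lemma translate_espace:
  assumes "w \<in> ivectors d"
  shows "translate (\<lambda>i. real_of_int (w i)) (espace d) = espace d"
proof (intro equalityI subsetI)
  fix x assume "x \<in> translate (\<lambda>i. real_of_int (w i)) (espace d)"
  then show "x \<in> espace d"
    using assms by (auto simp: translate_def espace_def ivectors_def)
next
  fix x assume x: "x \<in> espace d"
  then have "(\<lambda>i. x i - real_of_int (w i)) \<in> espace d"
    using assms by (auto simp: espace_def ivectors_def)
  moreover have "x = (\<lambda>i. (x i - real_of_int (w i)) + real_of_int (w i))" by simp
  ultimately show "x \<in> translate (\<lambda>i. real_of_int (w i)) (espace d)"
    unfolding translate_def by (intro image_eqI)
qed

lemma toroid_lattice_eq: "toroid_lattice d s k = (\<lambda>w i. real_of_int (w i)) ` L"
proof (intro equalityI subsetI)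
  fix v assume v: "v \<in> toroid_lattice d s k"
  then obtain u where "v = (\<lambda>i. real_of_int (int s * u i))" using toroid_lattice_integral by blast
  with v show "v \<in> (\<lambda>w i. real_of_int (w i)) ` L"
    by (intro image_eqI[of _ _ "\<lambda>i. int s * u i"]) (auto simp: L_def)
qed (auto simp: L_def)

lemma cls_eq: "cls c = {cube d (\<lambda>i. c i + 2 * w i) | w. w \<in> L}"
  unfolding cls_def translation_class_def toroid_lattice_eq image_image Setcompr_eq_image
  by (rule image_cong[OF HOL.refl]) (simp add: translate_cube L_ivectors)

lemma cube_in_cls: "cube d c \<in> cls c"
  unfolding cls_eq by (intro CollectI exI[of _ "\<lambda>_. 0"]) (simp add: L_zero)

lemma translation_class_empty: "translation_class d s k {} = bottom"
  using toroid_lattice.zero[of d s k] by (auto simp: translation_class_def translate_def bottom_def)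

lemma translation_class_espace: "translation_class d s k (espace d) = whole"
proof -
  have "translation_class d s k (espace d) = (\<lambda>_. espace d) ` L"
    unfolding translation_class_def toroid_lattice_eq image_image
    by (rule image_cong[OF HOL.refl]) (simp add: translate_espace L_ivectors)
  then show ?thesis using L_zero by (auto simp: whole_def)
qed

lemma shift_ivectors: "c \<in> ivectors d \<Longrightarrow> w \<in> L \<Longrightarrow> (\<lambda>i. c i + 2 * w i) \<in> ivectors d"
  using L_ivectors by (simp add: ivectors_def)

lemma cls_eq_iff:
  assumes "c \<in> ivectors d" "c' \<in> ivectors d"
  shows "cls c = cls c' \<longleftrightarrow> (\<exists>w \<in> L. c' = (\<lambda>i. c i + 2 * w i))"
proof
  assume "cls c = cls c'"
  then have "cube d c' \<in> cls c" using cube_in_cls[of c'] by simp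
  then obtain w where w: "w \<in> L" "cube d c' = cube d (\<lambda>i. c i + 2 * w i)"
    unfolding cls_eq by blast
  then show "\<exists>w \<in> L. c' = (\<lambda>i. c i + 2 * w i)"
    using cube_eq_iff[OF assms(2) shift_ivectors[OF assms(1) w(1)]] by blast
next
  have sub: "cls (\<lambda>i. c i + 2 * w i) \<subseteq> cls c" if w: "w \<in> L" for w and c :: "nat \<Rightarrow> int"
  proof
    fix X assume "X \<in> cls (\<lambda>i. c i + 2 * w i)"
    then obtain w' where "w' \<in> L" "X = cube d (\<lambda>i. c i + 2 * w i + 2 * w' i)" unfolding cls_eq by blast
    then show "X \<in> cls c" unfolding cls_eq using L_add[OF w, of w']
      by (intro CollectI exI[of _ "\<lambda>i. w i + w' i"]) (simp add: algebra_simps)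
  qed
  assume "\<exists>w \<in> L. c' = (\<lambda>i. c i + 2 * w i)"
  then obtain w where w: "w \<in> L" "c' = (\<lambda>i. c i + 2 * w i)" by blast
  have "cls c' \<subseteq> cls c" using sub[OF w(1), of c] w(2) by simp
  moreover have "cls c \<subseteq> cls c'" using sub[OF L_uminus[OF w(1)], of c'] w(2) by simp
  ultimately show "cls c = cls c'" by blast
qed

lemma cls_shift: "c \<in> ivectors d \<Longrightarrow> w \<in> L \<Longrightarrow> cls (\<lambda>i. c i + 2 * w i) = cls c"
  using cls_eq_iff shift_ivectors by metis

lemma cls_odd_coords: "c \<in> ivectors d \<Longrightarrow> c' \<in> ivectors d \<Longrightarrow> cls c = cls c' \<Longrightarrow> odd_coords d c = odd_coords d c'"
  using cls_eq_iff by auto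

lemma cls_distinct:
  assumes "c \<in> ivectors d"
  shows "cls c \<noteq> bottom" "cls c \<noteq> whole" "bottom \<noteq> whole"
proof -
  have "cube d c \<in> cls c" by (rule cube_in_cls)
  moreover have "cube d c \<noteq> {}" using centre_in_cube[OF assms] by blast
  moreover have "cube d c \<noteq> espace d" using espace_not_subset_cube[of d c] d by simp
  ultimately show "cls c \<noteq> bottom" "cls c \<noteq> whole" by (auto simp: bottom_def whole_def)
  have "(\<lambda>_. 0) \<in> espace d" by (simp add: espace_def)
  then show "bottom \<noteq> whole" by (auto simp: bottom_def whole_def)
qed

text \<open>This replaces the point sets: incidence becomes \<open>face_le\<close> on doubled
  centres, up to the choice of representatives, together with the two improper faces.\<close>

lemma Q_eq: "Q = {(bottom, X) | X. X \<in> insert bottom (insert whole (cls ` ivectors d))}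
  \<union> {(X, whole) | X. X \<in> insert bottom (insert whole (cls ` ivectors d))}
  \<union> {(cls c, cls c') | c c'. c \<in> ivectors d \<and> c' \<in> ivectors d \<and> face_le d c c'}" (is "_ = ?R")
proof (intro equalityI subsetI)
  fix z assume "z \<in> Q"
  then obtain F G where z: "z = (translation_class d s k F, translation_class d s k G)"
    and FG: "F \<in> cubic_faces d" "G \<in> cubic_faces d" "F \<subseteq> G"
    unfolding cubic_toroid_def by auto
  have F: "F = {} \<or> F = espace d \<or> F \<in> cube d ` ivectors d"
    and G: "G = {} \<or> G = espace d \<or> G \<in> cube d ` ivectors d"
    using FG(1,2) unfolding cubic_faces_eq by blast+
  have ne: "espace d \<noteq> {}" by (auto simp: espace_def)
  have X: "translation_class d s k H \<in> insert bottom (insert whole (cls ` ivectors d))"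
    if "H = {} \<or> H = espace d \<or> H \<in> cube d ` ivectors d" for H
    using that
  proof (elim disjE)
    assume "H \<in> cube d ` ivectors d"
    then show ?thesis unfolding cls_def by blast
  qed (simp_all add: translation_class_empty translation_class_espace)
  consider "F = {}" | "G = espace d" | "F \<noteq> {}" "G \<noteq> espace d" by blast
  then show "z \<in> ?R"
  proof cases
    case 1
    then have "z = (bottom, translation_class d s k G)" using z translation_class_empty by simp
    then show ?thesis using X[OF G] by blast
  next
    case 2
    then have "z = (translation_class d s k F, whole)" using z translation_class_espace by simp
    then show ?thesis using X[OF F] by blast
  next
    case False: 3
    have "F \<noteq> espace d"
    proof
      assume F: "F = espace d"
      then have "G \<noteq> {}" using FG(3) ne by blast
      then obtain c where "G = cube d c" using G False(2) by blast
      then show False using FG(3) F espace_not_subset_cube[of d c] d by simp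
    qed
    then obtain c where c: "c \<in> ivectors d" "F = cube d c" using F False by blast
    have "G \<noteq> {}" using False(1) FG(3) by blast
    then obtain c' where c': "c' \<in> ivectors d" "G = cube d c'" using G False by blast
    have "face_le d c c'" using FG(3) c c' cube_subset_iff by blast
    moreover have "z = (cls c, cls c')" using z c(2) c'(2) by (simp add: cls_def)
    ultimately show ?thesis using c(1) c'(1) by blast
  qed
next
  have cf: "F \<in> cubic_faces d \<Longrightarrow> G \<in> cubic_faces d \<Longrightarrow> F \<subseteq> G \<Longrightarrow>
    (translation_class d s k F, translation_class d s k G) \<in> Q" for F G
    unfolding cubic_toroid_def by auto
  have faces: "{} \<in> cubic_faces d" "espace d \<in> cubic_faces d"
    "c \<in> ivectors d \<Longrightarrow> cube d c \<in> cubic_faces d" for c by (auto simp: cubic_faces_eq)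
  have rep: "\<exists>F \<in> cubic_faces d. F \<subseteq> espace d \<and> X = translation_class d s k F"
    if "X \<in> insert bottom (insert whole (cls ` ivectors d))" for X
  proof -
    consider "X = bottom" | "X = whole" | c where "c \<in> ivectors d" "X = cls c" using \<open>X \<in> _\<close> by blast
    then show ?thesis
    proof cases
      case 1
      then show ?thesis using faces(1) translation_class_empty by (metis empty_subsetI)
    next
      case 2
      then show ?thesis using faces(2) translation_class_espace by (metis order_refl)
    next
      case 3
      have "cube d c \<subseteq> espace d" unfolding cube_def by blast
      then show ?thesis using faces(3)[OF 3(1)] 3(2) unfolding cls_def by blast
    qed
  qed
  fix z assume "z \<in> ?R"
  then show "z \<in> Q"
  proof (elim UnE CollectE exE conjE)
    fix X assume z: "z = (bottom, X)" and X: "X \<in> insert bottom (insert whole (cls ` ivectors d))"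
    obtain F where "F \<in> cubic_faces d" "X = translation_class d s k F" using rep[OF X] by blast
    then show ?thesis using cf[OF faces(1), of F] z translation_class_empty by simp
  next
    fix X assume z: "z = (X, whole)" and X: "X \<in> insert bottom (insert whole (cls ` ivectors d))"
    obtain F where "F \<in> cubic_faces d" "F \<subseteq> espace d" "X = translation_class d s k F" using rep[OF X] by blast
    then show ?thesis using cf[OF _ faces(2), of F] z translation_class_espace by simp
  next
    fix c c' assume "z = (cls c, cls c')" "c \<in> ivectors d" "c' \<in> ivectors d" "face_le d c c'"
    then show ?thesis using cf[OF faces(3) faces(3)] cube_subset_iff by (simp add: cls_def)
  qed
qed

lemma Field_Q: "Field Q = insert bottom (insert whole (cls ` ivectors d))"
proof (intro equalityI subsetI)
  fix X assume "X \<in> insert bottom (insert whole (cls ` ivectors d))"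
  then have "(bottom, X) \<in> Q" unfolding Q_eq by blast
  then show "X \<in> Field Q" by (rule FieldI2)
qed (auto simp: Field_def Q_eq)

lemma Field_Q_cases:
  assumes "X \<in> Field Q"
  obtains "X = bottom" | "X = whole" | c where "c \<in> ivectors d" "X = cls c"
  using assms unfolding Field_Q by blast

lemma bottom_le [simp]: "(bottom, X) \<in> Q \<longleftrightarrow> X \<in> Field Q"
  unfolding Field_Q by (auto simp: Q_eq)

lemma le_whole [simp]: "(X, whole) \<in> Q \<longleftrightarrow> X \<in> Field Q"
  unfolding Field_Q by (auto simp: Q_eq)

lemma le_bottom [simp]: "(X, bottom) \<in> Q \<longleftrightarrow> X = bottom"
  using cls_distinct by (auto simp: Q_eq)

lemma whole_le [simp]: "(whole, X) \<in> Q \<longleftrightarrow> X = whole"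
  using cls_distinct by (auto simp: Q_eq)

text \<open>Both representatives may be translated together, so the one on the left can be kept
  fixed and only the right one moves.\<close>

lemma cls_le_iff:
  assumes "c \<in> ivectors d" "c' \<in> ivectors d"
  shows "(cls c, cls c') \<in> Q \<longleftrightarrow> (\<exists>w \<in> L. face_le d c (\<lambda>i. c' i + 2 * w i))"
proof
  assume "(cls c, cls c') \<in> Q"
  then obtain a b where ab: "a \<in> ivectors d" "b \<in> ivectors d" "face_le d a b" "cls c = cls a" "cls c' = cls b"
    using cls_distinct[OF assms(1)] cls_distinct[OF assms(2)] unfolding Q_eq by auto
  obtain w where w: "w \<in> L" "c = (\<lambda>i. a i + 2 * w i)" using ab cls_eq_iff assms by metis
  obtain w' where w': "w' \<in> L" "b = (\<lambda>i. c' i + 2 * w' i)" using ab cls_eq_iff assms by metis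
  have "face_le d c (\<lambda>i. b i + 2 * w i)" using ab(3) w(2) by (simp add: face_le_shift)
  then have "face_le d c (\<lambda>i. c' i + 2 * (w i + w' i))" by (simp add: w'(2) algebra_simps)
  then show "\<exists>w \<in> L. face_le d c (\<lambda>i. c' i + 2 * w i)" using L_add[OF w(1) w'(1)] by (rule bexI)
next
  assume "\<exists>w \<in> L. face_le d c (\<lambda>i. c' i + 2 * w i)"
  then obtain w where w: "w \<in> L" "face_le d c (\<lambda>i. c' i + 2 * w i)" by blast
  then have "(cls c, cls (\<lambda>i. c' i + 2 * w i)) \<in> Q"
    using assms shift_ivectors[OF assms(2) w(1)] unfolding Q_eq by blast
  then show "(cls c, cls c') \<in> Q" using cls_shift[OF assms(2) w(1)] by simp
qed

text \<open>Incidences are lifted to the tessellation: a class above that of \<open>c\<close> has a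
  representative above \<open>c\<close> itself. With \<open>le_clsE\<close> for the other direction
  this lets a chain be lifted face by face.\<close>

lemma cls_leE:
  assumes "(cls c, X) \<in> Q" "c \<in> ivectors d" "X \<noteq> whole"
  obtains c' where "c' \<in> ivectors d" "X = cls c'" "face_le d c c'"
proof -
  have "X \<in> Field Q" using assms(1) by (rule FieldI2)
  moreover have "X \<noteq> bottom" using assms cls_distinct by auto
  ultimately obtain b where b: "b \<in> ivectors d" "X = cls b" using assms(3) by (auto elim: Field_Q_cases)
  then obtain w where "w \<in> L" "face_le d c (\<lambda>i. b i + 2 * w i)" using assms cls_le_iff by blast
  then show ?thesis using that[of "\<lambda>i. b i + 2 * w i"] b cls_shift shift_ivectors by simp
qed

lemma le_clsE:
  assumes "(X, cls c) \<in> Q" "c \<in> ivectors d" "X \<noteq> bottom"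
  obtains c' where "c' \<in> ivectors d" "X = cls c'" "face_le d c' c"
proof -
  have "X \<in> Field Q" using assms(1) by (rule FieldI1)
  moreover have "X \<noteq> whole" using assms cls_distinct by auto
  ultimately obtain b where b: "b \<in> ivectors d" "X = cls b" using assms(3) by (auto elim: Field_Q_cases)
  then obtain w where w: "w \<in> L" "face_le d b (\<lambda>i. c i + 2 * w i)" using assms cls_le_iff by blast
  then have "face_le d (\<lambda>i. b i + 2 * - w i) c"
    using face_le_shift[of d b "\<lambda>i. - w i" "\<lambda>i. c i + 2 * w i"] by simp
  then show ?thesis
    using that[of "\<lambda>i. b i + 2 * - w i"] b cls_shift[OF b(1) L_uminus[OF w(1)]]
      shift_ivectors[OF b(1) L_uminus[OF w(1)]] by simp
qed

text \<open>
  Two representatives of a class above \<open>c\<close> differ by at most 1 in each coordinate, but nonzero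
  lattice vectors have an entry of size at least \<open>s \<ge> 2\<close>.
\<close>

lemma face_above_unique:
  assumes "face_le d c b" "face_le d c (\<lambda>i. b i + 2 * w i)" "w \<in> L"
  shows "w = (\<lambda>i. 0)"
proof (rule L_small[OF assms(3)])
  show "\<bar>w i\<bar> \<le> 1" if "i \<in> {1..d}" for i
    using face_le_dist[OF assms(1) that] face_le_dist[OF assms(2) that] by linarith
qed

text \<open>Antisymmetry could fail in a quotient. It holds here because mutually incident classes
  have equal dimension, and an inclusion of cubes of equal dimension is an equality.\<close>

lemma partial_order_Q: "partial_order_on (Field Q) Q"
proof -
  have "antisym Q"
  proof (rule antisymI)
    fix X Y assume XY: "(X, Y) \<in> Q" "(Y, X) \<in> Q"
    then have "X \<in> Field Q" by (auto intro: FieldI1)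
    then show "X = Y"
    proof (cases rule: Field_Q_cases)
      case (3 c)
      show ?thesis
      proof (cases "Y = whole")
        case False
        obtain c' where c': "c' \<in> ivectors d" "Y = cls c'" "face_le d c c'"
          using cls_leE[of c Y] XY(1) 3 False by metis
        obtain w where w: "w \<in> L" "face_le d c' (\<lambda>i. c i + 2 * w i)"
          using XY(2) 3 c' cls_le_iff by blast
        have "card (odd_coords d c') \<le> card (odd_coords d c)"
          using odd_coords_mono[OF w(2)] by (intro card_mono) auto
        then have "c = c'" using face_le_card_eq c' 3 by blast
        then show ?thesis using 3 c' by simp
      qed (use XY in simp)
    qed (use XY in auto)
  qed
  moreover have "trans Q"
  proof (rule transI)
    fix X Y Z assume XYZ: "(X, Y) \<in> Q" "(Y, Z) \<in> Q"
    have F: "X \<in> Field Q" "Z \<in> Field Q" using XYZ by (auto intro: FieldI1 FieldI2)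
    show "(X, Z) \<in> Q"
    proof (cases "X = bottom \<or> Z = whole")
      case True
      then show ?thesis using F by auto
    next
      case False
      then have ne: "X \<noteq> whole" "Y \<noteq> whole" "Y \<noteq> bottom" using XYZ by auto
      then obtain c where c: "c \<in> ivectors d" "X = cls c" using F False by (auto elim: Field_Q_cases)
      obtain c' where c': "c' \<in> ivectors d" "Y = cls c'" "face_le d c c'"
        using cls_leE[of c Y] XYZ(1) c ne by metis
      obtain c'' where c'': "c'' \<in> ivectors d" "Z = cls c''" "face_le d c' c''"
        using cls_leE[of c' Z] XYZ(2) c' False by metis
      have "face_le d c c''" using c'(3) c''(3) by (rule face_le_trans)
      then show ?thesis using c c'' unfolding Q_eq by blast
    qed
  qed
  moreover have "refl_on (Field Q) Q"
    unfolding refl_on_def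
  proof
    fix X assume "X \<in> Field Q"
    then show "(X, X) \<in> Q"
    proof (cases rule: Field_Q_cases)
      case (3 c)
      then show ?thesis unfolding Q_eq using face_le_refl by blast
    qed (use \<open>X \<in> Field Q\<close> in auto)
  qed
  moreover have "Q \<subseteq> Field Q \<times> Field Q" by (auto simp: Field_def)
  ultimately show ?thesis by (simp add: partial_order_on_def preorder_on_def)
qed


section \<open>The index of the lattice\<close>

text \<open>With suitable sides \<open>m\<close> the box is a set of coset representatives of
  \<open>L\<close> among the integer vectors, so the index is the product of the sides.\<close>

definition box :: "(nat \<Rightarrow> nat) \<Rightarrow> (nat \<Rightarrow> int) set" where
  "box m = {b \<in> ivectors d. \<forall>i \<in> {1..d}. 0 \<le> b i \<and> b i < int (m i)}"

lemma card_box: "card (box m) = (\<Prod>i\<in>{1..d}. m i)"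
proof -
  have "bij_betw (\<lambda>b. restrict b {1..d}) (box m) (\<Pi>\<^sub>E i\<in>{1..d}. {0..<int (m i)})"
  proof (rule bij_betwI)
    show "(\<lambda>b. restrict b {1..d}) \<in> box m \<rightarrow> (\<Pi>\<^sub>E i\<in>{1..d}. {0..<int (m i)})"
      by (rule funcsetI) (simp add: box_def PiE_def Pi_def extensional_def)
    show "(\<lambda>f i. if i \<in> {1..d} then f i else 0) \<in> (\<Pi>\<^sub>E i\<in>{1..d}. {0..<int (m i)}) \<rightarrow> box m"
    proof
      fix f assume f: "f \<in> (\<Pi>\<^sub>E i\<in>{1..d}. {0..<int (m i)})"
      have "0 \<le> f i \<and> f i < int (m i)" if "i \<in> {1..d}" for i using PiE_mem[OF f that] by simp
      then show "(\<lambda>i. if i \<in> {1..d} then f i else 0) \<in> box m"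
        by (simp add: box_def ivectors_def)
    qed
    show "(\<lambda>i. if i \<in> {1..d} then restrict b {1..d} i else 0) = b" if b: "b \<in> box m" for b
    proof
      show "(if i \<in> {1..d} then restrict b {1..d} i else 0) = b i" for i
        using b by (cases "i \<in> {1..d}") (auto simp: box_def ivectors_def)
    qed
    show "restrict (\<lambda>i. if i \<in> {1..d} then f i else 0) {1..d} = f"
      if f: "f \<in> (\<Pi>\<^sub>E i\<in>{1..d}. {0..<int (m i)})" for f
    proof
      show "restrict (\<lambda>i. if i \<in> {1..d} then f i else 0) {1..d} i = f i" for i
        using PiE_arb[OF f, of i] by (cases "i \<in> {1..d}") simp_all
    qed
  qed
  then have "card (box m) = card (\<Pi>\<^sub>E i\<in>{1..d}. {0..<int (m i)})" by (rule bij_betw_same_card)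
  then show ?thesis by (simp add: card_PiE)
qed

text \<open>A transposition is enough to place the nonzero entries: it exchanges one of the
  directions \<open>1\<close> to \<open>k\<close> for another one.\<close>

lemma generator_in_L:
  assumes "a \<in> {1..d}" "b \<in> {1..d}" "\<And>i. e i \<in> {1, -1}"
  shows "(\<lambda>i. if Transposition.transpose a b i \<in> {1..k} then e i * int s else 0) \<in> L"
proof -
  have p: "Transposition.transpose a b permutes {1..d}" using assms(1,2) by (rule permutes_swap_id)
  have "real_of_int (e i) \<in> {1, -1}" for i using assms(3)[of i] by auto
  then have "range (\<lambda>i. real_of_int (e i)) \<subseteq> {1, -1}" by blast
  then have v: "signed_permute (Transposition.transpose a b) (\<lambda>i. real_of_int (e i)) (toroid_vector s k)
      \<in> toroid_vectors d s k"
    using p unfolding toroid_vectors_def by blast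
  have "(\<lambda>i. 0 + signed_permute (Transposition.transpose a b) (\<lambda>i. real_of_int (e i)) (toroid_vector s k) i)
      \<in> toroid_lattice d s k"
    by (rule toroid_lattice.add[OF toroid_lattice.zero v])
  also have "(\<lambda>i. 0 + signed_permute (Transposition.transpose a b) (\<lambda>i. real_of_int (e i)) (toroid_vector s k) i)
      = (\<lambda>i. real_of_int (if Transposition.transpose a b i \<in> {1..k} then e i * int s else 0))"
    by (auto simp: signed_permute_def toroid_vector_def)
  finally show ?thesis by (simp add: L_def)
qed

text \<open>Division with remainder in the directions \<open>I\<close>, by vectors that are diagonal
  on \<open>I\<close>. Other coordinates may change on the way; the last conclusion tells which do
  not.\<close>

lemma reduce_mod_L:
  assumes I: "I \<subseteq> {1..d}" and g: "\<And>i. i \<in> I \<Longrightarrow> g i \<in> L" and m: "\<And>i. i \<in> I \<Longrightarrow> 0 < m i"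
    and diag: "\<And>i. i \<in> I \<Longrightarrow> g i i = int (m i)"
    and off: "\<And>i j. i \<in> I \<Longrightarrow> j \<in> I \<Longrightarrow> i \<noteq> j \<Longrightarrow> g i j = 0"
  obtains l where "l \<in> L" "\<And>i. i \<in> I \<Longrightarrow> 0 \<le> w i - l i \<and> w i - l i < int (m i)"
    "\<And>j. (\<And>i. i \<in> I \<Longrightarrow> g i j = 0) \<Longrightarrow> l j = 0"
proof
  let ?l = "\<lambda>j. \<Sum>i\<in>I. (w i div int (m i)) * g i j"
  have fin: "finite I" using I finite_subset by blast
  show "?l \<in> L" by (rule L_sum[OF fin]) (rule L_scale[OF g])
  show "0 \<le> w j - ?l j \<and> w j - ?l j < int (m j)" if j: "j \<in> I" for j
  proof -
    have "?l j = (\<Sum>i\<in>I. if i = j then (w j div int (m j)) * int (m j) else 0)"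
      by (rule sum.cong) (use diag off j in auto)
    also have "\<dots> = (w j div int (m j)) * int (m j)" using fin j by simp
    finally have "w j - ?l j = w j mod int (m j)" by (simp add: minus_div_mult_eq_mod)
    then show ?thesis using m[OF j] by simp
  qed
  show "?l j = 0" if "\<And>i. i \<in> I \<Longrightarrow> g i j = 0" for j
    by (rule sum.neutral) (use that in simp)
qed

lemma box_unique_aux:
  assumes "b \<in> box m" "b' \<in> box m" "i \<in> {1..d}" "int (m i) dvd b i - b' i"
  shows "b i = b' i"
proof -
  have "0 \<le> b i" "b i < int (m i)" "0 \<le> b' i" "b' i < int (m i)" using assms by (auto simp: box_def)
  moreover have "b i mod int (m i) = b' i mod int (m i)" using assms(4) by (simp add: mod_eq_dvd_iff)
  ultimately show ?thesis by simp
qed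

text \<open>The sides are all \<open>s\<close> for \<open>k = 1\<close>; \<open>2 * s\<close> once
  and \<open>s\<close> otherwise for \<open>k = 2\<close>; \<open>s\<close> once and
  \<open>2 * s\<close> otherwise for \<open>k = d\<close>. A vector is reduced in two stages, those
  moves first that disturb other coordinates: for \<open>k = 2\<close> directions \<open>2\<close>
  to \<open>d\<close> and then 1, for \<open>k = d\<close> direction 1 and then the others.
  Uniqueness uses the parity invariants.\<close>

lemma L_index:
  obtains m where "\<forall>i \<in> {1..d}. 0 < m i" "(\<Prod>i\<in>{1..d}. m i) = 2 ^ (k - 1) * s ^ d"
    "\<forall>w \<in> ivectors d. \<exists>b \<in> box m. (\<lambda>i. w i - b i) \<in> L"
    "\<forall>b \<in> box m. \<forall>b' \<in> box m. (\<lambda>i. b i - b' i) \<in> L \<longrightarrow> b = b'"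
proof -
  note goal = that
  have result: thesis if "\<And>i. i \<in> {1..d} \<Longrightarrow> 0 < m i" "(\<Prod>i\<in>{1..d}. m i) = 2 ^ (k - 1) * s ^ d"
    "\<And>w. w \<in> ivectors d \<Longrightarrow> \<exists>b \<in> box m. (\<lambda>i. w i - b i) \<in> L"
    "\<And>b b'. b \<in> box m \<Longrightarrow> b' \<in> box m \<Longrightarrow> (\<lambda>i. b i - b' i) \<in> L \<Longrightarrow> b = b'" for m
    using that by (intro goal[of m] ballI impI)
  define unit where "unit c i = (\<lambda>j. if j = i then c else 0 :: int)" for c and i :: nat
  have split: "{1..d} = insert 1 {2..d}" "1 \<notin> {2..d}" using d by auto
  have s0: "s > 0" using s by simp
  have box: "\<exists>b \<in> box m. (\<lambda>i. w i - b i) \<in> L"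
    if "l \<in> L" "w \<in> ivectors d" "\<And>i. i \<in> {1..d} \<Longrightarrow> 0 \<le> w i - l i \<and> w i - l i < int (m i)" for w l m
  proof -
    have "(\<lambda>i. w i - l i) \<in> box m"
      using that L_ivectors[OF that(1)] by (simp add: box_def ivectors_def)
    then show ?thesis using that(1) by (intro bexI[of _ "\<lambda>i. w i - l i"]) simp_all
  qed
  consider "k = 1" | "k = 2" | "k = d" using k by blast
  then show ?thesis
  proof cases
    case 1
    let ?m = "\<lambda>_ :: nat. s"
    have unitL: "unit (int s) i \<in> L" if "i \<in> {1..d}" for i
    proof -
      have "(\<lambda>j. if Transposition.transpose 1 i j \<in> {1..k} then 1 * int s else 0) \<in> L"
        using that d by (intro generator_in_L) auto
      moreover have "Transposition.transpose 1 i j \<in> {1..k} \<longleftrightarrow> j = i" for j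
        using 1 by (auto simp: Transposition.transpose_def)
      ultimately show ?thesis by (simp add: unit_def cong: if_cong)
    qed
    show ?thesis
    proof (rule result[of ?m])
      show "(\<Prod>i\<in>{1..d}. ?m i) = 2 ^ (k - 1) * s ^ d" using 1 by simp
      show "\<exists>b \<in> box ?m. (\<lambda>i. w i - b i) \<in> L" if w: "w \<in> ivectors d" for w
      proof -
        obtain l where l: "l \<in> L" "\<And>i. i \<in> {1..d} \<Longrightarrow> 0 \<le> w i - l i \<and> w i - l i < int (?m i)"
          by (rule reduce_mod_L[of "{1..d}" "unit (int s)" ?m w]) (use unitL s0 in \<open>auto simp: unit_def\<close>)
        show ?thesis by (rule box[OF l(1) w]) (rule l(2))
      qed
      show "b = b'" if b: "b \<in> box ?m" "b' \<in> box ?m" "(\<lambda>i. b i - b' i) \<in> L" for b b'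
      proof (rule ivectors_eqI[of _ d])
        show "b i = b' i" if "i \<in> {1..d}" for i
          using box_unique_aux[OF b(1,2) that] L_dvd[OF b(3), of i] by simp
      qed (use b in \<open>auto simp: box_def\<close>)
    qed (rule s0)
  next
    case 2
    let ?m = "\<lambda>i :: nat. if i = 1 then 2 * s else s"
    let ?g = "\<lambda>i j. if j = 1 \<or> j = i then int s else 0"
    have gen: "(\<lambda>j. if j = 1 \<or> j = i then e j * int s else 0) \<in> L"
      if i: "i \<in> {2..d}" and e: "\<And>j. e j \<in> {1, -1}" for i e
    proof -
      have "(\<lambda>j. if Transposition.transpose 2 i j \<in> {1..k} then e j * int s else 0) \<in> L"
        using i d e by (intro generator_in_L) auto
      moreover have "Transposition.transpose 2 i j \<in> {1..k} \<longleftrightarrow> j = 1 \<or> j = i" for j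
        using 2 i by (auto simp: Transposition.transpose_def)
      ultimately show ?thesis by simp
    qed
    have gL: "?g i \<in> L" if "i \<in> {2..d}" for i using gen[OF that, of "\<lambda>_. 1"] by (simp cong: if_cong)
    \<comment> \<open>The sum of s(1, 1, 0, ...) and s(1, -1, 0, ...).\<close>
    have "(\<lambda>j. ?g 2 j + (if j = 1 \<or> j = 2 then (if j = 1 then 1 else -1) * int s else 0)) \<in> L"
      using gL[of 2] gen[of 2 "\<lambda>j. if j = 1 then 1 else -1"] d by (intro L_add) auto
    also have "(\<lambda>j. ?g 2 j + (if j = 1 \<or> j = 2 then (if j = 1 then 1 else -1) * int s else 0))
        = unit (int (2 * s)) 1" by (auto simp: unit_def)
    finally have uL: "unit (int (2 * s)) 1 \<in> L" .
    show ?thesis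
    proof (rule result[of ?m])
      show "0 < ?m i" for i using s0 by simp
      have "(\<Prod>i\<in>{2..d}. ?m i) = (\<Prod>i\<in>{2..d}. s)" by (rule prod.cong) auto
      then show "(\<Prod>i\<in>{1..d}. ?m i) = 2 ^ (k - 1) * s ^ d"
        using split 2 d by (simp flip: power_Suc)
      show "\<exists>b \<in> box ?m. (\<lambda>i. w i - b i) \<in> L" if w: "w \<in> ivectors d" for w
      proof -
        obtain l where l: "l \<in> L" "\<And>i. i \<in> {2..d} \<Longrightarrow> 0 \<le> w i - l i \<and> w i - l i < int (?m i)"
          by (rule reduce_mod_L[of "{2..d}" ?g ?m w]) (use gL s0 in auto)
        obtain l' where l': "l' \<in> L" "\<And>i. i \<in> {1} \<Longrightarrow> 0 \<le> w i - l i - l' i \<and> w i - l i - l' i < int (?m i)"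
          "\<And>j. (\<And>i. i \<in> {1} \<Longrightarrow> unit (int (2 * s)) i j = 0) \<Longrightarrow> l' j = 0"
          by (rule reduce_mod_L[of "{1}" "unit (int (2 * s))" ?m "\<lambda>i. w i - l i"])
            (use uL s0 d in \<open>auto simp: unit_def\<close>)
        have "0 \<le> w i - (l i + l' i) \<and> w i - (l i + l' i) < int (?m i)" if i: "i \<in> {1..d}" for i
        proof (cases "i = 1")
          case True
          then show ?thesis using l'(2)[of i] by (simp add: algebra_simps)
        next
          case False
          then have "l' i = 0" by (intro l'(3)) (simp add: unit_def)
          then show ?thesis using l(2)[of i] i False by simp
        qed
        then show ?thesis by (rule box[OF L_add[OF l(1) l'(1)] w])
      qed
      show "b = b'" if b: "b \<in> box ?m" "b' \<in> box ?m" "(\<lambda>i. b i - b' i) \<in> L" for b b'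
      proof (rule ivectors_eqI[of _ d])
        have eq: "b i = b' i" if "i \<in> {2..d}" for i
          using box_unique_aux[OF b(1,2), of i] L_dvd[OF b(3), of i] that by simp
        obtain u where u: "(\<lambda>i. b i - b' i) = (\<lambda>i. int s * u i)" "even (\<Sum>i\<in>{1..d}. u i)"
          using L_E[OF b(3)] 2 by metis
        have bu: "b i - b' i = int s * u i" for i using fun_cong[OF u(1)] .
        have "u i = 0" if "i \<in> {2..d}" for i using bu[of i] eq[OF that] s0 by simp
        then have "(\<Sum>i\<in>{1..d}. u i) = u 1" using split by simp
        \<comment> \<open>All coordinates but the first agree, so the even coordinate sum is
          \<open>u 1\<close>.\<close>
        then have "int (?m 1) dvd b 1 - b' 1" using u(2) bu[of 1] by (simp add: mult_dvd_mono mult.commute[of 2])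
        then have "b 1 = b' 1" using box_unique_aux[OF b(1,2), of 1] d by simp
        then show "b i = b' i" if "i \<in> {1..d}" for i
          using eq[of i] that by (cases "i = 1") auto
      qed (use b in \<open>auto simp: box_def\<close>)
    qed
  next
    case 3
    let ?m = "\<lambda>i :: nat. if i = 1 then s else 2 * s"
    let ?one = "\<lambda>j. if j \<in> {1..d} then int s else 0"
    have gen: "(\<lambda>j. if j \<in> {1..d} then e j * int s else 0) \<in> L" if e: "\<And>j. e j \<in> {1, -1}" for e
      using generator_in_L[of 1 1 e] e d 3 by simp
    have oL: "?one \<in> L" using gen[of "\<lambda>_. 1"] by (simp cong: if_cong)
    have uL: "unit (int (2 * s)) i \<in> L" if i: "i \<in> {1..d}" for i
    proof -
      \<comment> \<open>The difference of two generators that differ in the sign of entry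
        \<open>i\<close> only.\<close>
      have "(\<lambda>j. ?one j - (if j \<in> {1..d} then (if j = i then -1 else 1) * int s else 0)) \<in> L"
        using gen[of "\<lambda>j. if j = i then -1 else 1"] oL by (intro L_diff) auto
      also have "(\<lambda>j. ?one j - (if j \<in> {1..d} then (if j = i then -1 else 1) * int s else 0))
          = unit (int (2 * s)) i" using i by (auto simp: unit_def)
      finally show ?thesis .
    qed
    show ?thesis
    proof (rule result[of ?m])
      show "0 < ?m i" for i using s0 by simp
      have "(\<Prod>i\<in>{2..d}. ?m i) = (\<Prod>i\<in>{2..d}. 2 * s)" by (rule prod.cong) auto
      then have "(\<Prod>i\<in>{1..d}. ?m i) = s * (2 * s) ^ (d - 1)" using split by simp
      also have "\<dots> = 2 ^ (k - 1) * s ^ d"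
        using 3 d by (cases d) (simp_all add: power_mult_distrib)
      finally show "(\<Prod>i\<in>{1..d}. ?m i) = 2 ^ (k - 1) * s ^ d" .
      show "\<exists>b \<in> box ?m. (\<lambda>i. w i - b i) \<in> L" if w: "w \<in> ivectors d" for w
      proof -
        obtain l where l: "l \<in> L" "\<And>i. i \<in> {1} \<Longrightarrow> 0 \<le> w i - l i \<and> w i - l i < int (?m i)"
          by (rule reduce_mod_L[of "{1}" "\<lambda>_. ?one" ?m w]) (use oL s0 d in auto)
        obtain l' where l': "l' \<in> L" "\<And>i. i \<in> {2..d} \<Longrightarrow> 0 \<le> w i - l i - l' i \<and> w i - l i - l' i < int (?m i)"
          "\<And>j. (\<And>i. i \<in> {2..d} \<Longrightarrow> unit (int (2 * s)) i j = 0) \<Longrightarrow> l' j = 0"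
          by (rule reduce_mod_L[of "{2..d}" "unit (int (2 * s))" ?m "\<lambda>i. w i - l i"])
            (use uL s0 d in \<open>auto simp: unit_def\<close>)
        have "l' 1 = 0" by (rule l'(3)) (simp add: unit_def)
        then have "0 \<le> w i - (l i + l' i) \<and> w i - (l i + l' i) < int (?m i)" if i: "i \<in> {1..d}" for i
          using l(2)[of i] l'(2)[of i] i by (cases "i = 1") (auto simp: algebra_simps)
        then show ?thesis by (rule box[OF L_add[OF l(1) l'(1)] w])
      qed
      show "b = b'" if b: "b \<in> box ?m" "b' \<in> box ?m" "(\<lambda>i. b i - b' i) \<in> L" for b b'
      proof (rule ivectors_eqI[of _ d])
        obtain u where u: "(\<lambda>i. b i - b' i) = (\<lambda>i. int s * u i)" "\<exists>c. \<forall>i \<in> {1..d}. odd (u i) = c"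
          using L_E[OF b(3)] 3 by metis
        have bu: "b i - b' i = int s * u i" for i using fun_cong[OF u(1)] .
        have one: "1 \<in> {1..d}" using d by simp
        have "b 1 = b' 1" by (rule box_unique_aux[OF b(1,2) one]) (simp add: bu)
        \<comment> \<open>The first coordinates agree, so \<open>u 1 = 0\<close>; the common parity
          then makes every \<open>u i\<close> even, which accounts for the sides
          \<open>2 * s\<close>.\<close>
        then have "even (u 1)" using bu[of 1] s0 by simp
        then have "even (u i)" if "i \<in> {1..d}" for i using u(2) one that by blast
        then have "int (2 * s) dvd b i - b' i" if "i \<in> {1..d}" for i
          using that by (simp add: bu mult_dvd_mono mult.commute[of 2])
        then show "b i = b' i" if "i \<in> {1..d}" for i
          using box_unique_aux[OF b(1,2) that] \<open>b 1 = b' 1\<close> that by (cases "i = 1") auto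
      qed (use b in \<open>auto simp: box_def\<close>)
    qed
  qed
qed

text \<open>A doubled centre splits into twice an integer vector, which matters only modulo
  \<open>L\<close>, and a vector of parities.\<close>

lemma finite_Field_Q: "finite (Field Q)"
proof -
  obtain m where m: "\<forall>i \<in> {1..d}. 0 < m i" "\<forall>w \<in> ivectors d. \<exists>b \<in> box m. (\<lambda>i. w i - b i) \<in> L"
    by (rule L_index)
  have "(\<Prod>i\<in>{1..d}. m i) \<noteq> 0" using m(1) by (metis finite_atLeastAtMost less_irrefl prod_zero_iff)
  then have fin: "finite (box m)" using card_box[of m] by (metis card.infinite)
  have fin': "finite (box (\<lambda>_. 2))" using card_box[of "\<lambda>_. 2"] by (metis card.infinite power_eq_0_iff prod_constant zero_neq_numeral)
  let ?f = "\<lambda>(b, a). cls (\<lambda>i. 2 * b i + a i)"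
  have "cls ` ivectors d \<subseteq> ?f ` (box m \<times> box (\<lambda>_. 2))"
  proof
    fix X assume "X \<in> cls ` ivectors d"
    then obtain c where c: "c \<in> ivectors d" "X = cls c" by blast
    let ?w = "\<lambda>i. c i div 2" and ?a = "\<lambda>i. c i mod 2"
    have w: "?w \<in> ivectors d" and a: "?a \<in> box (\<lambda>_. 2)" using c by (simp_all add: ivectors_def box_def)
    from bspec[OF m(2) w] obtain b where b: "b \<in> box m" "(\<lambda>i. ?w i - b i) \<in> L" ..
    have "(\<lambda>i. 2 * b i + ?a i) \<in> ivectors d" using b(1) c(1) by (simp add: box_def ivectors_def)
    then have "cls (\<lambda>i. (2 * b i + ?a i) + 2 * (?w i - b i)) = cls (\<lambda>i. 2 * b i + ?a i)"
      using b(2) by (rule cls_shift)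
    moreover have "(\<lambda>i. (2 * b i + ?a i) + 2 * (?w i - b i)) = c" by (auto simp: fun_eq_iff)
    ultimately have "X = ?f (b, ?a)" using c(2) by simp
    then show "X \<in> ?f ` (box m \<times> box (\<lambda>_. 2))" using b(1) a by (simp only: image_eqI mem_Sigma_iff)
  qed
  then have "finite (cls ` ivectors d)"
    by (rule finite_subset) (intro finite_imageI finite_cartesian_product fin fin')
  then show ?thesis by (simp add: Field_Q)
qed

section \<open>Flags of a cubic toroid\<close>

text \<open>
  The flag with vertex \<open>v\<close>, edge direction \<open>x\<^sub>1\<close>, plane directions \<open>x\<^sub>1, x\<^sub>2\<close> and so on, where
  \<open>e\<close> gives the sense of each direction: its \<open>j\<close>-face has the centre \<open>v + (e(x\<^sub>1) + \<dots> + e(x\<^sub>j)) / 2\<close>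
  (doubled in \<open>centre\<close>, as everywhere).
\<close>

definition centre :: "(nat \<Rightarrow> int) \<Rightarrow> (nat \<Rightarrow> int) \<Rightarrow> nat set \<Rightarrow> nat \<Rightarrow> int" where
  "centre v e U = (\<lambda>i. 2 * v i + (if i \<in> U then e i else 0))"

definition std_face :: "(nat \<Rightarrow> int) \<Rightarrow> nat list \<Rightarrow> (nat \<Rightarrow> int) \<Rightarrow> nat \<Rightarrow> (nat \<Rightarrow> real) set set" where
  "std_face v xs e j = cls (centre v e (set (take j xs)))"

definition std_flag :: "(nat \<Rightarrow> int) \<Rightarrow> nat list \<Rightarrow> (nat \<Rightarrow> int) \<Rightarrow> (nat \<Rightarrow> real) set set set" where
  "std_flag v xs e = insert bottom (insert whole (std_face v xs e ` {..d}))"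

abbreviation orderings :: "nat list set" where "orderings \<equiv> permutations_of_set {1..d}"

text \<open>Extensional, so that distinct choices of senses are distinct functions and there are
  \<open>2 ^ d\<close> of them.\<close>

definition signs :: "(nat \<Rightarrow> int) set" where "signs = {1..d} \<rightarrow>\<^sub>E {1, -1}"

lemma signs_mem: "e \<in> signs \<Longrightarrow> i \<in> {1..d} \<Longrightarrow> e i = 1 \<or> e i = -1"
  unfolding signs_def using PiE_mem[of e "{1..d}" "\<lambda>_. {1, -1}" i] by simp

lemma signs_odd: "e \<in> signs \<Longrightarrow> i \<in> {1..d} \<Longrightarrow> odd (e i)"
  using signs_mem[of e i] by auto

lemma orderingsD:
  assumes "xs \<in> orderings"
  shows "set xs = {1..d}" "distinct xs" "length xs = d"
  using assms by (simp_all add: permutations_of_set_def length_finite_permutations_of_set[OF assms])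

lemma ordering_take:
  assumes "xs \<in> orderings" "j \<le> d"
  shows "set (take j xs) \<subseteq> {1..d}" "card (set (take j xs)) = j"
proof -
  show "set (take j xs) \<subseteq> {1..d}" using orderingsD(1)[OF assms(1)] set_take_subset by metis
  have "distinct (take j xs)" using orderingsD(2)[OF assms(1)] by simp
  then show "card (set (take j xs)) = j" using orderingsD(3)[OF assms(1)] assms(2) by (simp add: distinct_card)
qed

lemma centre_ivectors: "v \<in> ivectors d \<Longrightarrow> U \<subseteq> {1..d} \<Longrightarrow> centre v e U \<in> ivectors d"
  by (auto simp: centre_def ivectors_def subset_iff)

lemma odd_coords_centre:
  assumes "e \<in> signs" "U \<subseteq> {1..d}"
  shows "odd_coords d (centre v e U) = U"
proof -
  have "i \<in> {1..d} \<and> odd (centre v e U i) \<longleftrightarrow> i \<in> U" for i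
    using signs_odd[OF assms(1), of i] assms(2) by (cases "i \<in> U") (auto simp: centre_def)
  then show ?thesis by (simp add: odd_coords_def)
qed

lemma face_le_centre:
  assumes "e \<in> signs" "U \<subseteq> U'" "U' \<subseteq> {1..d}"
  shows "face_le d (centre v e U) (centre v e U')"
  unfolding face_le_def
proof
  fix i assume i: "i \<in> {1..d}"
  show "centre v e U i = centre v e U' i \<or>
      odd (centre v e U' i) \<and> \<bar>centre v e U i - centre v e U' i\<bar> = 1"
    using signs_mem[OF assms(1) i] assms(2) by (auto simp: centre_def)
qed

lemma std_face_Field: "v \<in> ivectors d \<Longrightarrow> xs \<in> orderings \<Longrightarrow> j \<le> d \<Longrightarrow> std_face v xs e j \<in> Field Q"
  unfolding std_face_def Field_Q using centre_ivectors ordering_take(1) by blast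

lemma std_face_le:
  assumes "v \<in> ivectors d" "xs \<in> orderings" "e \<in> signs" "i \<le> j" "j \<le> d"
  shows "(std_face v xs e i, std_face v xs e j) \<in> Q"
proof -
  have sub: "set (take i xs) \<subseteq> set (take j xs)" using assms(4) by (rule set_take_subset_set_take)
  have j: "set (take j xs) \<subseteq> {1..d}" using ordering_take assms by blast
  have "face_le d (centre v e (set (take i xs))) (centre v e (set (take j xs)))"
    using assms(3) sub j by (rule face_le_centre)
  moreover have "centre v e (set (take i xs)) \<in> ivectors d" "centre v e (set (take j xs)) \<in> ivectors d"
    using centre_ivectors assms(1) j sub by blast+
  ultimately show ?thesis unfolding std_face_def Q_eq by blast
qed

lemma std_face_dim:
  assumes "v \<in> ivectors d" "xs \<in> orderings" "e \<in> signs" "j \<le> d" "c \<in> ivectors d"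
    and "std_face v xs e j = cls c"
  shows "card (odd_coords d c) = j"
proof -
  have t: "set (take j xs) \<subseteq> {1..d}" using ordering_take assms by blast
  have "odd_coords d (centre v e (set (take j xs))) = odd_coords d c"
    using assms(6) unfolding std_face_def
    by (rule cls_odd_coords[OF centre_ivectors[OF assms(1) t] assms(5)])
  then show ?thesis using odd_coords_centre[OF assms(3) t] ordering_take(2)[OF assms(2,4)] by simp
qed

lemma std_face_eq_iff:
  assumes "v \<in> ivectors d" "xs \<in> orderings" "e \<in> signs" "i \<le> d"
    and "v' \<in> ivectors d" "xs' \<in> orderings" "e' \<in> signs" "j \<le> d"
    and "std_face v xs e i = std_face v' xs' e' j"
  shows "i = j"
proof -
  have t: "set (take j xs') \<subseteq> {1..d}" using ordering_take assms by blast
  have "card (odd_coords d (centre v' e' (set (take j xs')))) = i"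
    by (rule std_face_dim[OF assms(1-4) centre_ivectors[OF assms(5) t]])
      (use assms(9) in \<open>simp add: std_face_def\<close>)
  then show ?thesis using odd_coords_centre[OF assms(7) t] ordering_take(2)[OF assms(6,8)] by simp
qed

lemma std_face_ne:
  assumes "v \<in> ivectors d" "xs \<in> orderings" "j \<le> d"
  shows "std_face v xs e j \<noteq> bottom" "std_face v xs e j \<noteq> whole"
  using cls_distinct[OF centre_ivectors[OF assms(1) ordering_take(1)[OF assms(2,3)]]]
  by (simp_all add: std_face_def)

lemma bottom_ne_whole: "bottom \<noteq> whole"
  using cls_distinct(3)[of "\<lambda>_. 0"] by (simp add: ivectors_def)

lemma std_flag_chain:
  assumes "v \<in> ivectors d" "xs \<in> orderings" "e \<in> signs"
  shows "std_flag v xs e \<in> Chains Q"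
proof -
  have F: "X \<in> Field Q" if "X \<in> std_flag v xs e" for X
    using that std_face_Field[OF assms(1,2)] by (auto simp: std_flag_def Field_Q)
  have "(X, Y) \<in> Q \<or> (Y, X) \<in> Q" if X: "X \<in> std_flag v xs e" and Y: "Y \<in> std_flag v xs e" for X Y
  proof (cases "X = bottom \<or> Y = bottom \<or> X = whole \<or> Y = whole")
    case True
    then show ?thesis using F[OF X] F[OF Y] by auto
  next
    case False
    then obtain i j where ij: "i \<le> d" "X = std_face v xs e i" "j \<le> d" "Y = std_face v xs e j"
      using X Y unfolding std_flag_def by blast
    show ?thesis
      using std_face_le[OF assms, of i j] std_face_le[OF assms, of j i] ij by (cases "i \<le> j") auto
  qed
  then show ?thesis by (simp add: Chains_def)
qed

lemma card_std_flag:
  assumes "v \<in> ivectors d" "xs \<in> orderings" "e \<in> signs"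
  shows "card (std_flag v xs e) = Suc d + 2" "finite (std_flag v xs e)"
proof -
  have "inj_on (std_face v xs e) {..d}"
    using std_face_eq_iff[OF assms _ assms] by (intro inj_onI) simp
  then have "card (std_face v xs e ` {..d}) = d + 1" by (simp add: card_image)
  moreover have "whole \<notin> std_face v xs e ` {..d}" "bottom \<notin> std_face v xs e ` {..d}"
    using std_face_ne[OF assms(1,2)] by (metis atMost_iff imageE)+
  ultimately show "card (std_flag v xs e) = Suc d + 2"
    unfolding std_flag_def using bottom_ne_whole by simp
  show "finite (std_flag v xs e)" by (simp add: std_flag_def)
qed

lemma orderings_nonempty: "[1..<Suc d] \<in> orderings"
  by (auto simp: permutations_of_set_def)

text \<open>The chain is lifted to the tessellation above a representative \<open>c0\<close> of its
  smallest proper face. The lifts form a chain of actual cubes; a vertex of \<open>c0\<close>, the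
  senses in which the larger cubes extend from it and a refinement of their nested direction sets
  give the standard flag.\<close>

lemma chain_in_std_flag:
  assumes C: "C \<in> Chains Q"
  obtains v xs e where "v \<in> ivectors d" "xs \<in> orderings" "e \<in> signs" "C \<subseteq> std_flag v xs e"
proof (cases "\<exists>c \<in> ivectors d. cls c \<in> C")
  case False
  have CF: "C \<subseteq> Field Q" using C by (auto simp: Chains_def Field_def)
  have "X = bottom \<or> X = whole" if "X \<in> C" for X
    using subsetD[OF CF that] by (cases rule: Field_Q_cases) (use False that in auto)
  then have "C \<subseteq> std_flag (\<lambda>_. 0) [1..<Suc d] (\<lambda>i\<in>{1..d}. 1)" unfolding std_flag_def by blast
  moreover have "(\<lambda>_. 0) \<in> ivectors d" by (simp add: ivectors_def)
  moreover have "(\<lambda>i\<in>{1..d}. 1) \<in> signs" by (simp add: signs_def)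
  ultimately show ?thesis using that orderings_nonempty by blast
next
  case True
  define S where "S = {c \<in> ivectors d. cls c \<in> C}"
  obtain c0 where c0: "c0 \<in> S" "\<And>c. c \<in> S \<Longrightarrow> card (odd_coords d c0) \<le> card (odd_coords d c)"
  proof -
    obtain c where "c \<in> S" using True unfolding S_def by blast
    from ex_has_least_nat[of "\<lambda>c. c \<in> S", OF this, of "\<lambda>c. card (odd_coords d c)"]
    show ?thesis using that by metis
  qed
  define K where "K = {c \<in> S. face_le d c0 c}"
  have KS: "c \<in> ivectors d" "cls c \<in> C" "face_le d c0 c" if "c \<in> K" for c
    using that by (simp_all add: K_def S_def)
  have c0': "c0 \<in> ivectors d" "cls c0 \<in> C" "c0 \<in> K" using c0(1) by (simp_all add: S_def K_def)
  have lift: "\<exists>c' \<in> K. cls c' = cls c" if c: "c \<in> ivectors d" "cls c \<in> C" for c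
  proof -
    have "(cls c0, cls c) \<in> Q \<or> (cls c, cls c0) \<in> Q" using C c c0' by (simp add: Chains_def)
    then show ?thesis
    proof
      assume "(cls c0, cls c) \<in> Q"
      then obtain c' where c': "c' \<in> ivectors d" "cls c = cls c'" "face_le d c0 c'"
        using c0'(1) cls_distinct(2)[OF c(1)] by (rule cls_leE)
      then have "c' \<in> K" using c(2) by (simp add: K_def S_def)
      then show ?thesis using c'(2) by auto
    next
      assume "(cls c, cls c0) \<in> Q"
      then obtain w where w: "w \<in> L" "face_le d c (\<lambda>i. c0 i + 2 * w i)"
        using cls_le_iff c(1) c0'(1) by blast
      \<comment> \<open>Minimality of \<open>c0\<close> rules out a proper subface, so
        \<open>c\<close> is a lattice translate of \<open>c0\<close>.\<close>
      have "card (odd_coords d c0) \<le> card (odd_coords d c)" using c0(2) c by (simp add: S_def)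
      then have "c = (\<lambda>i. c0 i + 2 * w i)"
        using w(2) c(1) shift_ivectors[OF c0'(1) w(1)] by (intro face_le_card_eq) simp_all
      then have "cls c0 = cls c" using cls_shift[OF c0'(1) w(1)] by simp
      then show ?thesis using c0'(3) by blast
    qed
  qed
  \<comment> \<open>Lifts above the common face \<open>c0\<close> cannot be displaced against each
    other, so incidence of classes becomes inclusion.\<close>
  have lin': "face_le d a b" if a: "a \<in> K" and b: "b \<in> K" and le: "(cls a, cls b) \<in> Q" for a b
  proof -
    obtain w where w: "w \<in> L" "face_le d a (\<lambda>i. b i + 2 * w i)"
      using le cls_le_iff KS(1)[OF a] KS(1)[OF b] by blast
    have "face_le d c0 (\<lambda>i. b i + 2 * w i)" using KS(3)[OF a] w(2) by (rule face_le_trans)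
    then have "w = (\<lambda>i. 0)" using face_above_unique[OF KS(3)[OF b] _ w(1)] by blast
    then show ?thesis using w(2) by simp
  qed
  have lin: "face_le d a b \<or> face_le d b a" if a: "a \<in> K" and b: "b \<in> K" for a b
    using C KS(2)[OF a] KS(2)[OF b] lin'[OF a b] lin'[OF b a] by (auto simp: Chains_def)
  \<comment> \<open>Rounding down selects the vertex of \<open>c0\<close> with least
    coordinates.\<close>
  define v where "v i = c0 i div 2" for i
  \<comment> \<open>All lifts that are odd at \<open>i\<close> agree there (\<open>odd_eq\<close>),
    so the choice does not matter. Directions in which no face of the chain extends get the default
    1.\<close>
  define e where "e = (\<lambda>i\<in>{1..d}. if \<exists>c \<in> K. odd (c i) then (SOME c. c \<in> K \<and> odd (c i)) i - 2 * v i else 1)"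
  have odd_eq: "a i = b i" if ab: "a \<in> K" "b \<in> K" "odd (a i)" "odd (b i)" and i: "i \<in> {1..d}" for a b i
  proof -
    have *: "x i = y i" if "face_le d x y" "odd (x i)" "odd (y i)" for x y :: "nat \<Rightarrow> int"
    proof (rule ccontr)
      assume "x i \<noteq> y i"
      then have "\<bar>x i - y i\<bar> = 1" using that(1) i by (auto simp: face_le_def)
      moreover have "even (x i - y i)" using that(2,3) by simp
      ultimately show False by (metis even_abs_add_iff odd_one abs_minus_commute dvd_abs_iff)
    qed
    show ?thesis using lin[OF ab(1,2)] *[of a b] *[of b a] ab(3,4) by auto
  qed
  have e: "e i = c i - 2 * v i" if c: "c \<in> K" "odd (c i)" and i: "i \<in> {1..d}" for c i
  proof -
    have "\<exists>c. c \<in> K \<and> odd (c i)" using c by blast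
    from someI_ex[OF this] have "(SOME c. c \<in> K \<and> odd (c i)) i = c i"
      using odd_eq[OF _ c(1) _ c(2) i] by blast
    then show ?thesis using c i by (auto simp: e_def)
  qed
  have even: "c i = 2 * v i" if c: "c \<in> K" "even (c i)" and i: "i \<in> {1..d}" for c i
  proof -
    have "c0 i = c i" using KS(3)[OF c(1)] c(2) i by (auto simp: face_le_def)
    then show ?thesis using c(2) by (simp add: v_def)
  qed
  have v: "v \<in> ivectors d" using c0'(1) by (simp add: ivectors_def v_def)
  have signs: "e \<in> signs"
    unfolding signs_def
  proof (rule PiE_I)
    fix i assume i: "i \<in> {1..d}"
    show "e i \<in> {1, -1}"
    proof (cases "\<exists>c \<in> K. odd (c i)")
      case True
      then obtain c where c: "c \<in> K" "odd (c i)" by blast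
      have "c0 i = c i \<or> \<bar>c0 i - c i\<bar> = 1" using KS(3)[OF c(1)] i by (auto simp: face_le_def)
      then have "c i - 2 * (c0 i div 2) = 1 \<or> c i - 2 * (c0 i div 2) = -1" using c(2) by presburger
      then show ?thesis using e[OF c i] by (auto simp: v_def)
    qed (use i in \<open>simp add: e_def\<close>)
  qed (simp only: e_def restrict_apply if_False)
  have centre: "c = centre v e (odd_coords d c)" if c: "c \<in> K" for c
  proof (rule ivectors_eqI[OF KS(1)[OF c]])
    show "centre v e (odd_coords d c) \<in> ivectors d"
      by (rule centre_ivectors[OF v]) (auto simp: odd_coords_def)
    show "c i = centre v e (odd_coords d c) i" if i: "i \<in> {1..d}" for i
      using e[OF c _ i] even[OF c _ i] i by (cases "odd (c i)") (simp_all add: centre_def odd_coords_def)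
  qed
  have "\<exists>xs \<in> orderings. \<forall>U \<in> odd_coords d ` K. U = set (take (card U) xs)"
  proof (rule nested_sets_ordering)
    show "U \<subseteq> {1..d}" if "U \<in> odd_coords d ` K" for U using that by (auto simp: odd_coords_def)
    show "U \<subseteq> U' \<or> U' \<subseteq> U" if U: "U \<in> odd_coords d ` K" "U' \<in> odd_coords d ` K" for U U'
    proof -
      obtain a b where ab: "a \<in> K" "b \<in> K" "U = odd_coords d a" "U' = odd_coords d b" using U by blast
      show ?thesis using lin[OF ab(1,2)] odd_coords_mono[of d a b] odd_coords_mono[of d b a] ab(3,4) by blast
    qed
  qed simp
  then obtain xs where xs: "xs \<in> orderings" "\<forall>U \<in> odd_coords d ` K. U = set (take (card U) xs)" ..
  have "X \<in> std_flag v xs e" if X: "X \<in> C" for X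
  proof -
    have "X \<in> Field Q" using X C by (auto simp: Chains_def Field_def)
    then show ?thesis
    proof (cases rule: Field_Q_cases)
      case (3 c)
      then obtain c' where c': "c' \<in> K" "cls c' = X" using lift[of c] X by auto
      let ?j = "card (odd_coords d c')"
      have "odd_coords d c' = set (take ?j xs)" using xs(2) c'(1) by blast
      then have "X = std_face v xs e ?j" using centre[OF c'(1)] c'(2) by (simp add: std_face_def)
      moreover have "odd_coords d c' \<subseteq> {1..d}" by (auto simp: odd_coords_def)
      then have "?j \<le> d" using card_mono[of "{1..d}" "odd_coords d c'"] by simp
      ultimately show ?thesis by (simp add: std_flag_def)
    qed (simp_all add: std_flag_def)
  qed
  then show ?thesis using that[OF v xs(1) signs] by blast
qed

text \<open>A chain containing a standard flag lies in another standard flag, which has the same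
  finite size, so all three coincide.\<close>

lemma std_flag_is_flag:
  assumes "v \<in> ivectors d" "xs \<in> orderings" "e \<in> signs"
  shows "std_flag v xs e \<in> flags Q"
proof -
  have "C = std_flag v xs e" if C: "C \<in> Chains Q" "std_flag v xs e \<subseteq> C" for C
  proof -
    obtain v' xs' e' where c: "v' \<in> ivectors d" "xs' \<in> orderings" "e' \<in> signs" "C \<subseteq> std_flag v' xs' e'"
      using C(1) by (rule chain_in_std_flag)
    have "std_flag v xs e = std_flag v' xs' e'"
      using C(2) c(4) card_std_flag[OF assms] card_std_flag[OF c(1-3)] by (intro card_subset_eq) auto
    then show ?thesis using C(2) c(4) by simp
  qed
  then show ?thesis using std_flag_chain[OF assms] by (simp add: flags_def)
qed

lemma flag_is_std_flag:
  assumes "\<Psi> \<in> flags Q"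
  obtains v xs e where "v \<in> ivectors d" "xs \<in> orderings" "e \<in> signs" "\<Psi> = std_flag v xs e"
proof -
  have "\<Psi> \<in> Chains Q" using assms by (simp add: flags_def)
  then obtain v xs e where c: "v \<in> ivectors d" "xs \<in> orderings" "e \<in> signs" "\<Psi> \<subseteq> std_flag v xs e"
    by (rule chain_in_std_flag)
  have "std_flag v xs e = \<Psi>" using assms c(4) std_flag_chain[OF c(1-3)] by (simp add: flags_def)
  then have "\<Psi> = std_flag v xs e" ..
  with c(1-3) show ?thesis by (rule that)
qed

sublocale flag_graded_poset "Suc d" Q
proof
  show "card \<Psi> = Suc d + 2" if "\<Psi> \<in> flags Q" for \<Psi>
    using that by (rule flag_is_std_flag) (simp add: card_std_flag)
qed (rule finite_Field_Q partial_order_Q)+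

lemma std_face_shift:
  assumes "b \<in> ivectors d" "w \<in> L" "xs \<in> orderings" "j \<le> d"
  shows "std_face (\<lambda>i. b i + w i) xs e j = std_face b xs e j"
proof -
  have "centre (\<lambda>i. b i + w i) e (set (take j xs)) = (\<lambda>i. centre b e (set (take j xs)) i + 2 * w i)"
    by (auto simp: centre_def fun_eq_iff)
  then show ?thesis
    unfolding std_face_def
    using cls_shift[OF centre_ivectors[OF assms(1) ordering_take(1)[OF assms(3,4)]] assms(2), of e] by simp
qed

lemma std_flag_shift:
  assumes "b \<in> ivectors d" "w \<in> L" "xs \<in> orderings"
  shows "std_flag (\<lambda>i. b i + w i) xs e = std_flag b xs e"
  unfolding std_flag_def using std_face_shift[OF assms] by (auto cong: image_cong_simp)

lemma std_face_in_std_flag: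
  assumes "v \<in> ivectors d" "xs \<in> orderings" "e \<in> signs" "v' \<in> ivectors d" "xs' \<in> orderings" "e' \<in> signs"
    and "std_flag v xs e = std_flag v' xs' e'" "j \<le> d"
  shows "std_face v xs e j = std_face v' xs' e' j"
proof -
  have "std_face v xs e j \<in> std_flag v' xs' e'" using assms(7,8) unfolding std_flag_def by blast
  then obtain i where i: "i \<le> d" "std_face v xs e j = std_face v' xs' e' i"
    using std_face_ne[OF assms(1,2,8)] unfolding std_flag_def by blast
  have "j = i" by (rule std_face_eq_iff[OF assms(1-3,8) assms(4-6) i])
  then show ?thesis using i(2) by simp
qed

text \<open>Faces of the two flags agree up to a lattice vector. Both lie above the same vertex
  \<open>v\<close>, so this vector is zero; the prefixes and senses can then be read off the
  centres.\<close>

lemma std_flag_inj: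
  assumes a: "v \<in> ivectors d" "xs \<in> orderings" "e \<in> signs" and b: "xs' \<in> orderings" "e' \<in> signs"
    and eq: "std_flag v xs e = std_flag v xs' e'"
  shows "xs = xs'" "e = e'"
proof -
  have c: "centre v e (set (take j xs)) = centre v e' (set (take j xs'))" if j: "j \<le> d" for j
  proof -
    let ?a = "centre v e (set (take j xs))" and ?b = "centre v e' (set (take j xs'))"
    note ta = ordering_take(1)[OF a(2) j] and tb = ordering_take(1)[OF b(1) j]
    have "cls ?b = cls ?a" using std_face_in_std_flag[OF a a(1) b eq j] by (simp add: std_face_def)
    then obtain w where w: "w \<in> L" "?a = (\<lambda>i. ?b i + 2 * w i)"
      using cls_eq_iff centre_ivectors[OF a(1) ta] centre_ivectors[OF a(1) tb] by blast
    have va: "face_le d (centre v e {}) ?a" using face_le_centre[OF a(3) empty_subsetI ta] .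
    have vb: "face_le d (centre v e {}) ?b" using face_le_centre[OF b(2) empty_subsetI tb] by (simp add: centre_def)
    have "w = (\<lambda>i. 0)" using face_above_unique[OF vb _ w(1)] va w(2) by simp
    then show ?thesis using w(2) by simp
  qed
  have "set (take j xs) = set (take j xs')" if j: "j \<le> d" for j
    using c[OF j] odd_coords_centre[OF a(3) ordering_take(1)[OF a(2) j], of v]
      odd_coords_centre[OF b(2) ordering_take(1)[OF b(1) j], of v] by simp
  then show "xs = xs'" using orderingsD[OF a(2)] orderingsD[OF b(1)] by (intro set_take_eq_imp_eq) simp_all
  have "e i = e' i" if i: "i \<in> {1..d}" for i
    using fun_cong[OF c[OF order_refl], of i] i orderingsD[OF a(2)] orderingsD[OF b(1)] by (simp add: centre_def)
  then show "e = e'" using a(3) b(2) unfolding signs_def by (metis PiE_ext)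
qed

text \<open>The vertex counts only modulo \<open>L\<close>, so it ranges over a box of
  representatives; orderings contribute \<open>fact d\<close> and senses
  \<open>2 ^ d\<close>.\<close>

lemma card_flags_Q: "card (flags Q) = 2 ^ (k - 1) * s ^ d * fact d * 2 ^ d"
proof -
  obtain m where "\<forall>i \<in> {1..d}. 0 < m i" and m: "(\<Prod>i\<in>{1..d}. m i) = 2 ^ (k - 1) * s ^ d"
    "\<forall>w \<in> ivectors d. \<exists>b \<in> box m. (\<lambda>i. w i - b i) \<in> L"
    "\<forall>b \<in> box m. \<forall>b' \<in> box m. (\<lambda>i. b i - b' i) \<in> L \<longrightarrow> b = b'" by (rule L_index)
  let ?f = "\<lambda>(v, xs, e). std_flag v xs e"
  have bv: "b \<in> ivectors d" if "b \<in> box m" for b using that by (simp add: box_def)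
  have "bij_betw ?f (box m \<times> orderings \<times> signs) (flags Q)"
    unfolding bij_betw_def
  proof
    show "inj_on ?f (box m \<times> orderings \<times> signs)"
    proof (rule inj_onI)
      fix x y assume x: "x \<in> box m \<times> orderings \<times> signs" and y: "y \<in> box m \<times> orderings \<times> signs"
        and f: "?f x = ?f y"
      obtain v xs e v' xs' e' where xy: "x = (v, xs, e)" "y = (v', xs', e')" by (metis surj_pair)
      have a: "v \<in> box m" "xs \<in> orderings" "e \<in> signs" and b: "v' \<in> box m" "xs' \<in> orderings" "e' \<in> signs"
        and eq: "std_flag v xs e = std_flag v' xs' e'"
        using x y f xy by simp_all
      have "std_face v xs e 0 = std_face v' xs' e' 0"
        using std_face_in_std_flag[OF bv[OF a(1)] a(2,3) bv[OF b(1)] b(2,3) eq, of 0] by simp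
      then have "cls (\<lambda>i. 2 * v' i) = cls (\<lambda>i. 2 * v i)" by (simp add: std_face_def centre_def)
      moreover have "(\<lambda>i. 2 * v i) \<in> ivectors d" "(\<lambda>i. 2 * v' i) \<in> ivectors d"
        using bv a(1) b(1) by (simp_all add: ivectors_def)
      ultimately obtain w where w: "w \<in> L" "(\<lambda>i. 2 * v i) = (\<lambda>i. 2 * v' i + 2 * w i)"
        using cls_eq_iff by blast
      have "w = (\<lambda>i. v i - v' i)"
      proof
        show "w i = v i - v' i" for i using fun_cong[OF w(2), of i] by simp
      qed
      then have v: "v = v'" using w(1) m(3) a(1) b(1) by simp
      show "x = y"
        unfolding xy using v std_flag_inj[OF bv[OF a(1)] a(2,3) b(2,3)] eq by simp
    qed
    show "?f ` (box m \<times> orderings \<times> signs) = flags Q"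
    proof (intro equalityI subsetI)
      fix \<Psi> assume "\<Psi> \<in> flags Q"
      then obtain v xs e where c: "v \<in> ivectors d" "xs \<in> orderings" "e \<in> signs" "\<Psi> = std_flag v xs e"
        by (rule flag_is_std_flag)
      from bspec[OF m(2) c(1)] obtain b where b: "b \<in> box m" "(\<lambda>i. v i - b i) \<in> L" ..
      have "std_flag (\<lambda>i. b i + (v i - b i)) xs e = std_flag b xs e"
        by (rule std_flag_shift[OF bv[OF b(1)] b(2) c(2)])
      then have "\<Psi> = ?f (b, xs, e)" using c(4) by simp
      moreover have "(b, xs, e) \<in> box m \<times> orderings \<times> signs" using b(1) c(2,3) by simp
      ultimately show "\<Psi> \<in> ?f ` (box m \<times> orderings \<times> signs)" by (rule image_eqI)
    qed (use std_flag_is_flag bv in auto)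
  qed
  then have "card (flags Q) = card (box m \<times> orderings \<times> signs)" by (metis bij_betw_same_card)
  also have "\<dots> = 2 ^ (k - 1) * s ^ d * fact d * 2 ^ d"
    using m(1) by (simp add: card_cartesian_product card_box signs_def card_PiE numeral_2_eq_2)
  finally show ?thesis .
qed

section \<open>The diamond condition\<close>

lemma std_face_strictly_below_iff:
  assumes "v \<in> ivectors d" "xs \<in> orderings" "e \<in> signs" "i \<le> d" "j \<le> d"
  shows "strictly_below Q (std_face v xs e i) (std_face v xs e j) \<longleftrightarrow> i < j"
proof
  assume sb: "strictly_below Q (std_face v xs e i) (std_face v xs e j)"
  show "i < j"
  proof (rule ccontr)
    assume "\<not> i < j"
    then have "(std_face v xs e j, std_face v xs e i) \<in> Q"
      using assms by (intro std_face_le) auto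
    then show False using sb le_antisym by (auto simp: strictly_below_def)
  qed
next
  assume "i < j"
  then show "strictly_below Q (std_face v xs e i) (std_face v xs e j)"
    using std_face_le[OF assms(1-3), of i j] std_face_eq_iff[OF assms(1-4) assms(1-3,5)] assms(5)
    by (auto simp: strictly_below_def)
qed

lemma rank_std_face:
  assumes "v \<in> ivectors d" "xs \<in> orderings" "e \<in> signs" "j \<le> d"
  shows "face_rank Q (std_face v xs e j) = int j"
proof -
  have "{G \<in> std_flag v xs e. strictly_below Q G (std_face v xs e j)}
      = insert bottom (std_face v xs e ` {..<j})" (is "?L = ?R")
  proof (intro equalityI subsetI)
    fix G assume G: "G \<in> ?L"
    then have "G \<noteq> whole" using std_face_ne[OF assms(1,2,4)] by (auto simp: strictly_below_def)
    then consider "G = bottom" | i where "i \<le> d" "G = std_face v xs e i"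
      using G unfolding std_flag_def by blast
    then show "G \<in> ?R"
    proof cases
      case 2
      then show ?thesis using G std_face_strictly_below_iff[OF assms(1-3) 2(1) assms(4)] by simp
    qed simp
  next
    fix G assume "G \<in> ?R"
    then consider "G = bottom" | i where "i < j" "G = std_face v xs e i" by blast
    then show "G \<in> ?L"
    proof cases
      case 1
      then show ?thesis using std_face_Field[OF assms(1,2,4)] std_face_ne[OF assms(1,2,4)]
        by (auto simp: strictly_below_def std_flag_def)
    next
      case 2
      then show ?thesis using std_face_strictly_below_iff[OF assms(1-3) _ assms(4), of i] assms(4)
        by (auto simp: std_flag_def)
    qed
  qed
  moreover have "card ?R = j + 1"
  proof -
    have "inj_on (std_face v xs e) {..<j}"
      using std_face_eq_iff[OF assms(1-3) _ assms(1-3)] assms(4) by (intro inj_onI) simp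
    moreover have "bottom \<notin> std_face v xs e ` {..<j}"
    proof
      assume "bottom \<in> std_face v xs e ` {..<j}"
      then obtain i where "i < j" "bottom = std_face v xs e i" by blast
      then show False using std_face_ne(1)[OF assms(1,2), of i e] assms(4) by simp
    qed
    ultimately show ?thesis by (simp add: card_image)
  qed
  moreover have "std_face v xs e j \<in> std_flag v xs e" using assms(4) by (simp add: std_flag_def)
  ultimately show ?thesis using rank_in_flag[OF std_flag_is_flag[OF assms(1-3)]] by simp
qed

lemma rank_bottom: "face_rank Q bottom = -1"
proof -
  have "bottom \<in> Field Q" by (simp add: Field_Q)
  then obtain \<Psi> where \<Psi>: "\<Psi> \<in> flags Q" "bottom \<in> \<Psi>" by (rule face_in_flag)
  have "{G \<in> \<Psi>. strictly_below Q G bottom} = {}" by (auto simp: strictly_below_def)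
  then have "card {G \<in> \<Psi>. strictly_below Q G bottom} = 0" by (simp only: card.empty)
  then show ?thesis using rank_in_flag[OF \<Psi>] by simp
qed

lemma rank_whole: "face_rank Q whole = int d + 1"
proof -
  have "whole \<in> Field Q" by (simp add: Field_Q)
  then obtain \<Psi> where \<Psi>: "\<Psi> \<in> flags Q" "whole \<in> \<Psi>" by (rule face_in_flag)
  have "{G \<in> \<Psi>. strictly_below Q G whole} = \<Psi> - {whole}"
    using flag_Field[OF \<Psi>(1)] by (auto simp: strictly_below_def)
  then have "card {G \<in> \<Psi>. strictly_below Q G whole} = Suc d + 1"
    using \<Psi> card_flag[OF \<Psi>(1)] by simp
  then show ?thesis using rank_in_flag[OF \<Psi>] by simp
qed

text \<open>Any flag through the class is standard, and there position and dimension agree.\<close>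

lemma rank_cls:
  assumes "c \<in> ivectors d"
  shows "face_rank Q (cls c) = int (card (odd_coords d c))"
proof -
  have "cls c \<in> Field Q" using assms by (simp add: Field_Q)
  then obtain \<Psi> where \<Psi>: "\<Psi> \<in> flags Q" "cls c \<in> \<Psi>" by (rule face_in_flag)
  obtain v xs e where v: "v \<in> ivectors d" "xs \<in> orderings" "e \<in> signs" "\<Psi> = std_flag v xs e"
    using \<Psi>(1) by (rule flag_is_std_flag)
  obtain j where j: "j \<le> d" "cls c = std_face v xs e j"
    using \<Psi>(2) v(4) cls_distinct[OF assms] unfolding std_flag_def by auto
  show ?thesis
    using rank_std_face[OF v(1-3) j(1)] std_face_dim[OF v(1-3) j(1) assms] j(2) by simp
qed

lemma cls_strictly_belowI:
  assumes "b \<in> ivectors d" "c \<in> ivectors d" "face_le d b c" "b \<noteq> c"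
  shows "strictly_below Q (cls b) (cls c)"
proof -
  have "cls b \<noteq> cls c"
  proof
    assume "cls b = cls c"
    then have "odd_coords d b = odd_coords d c" using assms(1,2) by (intro cls_odd_coords)
    then have "b = c" using face_le_odd_coords_eq[OF assms(3)] assms(1,2) by (intro ivectors_eqI) auto
    then show False using assms(4) by simp
  qed
  moreover have "(cls b, cls c) \<in> Q" using assms(1-3) unfolding Q_eq by blast
  ultimately show ?thesis by (simp add: strictly_below_def)
qed

lemma ivectors_upd: "c \<in> ivectors d \<Longrightarrow> x \<in> {1..d} \<Longrightarrow> c(x := a) \<in> ivectors d"
  by (auto simp: ivectors_def)

text \<open>An identification would need a lattice vector with entry -1, which
  \<open>s \<ge> 2\<close> does not divide. So the two ends of an edge, and the two cells at a wall,
  are distinct.\<close>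

lemma cls_upd_ne:
  assumes "c \<in> ivectors d" "x \<in> {1..d}"
  shows "cls (c(x := c x + 1)) \<noteq> cls (c(x := c x - 1))"
proof
  assume "cls (c(x := c x + 1)) = cls (c(x := c x - 1))"
  then obtain w where w: "w \<in> L" "c(x := c x - 1) = (\<lambda>i. (c(x := c x + 1)) i + 2 * w i)"
    using cls_eq_iff[OF ivectors_upd[OF assms] ivectors_upd[OF assms]] by blast
  have "w x = -1" using fun_cong[OF w(2), of x] by simp
  then show False using L_dvd[OF w(1), of x] s by simp
qed

lemma upd_pm1:
  assumes "b \<in> ivectors d" "c \<in> ivectors d" "x \<in> {1..d}" "\<And>i. i \<in> {1..d} \<Longrightarrow> i \<noteq> x \<Longrightarrow> b i = c i" "\<bar>b x - c x\<bar> = 1"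
  shows "b = c(x := c x + 1) \<or> b = c(x := c x - 1)"
proof -
  have "b = c(x := b x)"
    by (rule ivectors_eqI[OF assms(1) ivectors_upd[OF assms(2,3)]]) (use assms(4) in auto)
  moreover have "b x = c x + 1 \<or> b x = c x - 1" using assms(5) by linarith
  ultimately show ?thesis by metis
qed

text \<open>The edge is odd in direction \<open>x\<close> only, so a face below it can differ from
  it only there.\<close>

lemma between_bottom_edge:
  assumes c: "c \<in> ivectors d" and x: "odd_coords d c = {x}"
  shows "{H. strictly_below Q bottom H \<and> strictly_below Q H (cls c)}
    = {cls (c(x := c x + 1)), cls (c(x := c x - 1))}"
proof (intro equalityI subsetI)
  have xd: "x \<in> {1..d}" "odd (c x)" using x by (auto simp: odd_coords_def)
  fix H assume "H \<in> {H. strictly_below Q bottom H \<and> strictly_below Q H (cls c)}"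
  then have H: "H \<noteq> bottom" "(H, cls c) \<in> Q" "H \<noteq> cls c" by (auto simp: strictly_below_def)
  obtain b where b: "b \<in> ivectors d" "H = cls b" "face_le d b c"
    using H(2) c H(1) by (rule le_clsE)
  have eq: "b i = c i" if "i \<in> {1..d}" "i \<noteq> x" for i
  proof -
    have "even (c i)" using that x by (auto simp: odd_coords_def)
    then show ?thesis using b(3) that(1) by (auto simp: face_le_def)
  qed
  have "b x \<noteq> c x"
  proof
    assume "b x = c x"
    then have "b i = c i" if "i \<in> {1..d}" for i using eq[OF that] by (cases "i = x") simp_all
    then have "b = c" by (rule ivectors_eqI[OF b(1) c])
    then show False using H(3) b(2) by simp
  qed
  then have "\<bar>b x - c x\<bar> = 1" by (rule face_le_neD(3)[OF b(3) xd(1)])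
  then have "b = c(x := c x + 1) \<or> b = c(x := c x - 1)" using b(1) c xd(1) eq by (intro upd_pm1)
  then show "H \<in> {cls (c(x := c x + 1)), cls (c(x := c x - 1))}" using b(2) by blast
next
  have xd: "x \<in> {1..d}" "odd (c x)" using x by (auto simp: odd_coords_def)
  have "cls (c(x := c x + a)) \<in> {H. strictly_below Q bottom H \<and> strictly_below Q H (cls c)}" if "\<bar>a\<bar> = 1" for a
  proof -
    have iv: "c(x := c x + a) \<in> ivectors d" using c xd(1) by (rule ivectors_upd)
    have "strictly_below Q (cls (c(x := c x + a))) (cls c)"
    proof (rule cls_strictly_belowI[OF iv c])
      show "face_le d (c(x := c x + a)) c" using xd(2) that by (simp add: face_le_def)
      have "(c(x := c x + a)) x \<noteq> c x" using that by auto
      then show "c(x := c x + a) \<noteq> c" by metis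
    qed
    moreover have "strictly_below Q bottom (cls (c(x := c x + a)))"
      using cls_distinct(1)[OF iv] iv by (auto simp: strictly_below_def Field_Q)
    ultimately show ?thesis by simp
  qed
  from this[of 1] this[of "-1"]
  show "H \<in> {H. strictly_below Q bottom H \<and> strictly_below Q H (cls c)}"
    if "H \<in> {cls (c(x := c x + 1)), cls (c(x := c x - 1))}" for H using that by auto
qed

text \<open>A wall of dimension \<open>d - 1\<close> is even in direction \<open>x\<close> only, so
  the larger cubes are the cells on its two sides.\<close>

lemma between_ridge_whole:
  assumes c: "c \<in> ivectors d" and x: "x \<in> {1..d}" "odd_coords d c = {1..d} - {x}"
  shows "{H. strictly_below Q (cls c) H \<and> strictly_below Q H whole}
    = {cls (c(x := c x + 1)), cls (c(x := c x - 1))}"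
proof (intro equalityI subsetI)
  fix H assume "H \<in> {H. strictly_below Q (cls c) H \<and> strictly_below Q H whole}"
  then have H: "H \<noteq> whole" "(cls c, H) \<in> Q" "H \<noteq> cls c" by (auto simp: strictly_below_def)
  obtain b where b: "b \<in> ivectors d" "H = cls b" "face_le d c b"
    using H(2) c H(1) by (rule cls_leE)
  have eq: "b i = c i" if i: "i \<in> {1..d}" "i \<noteq> x" for i
  proof (rule ccontr)
    assume "b i \<noteq> c i"
    then have "even (c i)" using face_le_neD(2)[OF b(3) i(1)] by simp
    moreover have "i \<in> odd_coords d c" using x(2) i by simp
    ultimately show False by (simp add: odd_coords_def)
  qed
  have "b x \<noteq> c x"
  proof
    assume "b x = c x"
    then have "b i = c i" if "i \<in> {1..d}" for i using eq[OF that] by (cases "i = x") simp_all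
    then have "b = c" by (rule ivectors_eqI[OF b(1) c])
    then show False using H(3) b(2) by simp
  qed
  then have "\<bar>b x - c x\<bar> = 1" using face_le_neD(3)[OF b(3) x(1)] by (simp add: abs_minus_commute)
  then have "b = c(x := c x + 1) \<or> b = c(x := c x - 1)" using b(1) c x(1) eq by (intro upd_pm1)
  then show "H \<in> {cls (c(x := c x + 1)), cls (c(x := c x - 1))}" using b(2) by blast
next
  have "x \<notin> odd_coords d c" using x(2) by simp
  then have ev: "even (c x)" using x(1) by (simp add: odd_coords_def)
  have "cls (c(x := c x + a)) \<in> {H. strictly_below Q (cls c) H \<and> strictly_below Q H whole}" if a: "\<bar>a\<bar> = 1" for a
  proof -
    have iv: "c(x := c x + a) \<in> ivectors d" using c x(1) by (rule ivectors_upd)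
    have "strictly_below Q (cls c) (cls (c(x := c x + a)))"
    proof (rule cls_strictly_belowI[OF c iv])
      have "odd (c x + a)" using ev a by presburger
      then show "face_le d c (c(x := c x + a))" using a by (simp add: face_le_def)
      have "(c(x := c x + a)) x \<noteq> c x" using a by auto
      then show "c \<noteq> c(x := c x + a)" by metis
    qed
    moreover have "strictly_below Q (cls (c(x := c x + a))) whole"
      using cls_distinct(2)[OF iv] iv by (auto simp: strictly_below_def Field_Q)
    ultimately show ?thesis by simp
  qed
  from this[of 1] this[of "-1"]
  show "H \<in> {H. strictly_below Q (cls c) H \<and> strictly_below Q H whole}"
    if "H \<in> {cls (c(x := c x + 1)), cls (c(x := c x - 1))}" for H using that by auto
qed

text \<open>An intermediate class is lifted above \<open>c\<close>; \<open>face_above_unique\<close>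
  then places the lift below \<open>c'\<close> itself. By \<open>face_le_between\<close> it takes
  each coordinate from \<open>c\<close> or from \<open>c'\<close>, which leaves a choice only at
  \<open>x\<close> and \<open>y\<close>.\<close>

lemma between_cls:
  assumes c: "c \<in> ivectors d" and c': "c' \<in> ivectors d" and le: "face_le d c c'"
    and xy: "odd_coords d c' - odd_coords d c = {x, y}" "x \<noteq> y"
  shows "{H. strictly_below Q (cls c) H \<and> strictly_below Q H (cls c')}
    = {cls (c(x := c' x)), cls (c(y := c' y))}"
proof (intro equalityI subsetI)
  have xd: "x \<in> {1..d}" "y \<in> {1..d}" using xy(1) by (auto simp: odd_coords_def)
  have eq: "c i = c' i" if i: "i \<in> {1..d}" "i \<noteq> x" "i \<noteq> y" for i
  proof (rule ccontr)
    assume "c i \<noteq> c' i"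
    then have *: "odd (c' i)" "even (c i)" using face_le_neD[OF le i(1)] by simp_all
    then have "i \<in> odd_coords d c' - odd_coords d c" using * i(1) by (simp add: odd_coords_def)
    then show False using xy(1) i(2,3) by simp
  qed
  fix H assume "H \<in> {H. strictly_below Q (cls c) H \<and> strictly_below Q H (cls c')}"
  then have H: "(cls c, H) \<in> Q" "H \<noteq> cls c" "(H, cls c') \<in> Q" "H \<noteq> cls c'" by (auto simp: strictly_below_def)
  have "H \<noteq> whole" using H(3,4) by auto
  with H(1) c obtain b where b: "b \<in> ivectors d" "H = cls b" "face_le d c b" by (rule cls_leE)
  obtain w where w: "w \<in> L" "face_le d b (\<lambda>i. c' i + 2 * w i)"
    using H(3) b(1,2) cls_le_iff[OF b(1) c'] by blast
  have "w = (\<lambda>i. 0)" using face_above_unique[OF le face_le_trans[OF b(3) w(2)] w(1)] .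
  then have bc': "face_le d b c'" using w(2) by simp
  have bi: "b i = c i \<or> b i = c' i" if "i \<in> {1..d}" for i
    using face_le_between[OF b(3) bc' that] .
  have "b = c(x := b x, y := b y)"
    using ivectors_upd[OF ivectors_upd[OF c xd(1)] xd(2)] bi eq by (intro ivectors_eqI[OF b(1)]) (auto, metis)
  moreover have "c' = c(x := c' x, y := c' y)"
    using ivectors_upd[OF ivectors_upd[OF c xd(1)] xd(2)] eq by (intro ivectors_eqI[OF c']) auto
  moreover have "b \<noteq> c" "b \<noteq> c'" using H(2,4) b(2) by auto
  ultimately have "b = c(x := c' x) \<or> b = c(y := c' y)"
    using bi[OF xd(1)] bi[OF xd(2)] by (metis fun_upd_triv fun_upd_twist)
  then show "H \<in> {cls (c(x := c' x)), cls (c(y := c' y))}" using b(2) by blast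
next
  have *: "cls (c(z := c' z)) \<in> {H. strictly_below Q (cls c) H \<and> strictly_below Q H (cls c')}"
    if z: "z \<in> {1..d}" "odd (c' z)" "even (c z)" and u: "u \<in> {1..d}" "odd (c' u)" "even (c u)" "u \<noteq> z" for z u
  proof -
    have iv: "c(z := c' z) \<in> ivectors d" using c z(1) by (rule ivectors_upd)
    have "c z \<noteq> c' z" "c u \<noteq> c' u" using z(2,3) u(2,3) by auto
    then have "(c(z := c' z)) z \<noteq> c z" "(c(z := c' z)) u \<noteq> c' u" using u(4) by auto
    then have ne: "c \<noteq> c(z := c' z)" "c(z := c' z) \<noteq> c'" by metis+
    have "face_le d c (c(z := c' z))" "face_le d (c(z := c' z)) c'"
      using le z by (auto simp: face_le_def)
    then show ?thesis using cls_strictly_belowI[OF c iv] cls_strictly_belowI[OF iv c'] ne by blast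
  qed
  have "x \<in> odd_coords d c' - odd_coords d c" "y \<in> odd_coords d c' - odd_coords d c" using xy(1) by auto
  then have "x \<in> {1..d}" "odd (c' x)" "even (c x)" "y \<in> {1..d}" "odd (c' y)" "even (c y)"
    by (auto simp: odd_coords_def)
  then show "H \<in> {H. strictly_below Q (cls c) H \<and> strictly_below Q H (cls c')}"
    if "H \<in> {cls (c(x := c' x)), cls (c(y := c' y))}" for H
    using that *[of x y] *[of y x] xy(2) by blast
qed

lemma diamond_Q: "diamond_condition Q"
  unfolding diamond_condition_def
proof (intro allI impI)
  fix F G assume "(F, G) \<in> Q \<and> face_rank Q G = face_rank Q F + 2"
  then have FG: "(F, G) \<in> Q" "face_rank Q G = face_rank Q F + 2" by auto
  have "F \<in> Field Q" using FG(1) by (rule FieldI1)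
  then show "card {H. strictly_below Q F H \<and> strictly_below Q H G} = 2"
  proof (cases rule: Field_Q_cases)
    case 1
    \<comment> \<open>Here \<open>G\<close> has rank 1, whereas \<open>whole\<close> has rank
      \<open>d + 1\<close>.\<close>
    have "G \<noteq> bottom" "G \<noteq> whole" using FG(2) 1 rank_bottom rank_whole d by auto
    moreover have "G \<in> Field Q" using FG(1) by (rule FieldI2)
    ultimately obtain c where c: "c \<in> ivectors d" "G = cls c" by (auto elim: Field_Q_cases)
    have "card (odd_coords d c) = 1" using FG(2) 1 c rank_bottom rank_cls by simp
    then obtain x where x: "odd_coords d c = {x}" by (auto simp: card_1_singleton_iff)
    then have "x \<in> {1..d}" by (auto simp: odd_coords_def)
    then show ?thesis using between_bottom_edge[OF c(1) x] 1 c cls_upd_ne[OF c(1)] by simp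
  next
    case 2
    then have "G = whole" using FG(1) by simp
    then show ?thesis using 2 FG(2) by simp
  next
    case (3 c)
    show ?thesis
    proof (cases "G = whole")
      case True
      have "card (odd_coords d c) + 1 = d" using FG(2) True 3 rank_whole rank_cls by simp
      moreover have "odd_coords d c \<subseteq> {1..d}" by (auto simp: odd_coords_def)
      ultimately have "card ({1..d} - odd_coords d c) = 1" by (simp add: card_Diff_subset)
      then obtain x where x: "{1..d} - odd_coords d c = {x}" by (auto simp: card_1_singleton_iff)
      have "x \<in> {1..d}" "odd_coords d c = {1..d} - {x}"
        using x \<open>odd_coords d c \<subseteq> {1..d}\<close> by auto
      then show ?thesis using between_ridge_whole[OF 3(1)] True 3 cls_upd_ne[OF 3(1)] by simp
    next
      case False
      then obtain c' where c': "c' \<in> ivectors d" "G = cls c'" "face_le d c c'"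
        using FG(1) 3 cls_leE[of c G] by metis
      have "card (odd_coords d c') = card (odd_coords d c) + 2" using FG(2) 3 c' rank_cls by simp
      then have "card (odd_coords d c' - odd_coords d c) = 2"
        using odd_coords_mono[OF c'(3)] by (simp add: card_Diff_subset)
      then obtain x y where xy: "odd_coords d c' - odd_coords d c = {x, y}" "x \<noteq> y"
        by (auto simp: card_2_iff)
      have "x \<in> odd_coords d c' - odd_coords d c" "y \<in> odd_coords d c' - odd_coords d c" using xy(1) by auto
      then have o: "x \<in> {1..d}" "odd (c' x)" "even (c x)" "y \<in> {1..d}" by (auto simp: odd_coords_def)
      have "cls (c(x := c' x)) \<noteq> cls (c(y := c' y))"
      proof
        assume "cls (c(x := c' x)) = cls (c(y := c' y))"
        then have "odd_coords d (c(x := c' x)) = odd_coords d (c(y := c' y))"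
          using ivectors_upd[OF 3(1)] o by (intro cls_odd_coords) auto
        moreover have "x \<in> odd_coords d (c(x := c' x))" "x \<notin> odd_coords d (c(y := c' y))"
          using o xy(2) by (simp_all add: odd_coords_def)
        ultimately show False by simp
      qed
      then show ?thesis using between_cls[OF 3(1) c'(1,3) xy] 3 c' by simp
    qed
  qed
qed

section \<open>Flag connectedness\<close>

definition reach :: "(nat \<Rightarrow> real) set set set \<Rightarrow> (nat \<Rightarrow> real) set set set \<Rightarrow> bool" where
  "reach = (\<lambda>A B. \<exists>i<Suc d. adjacent Q i A B)\<^sup>*\<^sup>*"

lemma reach_refl: "reach A A"
  by (simp add: reach_def)

lemma reach_trans: "reach A B \<Longrightarrow> reach B C \<Longrightarrow> reach A C"
  by (simp add: reach_def)

lemma flag_face_std_flag: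
  assumes "v \<in> ivectors d" "xs \<in> orderings" "e \<in> signs"
  shows "j \<le> d \<Longrightarrow> flag_face (std_flag v xs e) (int j) = std_face v xs e j"
    and "flag_face (std_flag v xs e) (-1) = bottom"
    and "flag_face (std_flag v xs e) (int d + 1) = whole"
proof -
  note f = std_flag_is_flag[OF assms]
  show "j \<le> d \<Longrightarrow> flag_face (std_flag v xs e) (int j) = std_face v xs e j"
    by (rule flag_face_eqI[OF f]) (auto simp: std_flag_def rank_std_face[OF assms])
  show "flag_face (std_flag v xs e) (-1) = bottom"
    by (rule flag_face_eqI[OF f]) (auto simp: std_flag_def rank_bottom)
  show "flag_face (std_flag v xs e) (int d + 1) = whole"
    by (rule flag_face_eqI[OF f]) (auto simp: std_flag_def rank_whole)
qed

lemma reach_step: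
  assumes a: "v \<in> ivectors d" "xs \<in> orderings" "e \<in> signs"
    and b: "v' \<in> ivectors d" "xs' \<in> orderings" "e' \<in> signs" and i: "i \<le> d"
    and eq: "\<And>j. j \<le> d \<Longrightarrow> j \<noteq> i \<Longrightarrow>
      centre v e (set (take j xs)) = centre v' e' (set (take j xs'))"
  shows "reach (std_flag v xs e) (std_flag v' xs' e')"
proof (cases "std_flag v xs e = std_flag v' xs' e'")
  case False
  have "flag_face (std_flag v xs e) k = flag_face (std_flag v' xs' e') k"
    if k: "-1 \<le> k" "k \<le> int (Suc d)" "k \<noteq> int i" for k
  proof -
    consider "k = -1" | "k = int d + 1" | j where "k = int j" "j \<le> d"
    proof (cases "k = -1 \<or> k = int d + 1")
      case False
      then have "k = int (nat k)" "nat k \<le> d" using k by auto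
      then show ?thesis using that(3) by blast
    qed (use that in blast)
    then show ?thesis
    proof cases
      case (3 j)
      then show ?thesis
        using flag_face_std_flag(1)[OF a] flag_face_std_flag(1)[OF b] eq[of j] k(3)
        by (simp add: std_face_def)
    qed (simp_all add: flag_face_std_flag[OF a] flag_face_std_flag[OF b])
  qed
  then have "adjacent Q i (std_flag v xs e) (std_flag v' xs' e')"
    using i False std_flag_is_flag[OF a] std_flag_is_flag[OF b]
    by (subst adjacent_iff_flag_face) auto
  then show ?thesis unfolding reach_def using i
    by (intro r_into_rtranclp exI[of _ i] conjI) simp_all
qed (simp add: reach_refl)

text \<open>Swapping neighbouring directions changes a single prefix set, hence a single
  face.\<close>

lemma reach_ordering:
  assumes v: "v \<in> ivectors d" and e: "e \<in> signs" and xs: "xs \<in> orderings" "ys \<in> orderings"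
  shows "reach (std_flag v xs e) (std_flag v ys e)"
proof -
  let ?P = "\<lambda>zs. zs \<in> orderings \<and> reach (std_flag v xs e) (std_flag v zs e)"
  have "?P ys"
  proof (rule adjacent_swaps_reach[where P = ?P])
    fix a x y b assume P: "?P (a @ x # y # b)"
    then have o: "a @ x # y # b \<in> orderings" by simp
    then have o': "a @ y # x # b \<in> orderings" by (auto simp: permutations_of_set_def)
    have len: "length a + 2 \<le> d" using orderingsD(3)[OF o] by simp
    have "reach (std_flag v (a @ x # y # b) e) (std_flag v (a @ y # x # b) e)"
    proof (rule reach_step[OF v o e v o' e])
      show "length a + 1 \<le> d" using len by simp
      fix j assume j: "j \<noteq> length a + 1"
      have "set (take j (a @ x # y # b)) = set (take j (a @ y # x # b))"
      proof (cases "j \<le> length a")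
        case False
        \<comment> \<open>A longer prefix contains both swapped entries.\<close>
        then have "j = length a + Suc (Suc (j - length a - 2))" using j by linarith
        then obtain m where "j = length a + Suc (Suc m)" ..
        then show ?thesis by (simp add: insert_commute)
      qed simp
      then show "centre v e (set (take j (a @ x # y # b))) = centre v e (set (take j (a @ y # x # b)))"
        by simp
    qed
    then show "?P (a @ y # x # b)" using P o' reach_trans by blast
  next
    show "?P xs" using xs(1) reach_refl by simp
    show "mset xs = mset ys" using orderingsD(1,2)[OF xs(1)] orderingsD(1,2)[OF xs(2)]
      by (metis set_eq_iff_mset_eq_distinct)
  qed
  then show ?thesis by simp
qed

lemma ordering_with_last:
  assumes "x \<in> {1..d}"
  obtains ys where "ys @ [x] \<in> orderings"
proof -
  have "finite ({1..d} - {x})" by simp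
  from finite_distinct_list[OF this] obtain ys where ys: "set ys = {1..d} - {x}" "distinct ys"
    by (elim exE conjE)
  have "insert x {1..d} = {1..d}" using assms by (rule insert_absorb)
  then have "ys @ [x] \<in> orderings" using ys by (simp add: permutations_of_set_def)
  then show ?thesis by (rule that)
qed

lemma ordering_with_first:
  assumes "x \<in> {1..d}"
  obtains ys where "x # ys \<in> orderings"
proof -
  have "finite ({1..d} - {x})" by simp
  from finite_distinct_list[OF this] obtain ys where ys: "set ys = {1..d} - {x}" "distinct ys"
    by (elim exE conjE)
  have "insert x {1..d} = {1..d}" using assms by (rule insert_absorb)
  then have "x # ys \<in> orderings" using ys by (simp add: permutations_of_set_def)
  then show ?thesis by (rule that)
qed

lemma signs_upd: "e \<in> signs \<Longrightarrow> x \<in> {1..d} \<Longrightarrow> a \<in> {1, -1} \<Longrightarrow> e(x := a) \<in> signs"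
  unfolding signs_def using PiE_fun_upd[of a "\<lambda>_. {1, -1}" x e "{1..d}"] by (simp add: insert_absorb)

text \<open>With \<open>x\<close> as the last direction its sense affects only the cell of dimension
  \<open>d\<close>, so the flip is one adjacency; reordering before and after is free.\<close>

lemma reach_flip:
  assumes v: "v \<in> ivectors d" and e: "e \<in> signs" and xs: "xs \<in> orderings"
    and x: "x \<in> {1..d}" and a: "a \<in> {1, -1}"
  shows "reach (std_flag v xs e) (std_flag v xs (e(x := a)))"
proof -
  obtain ys where ys: "ys @ [x] \<in> orderings" using x by (rule ordering_with_last)
  have e': "e(x := a) \<in> signs" using e x a by (rule signs_upd)
  have len: "length ys = d - 1" using orderingsD(3)[OF ys] by simp
  have "reach (std_flag v (ys @ [x]) e) (std_flag v (ys @ [x]) (e(x := a)))"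
  proof (rule reach_step[OF v ys e v ys e' order_refl])
    fix j assume "j \<le> d" "j \<noteq> d"
    then have "take j (ys @ [x]) = take j ys" using len by simp
    moreover have "x \<notin> set (take j ys)" using orderingsD(2)[OF ys] by (auto dest: in_set_takeD)
    ultimately show "centre v e (set (take j (ys @ [x]))) = centre v (e(x := a)) (set (take j (ys @ [x])))"
      by (auto simp: centre_def fun_eq_iff)
  qed
  then show ?thesis
    using reach_ordering[OF v e xs ys] reach_ordering[OF v e' ys xs] reach_trans by blast
qed

lemma reach_signs:
  assumes v: "v \<in> ivectors d" and e: "e \<in> signs" and \<delta>: "\<delta> \<in> signs" and xs: "xs \<in> orderings"
  shows "reach (std_flag v xs e) (std_flag v xs \<delta>)"
proof -
  let ?e = "\<lambda>A i. if i \<in> A then \<delta> i else e i"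
  have "?e A \<in> signs \<and> reach (std_flag v xs e) (std_flag v xs (?e A))" if "A \<subseteq> {1..d}" for A
  proof -
    have "finite A" using that finite_subset by blast
    then show ?thesis using that
    proof (induction A rule: finite_induct)
      case (insert x A)
      then have IH: "?e A \<in> signs" "reach (std_flag v xs e) (std_flag v xs (?e A))" by auto
      have x: "x \<in> {1..d}" using insert.prems by simp
      have a: "\<delta> x \<in> {1, -1}" using signs_mem[OF \<delta> x] by simp
      have upd: "?e (insert x A) = (?e A)(x := \<delta> x)" by (auto simp: fun_eq_iff)
      show ?case unfolding upd
        using signs_upd[OF IH(1) x a] reach_trans[OF IH(2) reach_flip[OF v IH(1) xs x a]] by blast
    qed (use e reach_refl in simp)
  qed
  then have "reach (std_flag v xs e) (std_flag v xs (?e {1..d}))" by blast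
  moreover have "?e {1..d} = \<delta>"
  proof
    show "?e {1..d} i = \<delta> i" for i
      using PiE_arb[OF e[unfolded signs_def], of i] PiE_arb[OF \<delta>[unfolded signs_def], of i] by auto
  qed
  ultimately show ?thesis by simp
qed

text \<open>With \<open>x\<close> as the first direction and sense \<open>a\<close>, moving to the
  other end of the edge and reversing the sense keeps every face but the vertex, since 2v + a = 2(v
  + a) - a.\<close>

lemma reach_move:
  assumes v: "v \<in> ivectors d" and e: "e \<in> signs" and xs: "xs \<in> orderings"
    and x: "x \<in> {1..d}" and a: "a \<in> {1, -1}"
  shows "reach (std_flag v xs e) (std_flag (v(x := v x + a)) xs e)"
proof -
  obtain ys where ys: "x # ys \<in> orderings" using x by (rule ordering_with_first)
  have na: "- a \<in> {1, -1}" using a by auto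
  have e1: "e(x := a) \<in> signs" using e x a by (rule signs_upd)
  have e2: "e(x := - a) \<in> signs" using e x na by (rule signs_upd)
  let ?v = "v(x := v x + a)"
  have v': "?v \<in> ivectors d" using v x by (rule ivectors_upd)
  have "reach (std_flag v (x # ys) (e(x := a))) (std_flag ?v (x # ys) (e(x := - a)))"
  proof (rule reach_step[OF v ys e1 v' ys e2 le0])
    fix j :: nat assume "j \<noteq> 0"
    then have "x \<in> set (take j (x # ys))" by (simp add: take_Cons')
    then show "centre v (e(x := a)) (set (take j (x # ys))) = centre ?v (e(x := - a)) (set (take j (x # ys)))"
      by (auto simp: centre_def fun_eq_iff)
  qed
  moreover have "reach (std_flag v xs e) (std_flag v (x # ys) (e(x := a)))"
    using reach_signs[OF v e e1 xs] reach_ordering[OF v e1 xs ys] by (rule reach_trans)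
  moreover have "reach (std_flag ?v (x # ys) (e(x := - a))) (std_flag ?v xs e)"
    using reach_signs[OF v' e2 e ys] reach_ordering[OF v' e ys xs] by (rule reach_trans)
  ultimately show ?thesis using reach_trans by blast
qed

lemma reach_upd:
  assumes v: "v \<in> ivectors d" and e: "e \<in> signs" and xs: "xs \<in> orderings" and x: "x \<in> {1..d}"
  shows "reach (std_flag v xs e) (std_flag (v(x := m)) xs e)"
proof (induction m rule: int_induct[where k = "v x"])
  case base
  show ?case by (simp add: reach_refl)
next
  case (step1 m)
  have "reach (std_flag (v(x := m)) xs e) (std_flag (v(x := m + 1)) xs e)"
    using reach_move[where v = "v(x := m)" and a = 1, OF ivectors_upd[OF v x] e xs x] by simp
  with step1.IH show ?case by (rule reach_trans)
next
  case (step2 m)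
  have "reach (std_flag (v(x := m)) xs e) (std_flag (v(x := m - 1)) xs e)"
    using reach_move[where v = "v(x := m)" and a = "-1", OF ivectors_upd[OF v x] e xs x] by simp
  with step2.IH show ?case by (rule reach_trans)
qed

lemma reach_vertex:
  assumes v: "v \<in> ivectors d" and u: "u \<in> ivectors d" and e: "e \<in> signs" and xs: "xs \<in> orderings"
  shows "reach (std_flag v xs e) (std_flag u xs e)"
proof -
  let ?e = "\<lambda>A i. if i \<in> A then u i else v i"
  have "?e A \<in> ivectors d \<and> reach (std_flag v xs e) (std_flag (?e A) xs e)" if "A \<subseteq> {1..d}" for A
  proof -
    have "finite A" using that finite_subset by blast
    then show ?thesis using that
    proof (induction A rule: finite_induct)
      case (insert x A)
      then have IH: "?e A \<in> ivectors d" "reach (std_flag v xs e) (std_flag (?e A) xs e)" by auto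
      have x: "x \<in> {1..d}" using insert.prems by simp
      have upd: "?e (insert x A) = (?e A)(x := u x)" by (auto simp: fun_eq_iff)
      show ?case unfolding upd
        using ivectors_upd[OF IH(1) x] reach_trans[OF IH(2) reach_upd[OF IH(1) e xs x]] by blast
    qed (use v reach_refl in simp)
  qed
  then have "reach (std_flag v xs e) (std_flag (?e {1..d}) xs e)" by blast
  moreover have "?e {1..d} = u" using u v by (auto simp: ivectors_def fun_eq_iff)
  ultimately show ?thesis by simp
qed

lemma reach_flags:
  assumes "\<Phi> \<in> flags Q" "\<Psi> \<in> flags Q"
  shows "reach \<Phi> \<Psi>"
proof -
  obtain v xs e where a: "v \<in> ivectors d" "xs \<in> orderings" "e \<in> signs" "\<Phi> = std_flag v xs e"
    using assms(1) by (rule flag_is_std_flag)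
  obtain u ys \<delta> where b: "u \<in> ivectors d" "ys \<in> orderings" "\<delta> \<in> signs" "\<Psi> = std_flag u ys \<delta>"
    using assms(2) by (rule flag_is_std_flag)
  have "reach (std_flag v xs e) (std_flag u xs e)" using a b by (intro reach_vertex)
  moreover have "reach (std_flag u xs e) (std_flag u ys e)" using a b by (intro reach_ordering)
  moreover have "reach (std_flag u ys e) (std_flag u ys \<delta>)" using a b by (intro reach_signs)
  ultimately show ?thesis unfolding a(4) b(4) using reach_trans by blast
qed

sublocale flag_connected_poset "Suc d" Q
  by unfold_locales (use diamond_Q reach_flags in \<open>simp_all add: reach_def\<close>)

section \<open>Regularity of the cubic toroid\<close>

text \<open>The permutation \<open>p\<close> sends a direction to its position in \<open>xs\<close>,
  counted from 1.\<close>

lemma ordering_permutation: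
  assumes xs: "xs \<in> orderings"
  obtains p where "p permutes {1..d}" "\<And>i j. i \<in> {1..d} \<Longrightarrow> j \<le> d \<Longrightarrow> i \<in> set (take j xs) \<longleftrightarrow> p i \<le> j"
proof -
  define \<pi> where "\<pi> j = (if j \<in> {1..d} then xs ! (j - 1) else j)" for j
  have "bij_betw (\<lambda>j. j - 1) {1..d} {..<d}"
    by (rule bij_betw_byWitness[where f' = Suc]) auto
  moreover have "bij_betw ((!) xs) {..<d} {1..d}"
    using orderingsD[OF xs] by (intro bij_betw_nth) auto
  ultimately have "bij_betw ((!) xs \<circ> (\<lambda>j. j - 1)) {1..d} {1..d}" by (rule bij_betw_trans)
  then have "bij_betw \<pi> {1..d} {1..d}"
    by (rule bij_betw_cong[THEN iffD1, rotated]) (simp add: \<pi>_def)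
  then have \<pi>: "\<pi> permutes {1..d}" by (rule bij_imp_permutes) (auto simp: \<pi>_def)
  have "i \<in> set (take j xs) \<longleftrightarrow> inv_into UNIV \<pi> i \<le> j" if i: "i \<in> {1..d}" and j: "j \<le> d" for i j
  proof -
    let ?y = "inv_into UNIV \<pi> i"
    have y: "?y \<in> {1..d}" "\<pi> ?y = i"
      using permutes_in_image[OF permutes_inv[OF \<pi>]] i permutes_inverses(1)[OF \<pi>] by auto
    then have nth: "xs ! (?y - 1) = i" "?y - 1 < d" by (auto simp: \<pi>_def)
    show ?thesis
    proof
      assume "i \<in> set (take j xs)"
      then obtain m where m: "m < j" "xs ! m = i" using j orderingsD(3)[OF xs] by (auto simp: in_set_conv_nth)
      then have "m = ?y - 1"
        using nth j orderingsD(2,3)[OF xs] by (metis nth_eq_iff_index_eq order.strict_trans2)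
      then show "?y \<le> j" using m(1) by simp
    next
      assume "?y \<le> j"
      then have "?y - 1 < j" using y(1) by auto
      then show "i \<in> set (take j xs)"
        using nth j orderingsD(3)[OF xs] by (auto simp: in_set_conv_nth intro!: exI[of _ "?y - 1"])
    qed
  qed
  with permutes_inv[OF \<pi>] that show ?thesis by blast
qed

text \<open>The isometry that permutes coordinates by \<open>p\<close>, applies the signs
  \<open>e\<close> and translates by \<open>v\<close> preserves the integer vectors, the inclusions
  and the lattice \<open>L\<close>. It therefore acts on the classes, and it carries the base flag
  at the origin to the given one. On doubled centres it is \<open>h\<close>.\<close>

lemma std_flag_transitive:
  assumes v: "v \<in> ivectors d" and xs: "xs \<in> orderings" and e: "e \<in> signs"
  shows "\<exists>\<gamma> \<in> carrier (Aut Q).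
    \<gamma> ` std_flag (\<lambda>_. 0) [1..<Suc d] (\<lambda>i\<in>{1..d}. 1) = std_flag v xs e"
proof -
  obtain p where p: "p permutes {1..d}"
    "\<And>i j. i \<in> {1..d} \<Longrightarrow> j \<le> d \<Longrightarrow> i \<in> set (take j xs) \<longleftrightarrow> p i \<le> j"
    using ordering_permutation[OF xs] by metis
  define q where "q = inv_into UNIV p"
  have q: "q permutes {1..d}" "p (q i) = i" "q (p i) = i" for i
    unfolding q_def using permutes_inv[OF p(1)] permutes_inverses[OF p(1)] by auto
  have pin: "p i \<in> {1..d} \<longleftrightarrow> i \<in> {1..d}" and qin: "q i \<in> {1..d} \<longleftrightarrow> i \<in> {1..d}" for i
    using permutes_in_image[OF p(1)] permutes_in_image[OF q(1)] by auto
  have sq: "e i * (e i * z) = z" if "i \<in> {1..d}" for i z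
    using signs_mem[OF e that] by auto
  define h where "h c = (\<lambda>i. 2 * v i + e i * c (p i))" for c
  \<comment> \<open>\<open>h'\<close> undoes translation, signs and permutation. As a right inverse
    of \<open>h\<close> it provides surjectivity.\<close>
  define h' where "h' c = (\<lambda>i. e (q i) * (c (q i) - 2 * v (q i)))" for c
  have out: "c i = 0" "v i = 0" if "c \<in> ivectors d" "i \<notin> {1..d}" for c i
    using that v by (auto simp: ivectors_def)
  have h_iv: "h c \<in> ivectors d" if c: "c \<in> ivectors d" for c
  proof -
    have "h c i = 0" if i: "i \<notin> {1..d}" for i
    proof -
      have "p i \<notin> {1..d}" using i pin by blast
      then show ?thesis using out[OF c] i by (simp add: h_def)
    qed
    then show ?thesis by (simp add: ivectors_def)
  qed
  have h'_iv: "h' c \<in> ivectors d" if c: "c \<in> ivectors d" for c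
  proof -
    have "h' c i = 0" if i: "i \<notin> {1..d}" for i
    proof -
      have "q i \<notin> {1..d}" using i qin by blast
      then show ?thesis using out[OF c] by (simp add: h'_def)
    qed
    then show ?thesis by (simp add: ivectors_def)
  qed
  have hh': "h (h' c) = c" if c: "c \<in> ivectors d" for c
  proof (rule ivectors_eqI[OF h_iv[OF h'_iv[OF c]] c])
    show "h (h' c) i = c i" if "i \<in> {1..d}" for i
      by (simp only: h_def h'_def q sq[OF that] add_diff_cancel_left' diff_add_cancel add_diff_eq)
  qed
  have le: "face_le d (h a) (h b) \<longleftrightarrow> face_le d a b" for a b
  proof -
    have iff: "(h a i = h b i \<or> odd (h b i) \<and> \<bar>h a i - h b i\<bar> = 1) \<longleftrightarrow>
        (a (p i) = b (p i) \<or> odd (b (p i)) \<and> \<bar>a (p i) - b (p i)\<bar> = 1)" if i: "i \<in> {1..d}" for i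
      using signs_mem[OF e i] by (elim disjE) (auto simp: h_def)
    have "face_le d (h a) (h b) \<longleftrightarrow>
        (\<forall>i\<in>{1..d}. a (p i) = b (p i) \<or> odd (b (p i)) \<and> \<bar>a (p i) - b (p i)\<bar> = 1)"
      unfolding face_le_def by (rule ball_cong[OF HOL.refl iff])
    also have "\<dots> \<longleftrightarrow> (\<forall>i\<in>p ` {1..d}. a i = b i \<or> odd (b i) \<and> \<bar>a i - b i\<bar> = 1)" by simp
    also have "p ` {1..d} = {1..d}" using p(1) by (rule permutes_image)
    finally show ?thesis by (simp only: face_le_def)
  qed
  have shift: "h (\<lambda>i. c i + 2 * w i) = (\<lambda>i. h c i + 2 * (e i * w (p i)))" for c w
    by (simp add: h_def fun_eq_iff algebra_simps)
  have eL: "(\<lambda>i. e i * w (p i)) \<in> L" if "w \<in> L" for w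
    using p(1) _ that by (rule L_signed_permute) (use signs_mem[OF e] in auto)
  \<comment> \<open>The linear part maps \<open>L\<close> onto itself, so that incidences are
    reflected as well as preserved.\<close>
  have L_ex: "\<exists>w' \<in> L. w = (\<lambda>i. e i * w' (p i))" if w: "w \<in> L" for w
  proof
    show L': "(\<lambda>i. e (q i) * w (q i)) \<in> L"
    proof (rule L_signed_permute[OF q(1) _ w])
      show "e (q i) \<in> {1, -1}" if "i \<in> {1..d}" for i
        using signs_mem[OF e, of "q i"] that qin by blast
    qed
    show "w = (\<lambda>i. e i * (e (q (p i)) * w (q (p i))))"
      by (rule ivectors_eqI[OF L_ivectors[OF w] L_ivectors[OF eL[OF L']]]) (simp add: q sq)
  qed
  have cls_h: "cls (h a) = cls (h b)" if ab: "cls a = cls b" "a \<in> ivectors d" "b \<in> ivectors d" for a b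
  proof -
    obtain w where w: "w \<in> L" "b = (\<lambda>i. a i + 2 * w i)" using ab cls_eq_iff by blast
    then have "h b = (\<lambda>i. h a i + 2 * (e i * w (p i)))" using shift by simp
    then show ?thesis using cls_shift[OF h_iv[OF ab(2)] eL[OF w(1)]] by simp
  qed
  have cls_le_h: "(cls (h a), cls (h b)) \<in> Q \<longleftrightarrow> (cls a, cls b) \<in> Q"
    if ab: "a \<in> ivectors d" "b \<in> ivectors d" for a b
  proof -
    have *: "face_le d (h a) (\<lambda>i. h b i + 2 * (e i * w (p i))) \<longleftrightarrow> face_le d a (\<lambda>i. b i + 2 * w i)" for w
      using le[of a "\<lambda>i. b i + 2 * w i"] by (simp only: shift)
    have "(cls (h a), cls (h b)) \<in> Q \<longleftrightarrow> (\<exists>w \<in> L. face_le d (h a) (\<lambda>i. h b i + 2 * w i))"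
      by (rule cls_le_iff[OF h_iv[OF ab(1)] h_iv[OF ab(2)]])
    also have "\<dots> \<longleftrightarrow> (\<exists>w \<in> L. face_le d a (\<lambda>i. b i + 2 * w i))"
    proof
      assume "\<exists>w \<in> L. face_le d (h a) (\<lambda>i. h b i + 2 * w i)"
      then obtain w where w: "w \<in> L" "face_le d (h a) (\<lambda>i. h b i + 2 * w i)" ..
      from L_ex[OF w(1)] obtain w' where w': "w' \<in> L" "w = (\<lambda>i. e i * w' (p i))" ..
      then have "face_le d a (\<lambda>i. b i + 2 * w' i)" using w(2) * by simp
      then show "\<exists>w \<in> L. face_le d a (\<lambda>i. b i + 2 * w i)" using w'(1) by (rule bexI)
    next
      assume "\<exists>w \<in> L. face_le d a (\<lambda>i. b i + 2 * w i)"
      then obtain w where w: "w \<in> L" "face_le d a (\<lambda>i. b i + 2 * w i)" ..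
      then have "face_le d (h a) (\<lambda>i. h b i + 2 * (e i * w (p i)))" using * by blast
      then show "\<exists>w \<in> L. face_le d (h a) (\<lambda>i. h b i + 2 * w i)" using eL[OF w(1)] by (rule bexI)
    qed
    also have "\<dots> \<longleftrightarrow> (cls a, cls b) \<in> Q" by (rule cls_le_iff[OF ab, symmetric])
    finally show ?thesis .
  qed
  \<comment> \<open>By \<open>cls_h\<close> the chosen representative does not affect the resulting
    class.\<close>
  define \<gamma> where "\<gamma> = (\<lambda>X \<in> Field Q. if X = bottom \<or> X = whole then X
    else cls (h (SOME c. c \<in> ivectors d \<and> X = cls c)))"
  have \<gamma>_bottom: "\<gamma> bottom = bottom" and \<gamma>_whole: "\<gamma> whole = whole"
    by (simp_all add: \<gamma>_def Field_Q)
  have \<gamma>_cls: "\<gamma> (cls c) = cls (h c)" if c: "c \<in> ivectors d" for c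
  proof -
    have "\<exists>c'. c' \<in> ivectors d \<and> cls c = cls c'" using c by blast
    from someI_ex[OF this] have "cls (h (SOME c'. c' \<in> ivectors d \<and> cls c = cls c')) = cls (h c)"
      using cls_h[OF _ _ c] by metis
    then show ?thesis using cls_distinct[OF c] c by (simp add: \<gamma>_def Field_Q)
  qed
  have \<gamma>_in: "\<gamma> X \<in> Field Q" if "X \<in> Field Q" for X
    using that h_iv by (cases rule: Field_Q_cases) (auto simp: \<gamma>_bottom \<gamma>_whole \<gamma>_cls Field_Q)
  have \<gamma>_le: "(\<gamma> X, \<gamma> Y) \<in> Q \<longleftrightarrow> (X, Y) \<in> Q" if X: "X \<in> Field Q" and Y: "Y \<in> Field Q" for X Y
    using X
  proof (cases rule: Field_Q_cases)
    case 1
    then show ?thesis using \<gamma>_in[OF Y] Y by (simp add: \<gamma>_bottom)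
  next
    case 2
    have "\<gamma> Y = whole \<longleftrightarrow> Y = whole"
      using Y cls_distinct h_iv by (cases rule: Field_Q_cases) (auto simp: \<gamma>_bottom \<gamma>_whole \<gamma>_cls)
    then show ?thesis using 2 by (simp add: \<gamma>_whole)
  next
    case X: (3 a)
    show ?thesis using Y
    proof (cases rule: Field_Q_cases)
      case 1
      then show ?thesis using X cls_distinct h_iv by (simp add: \<gamma>_bottom \<gamma>_cls)
    next
      case 2
      then show ?thesis using X h_iv by (simp add: \<gamma>_whole \<gamma>_cls Field_Q)
    next
      case (3 b)
      then show ?thesis using X cls_le_h by (simp add: \<gamma>_cls)
    qed
  qed
  have "\<gamma> \<in> carrier (Aut Q)"
    unfolding mem_automorphism_group bij_betw_def
  proof (intro conjI ballI)
    show "\<gamma> \<in> extensional (Field Q)" by (simp add: \<gamma>_def)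
    show "inj_on \<gamma> (Field Q)"
    proof (rule inj_onI)
      fix X Y assume XY: "X \<in> Field Q" "Y \<in> Field Q" "\<gamma> X = \<gamma> Y"
      \<comment> \<open>Injectivity comes from the order: equal images are comparable both ways, and
        \<open>\<gamma>\<close> reflects an antisymmetric relation.\<close>
      have "(\<gamma> X, \<gamma> X) \<in> Q" using le_refl[OF \<gamma>_in[OF XY(1)]] .
      then have "(X, Y) \<in> Q" "(Y, X) \<in> Q" using \<gamma>_le XY by metis+
      then show "X = Y" by (rule le_antisym)
    qed
    show "\<gamma> ` Field Q = Field Q"
    proof (intro equalityI subsetI)
      fix X assume "X \<in> Field Q"
      then show "X \<in> \<gamma> ` Field Q"
      proof (cases rule: Field_Q_cases)
        case 1
        then show ?thesis using \<gamma>_bottom by (intro image_eqI[of _ _ bottom]) (simp_all add: Field_Q)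
      next
        case 2
        then show ?thesis using \<gamma>_whole by (intro image_eqI[of _ _ whole]) (simp_all add: Field_Q)
      next
        case (3 c)
        then show ?thesis using \<gamma>_cls[OF h'_iv[OF 3(1)]] hh'[OF 3(1)] h'_iv[OF 3(1)]
          by (intro image_eqI[of _ _ "cls (h' c)"]) (simp_all add: Field_Q)
      qed
    qed (use \<gamma>_in in auto)
    show "(X, Y) \<in> Q \<longleftrightarrow> (\<gamma> X, \<gamma> Y) \<in> Q" if "X \<in> Field Q" "Y \<in> Field Q" for X Y
      using \<gamma>_le[OF that] by simp
  qed
  moreover have "\<gamma> ` std_flag (\<lambda>_. 0) [1..<Suc d] (\<lambda>i\<in>{1..d}. 1) = std_flag v xs e"
  proof -
    let ?e = "(\<lambda>i\<in>{1..d}. 1) :: nat \<Rightarrow> int"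
    have "\<gamma> (std_face (\<lambda>_. 0) [1..<Suc d] ?e j) = std_face v xs e j" if j: "j \<le> d" for j
    proof -
      have "take j [1..<Suc d] = [1..<1 + j]" using j by (intro take_upt) simp
      then have t: "set (take j [1..<Suc d]) = {1..j}"
        by (simp only: set_upt plus_1_eq_Suc atLeastLessThanSuc_atLeastAtMost)
      have sub: "{1..j} \<subseteq> {1..d}" using j by auto
      have iv: "centre (\<lambda>_. 0) ?e {1..j} \<in> ivectors d"
        by (rule centre_ivectors[OF _ sub]) (simp add: ivectors_def)
      have "h (centre (\<lambda>_. 0) ?e {1..j}) = centre v e (set (take j xs))"
      proof (rule ivectors_eqI[OF h_iv[OF iv] centre_ivectors[OF v ordering_take(1)[OF xs j]]])
        fix i assume i: "i \<in> {1..d}"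
        have "p i \<in> {1..d}" using i pin by blast
        then show "h (centre (\<lambda>_. 0) ?e {1..j}) i = centre v e (set (take j xs)) i"
          using p(2)[OF i j] by (simp add: h_def centre_def)
      qed
      then show ?thesis unfolding std_face_def t using \<gamma>_cls[OF iv] by simp
    qed
    then have "\<gamma> ` std_face (\<lambda>_. 0) [1..<Suc d] ?e ` {..d} = std_face v xs e ` {..d}"
      unfolding image_image by (intro image_cong[OF HOL.refl]) simp
    then show ?thesis unfolding std_flag_def by (simp only: image_insert \<gamma>_bottom \<gamma>_whole)
  qed
  ultimately show ?thesis by blast
qed

lemma flag_transitive:
  assumes "\<Phi> \<in> flags Q" "\<Psi> \<in> flags Q"
  shows "\<exists>\<gamma> \<in> carrier (Aut Q). \<gamma> ` \<Phi> = \<Psi>"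
proof -
  interpret A: group "Aut Q" by (rule group_automorphism_group)
  let ?B = "std_flag (\<lambda>_. 0) [1..<Suc d] (\<lambda>i\<in>{1..d}. 1)"
  have B: "?B \<in> flags Q"
    by (rule std_flag_is_flag[OF _ orderings_nonempty]) (simp_all add: ivectors_def signs_def)
  have *: "\<exists>\<gamma> \<in> carrier (Aut Q). \<gamma> ` ?B = \<Theta>" if "\<Theta> \<in> flags Q" for \<Theta>
    using that by (rule flag_is_std_flag) (use std_flag_transitive in blast)
  from *[OF assms(1)] obtain \<alpha> where \<alpha>: "\<alpha> \<in> carrier (Aut Q)" "\<alpha> ` ?B = \<Phi>" ..
  from *[OF assms(2)] obtain \<beta> where \<beta>: "\<beta> \<in> carrier (Aut Q)" "\<beta> ` ?B = \<Psi>" ..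
  let ?i = "inv\<^bsub>Aut Q\<^esub> \<alpha>"
  have "?i ` \<Phi> = (\<alpha> \<otimes>\<^bsub>Aut Q\<^esub> ?i) ` ?B"
    using mult_automorphism_image[OF B] \<alpha>(2) by simp
  also have "\<dots> = ?B" using \<alpha>(1) one_automorphism_image[OF B] by simp
  finally have "(?i \<otimes>\<^bsub>Aut Q\<^esub> \<beta>) ` \<Phi> = \<Psi>"
    using mult_automorphism_image[OF assms(1)] \<beta>(2) by simp
  moreover have "?i \<otimes>\<^bsub>Aut Q\<^esub> \<beta> \<in> carrier (Aut Q)" using \<alpha>(1) \<beta>(1) by simp
  ultimately show ?thesis by blast
qed

lemma rotary_flag_Q:
  assumes "\<Psi> \<in> flags Q"
  shows "rotary_flag (Suc d) Q \<Psi>"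
proof
  fix i assume "1 \<le> i" "i \<le> Suc d - 1"
  then have "adjacent_flag Q (i - 1) (adjacent_flag Q i \<Psi>) \<in> flags Q"
    using assms by (intro adjacent_flag_in_flags) auto
  then show "\<exists>\<gamma> \<in> carrier (Aut Q). \<gamma> ` \<Psi> = adjacent_flag Q (i - 1) (adjacent_flag Q i \<Psi>)"
    using assms flag_transitive by blast
qed (rule assms)

text \<open>The exponent of 2 is \<open>(k - 1) + d\<close>: the first summand comes from the index
  of the lattice, the second from the senses of the directions.\<close>

lemma order_automorphism_group_Q: "order (Aut Q) = 2 ^ (d + k - 1) * fact d * s ^ d"
proof -
  have "std_flag (\<lambda>_. 0) [1..<Suc d] (\<lambda>i\<in>{1..d}. 1) \<in> flags Q"
    by (rule std_flag_is_flag[OF _ orderings_nonempty]) (simp_all add: ivectors_def signs_def)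
  then have "order (Aut Q) = card (flags Q)"
    using flag_transitive by (intro order_automorphism_group_transitive)
  moreover have "d + k - 1 = (k - 1) + d" using k_bounds by simp
  ultimately show ?thesis by (simp add: card_flags_Q power_add)
qed

end

section \<open>Chirality of the mix\<close>

text \<open>Positivity relies on the finiteness of the rotation group. It makes the constructed
  values of \<open>s\<close> at least 2 and pairwise distinct.\<close>

lemma order_chirality_group:
  assumes "n \<ge> 3" and P: "rotary_flag n P \<Phi>"
  shows "order (chirality_group n P \<Phi>)
    = card (presented_hom (rotation_group n P \<Phi>) (std_rotation P \<Phi>) ` Wplus_bar n ` rotation_kernel n P \<Phi>)"
    and "order (chirality_group n P \<Phi>) > 0"
proof -
  interpret P: rotary_flag n P \<Phi> by (rule P)
  let ?\<phi> = "presented_hom (rotation_group n P \<Phi>) (std_rotation P \<Phi>)"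
  let ?M = "kernel (Wplus n) (rotation_group n P \<Phi>) ?\<phi>"
  interpret \<phi>: group_hom "Wplus n" "rotation_group n P \<Phi>" ?\<phi>
    by (rule Wplus_kernel_hom, rule P.rotation_group_map)
  have "Wplus_bar n ` ?M \<subseteq> carrier (Wplus n)"
    using Wplus_bar_hom[OF assms(1)] by (auto simp: hom_def kernel_def)
  then have sub: "?\<phi> ` Wplus_bar n ` ?M \<subseteq> carrier (rotation_group n P \<Phi>)"
    and eq: "order (chirality_group n P \<Phi>) = card (?\<phi> ` Wplus_bar n ` ?M)"
    unfolding chirality_group_def Let_def rotation_kernel_def Wplus_kernel_def
    using order_kernel_quotient[OF \<phi>.group_hom_axioms] by auto
  from eq show "order (chirality_group n P \<Phi>) = card (?\<phi> ` Wplus_bar n ` rotation_kernel n P \<Phi>)"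
    by (simp only: rotation_kernel_def Wplus_kernel_def)
  have "finite (?\<phi> ` Wplus_bar n ` ?M)" using sub P.finite_rotation_group by (rule finite_subset)
  moreover have "\<one>\<^bsub>Wplus n\<^esub> \<in> ?M" by (simp add: kernel_def)
  then have "?\<phi> ` Wplus_bar n ` ?M \<noteq> {}" by blast
  ultimately show "order (chirality_group n P \<Phi>) > 0" unfolding eq by (simp add: card_gt_0_iff)
qed

text \<open>If the mix is not chiral, bar preserves M \<inter> K and so maps it into M, which is the
  condition under which the surjection between images of the kernels is well defined.\<close>

lemma order_chirality_group_dvd:
  fixes P :: "'a rel" and Q :: "'b rel"
  assumes "n \<ge> 3" and P: "rotary_flag n P \<Phi>" and Q: "rotary_flag n Q \<Psi>"
    and achiral: "\<not> mix_chiral n P \<Phi> Q \<Psi>"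
  shows "order (chirality_group n P \<Phi>) dvd order (rotation_group n Q \<Psi>)"
proof -
  interpret P: rotary_flag n P \<Phi> by (rule P)
  interpret Q: rotary_flag n Q \<Psi> by (rule Q)
  have gen: "mix_generator P \<Phi> Q \<Psi> = (\<lambda>i. (std_rotation P \<Phi> i, std_rotation Q \<Psi> i))"
    by (simp add: mix_generator_def fun_eq_iff)
  have "mix_kernel n P \<Phi> Q \<Psi> = rotation_kernel n P \<Phi> \<inter> rotation_kernel n Q \<Psi>"
    unfolding mix_kernel_def mix_rotation_group_def gen rotation_kernel_def
    by (rule Wplus_kernel_mix[OF P.rotation_group_map Q.rotation_group_map])
  then have "Wplus_bar n ` (rotation_kernel n P \<Phi> \<inter> rotation_kernel n Q \<Psi>) \<subseteq> rotation_kernel n P \<Phi>"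
    using achiral by (auto simp: mix_chiral_def)
  then show ?thesis
    unfolding order_chirality_group(1)[OF assms(1) P] rotation_kernel_def Wplus_kernel_def
    by (intro card_kernel_image_dvd_order[OF Wplus_kernel_hom[OF P.rotation_group_map]
          Wplus_kernel_hom[OF Q.rotation_group_map] Wplus_bar_hom[OF assms(1)] _ Q.finite_rotation_group])
qed

theorem theorem5p1:
  fixes P :: "'a rel" and \<Phi> :: "'a set" and n k :: nat
  assumes "n \<ge> 3"
    and "finite (Field P)"
    and "chiral_polytope n P"
    and "\<Phi> \<in> flags P"
    and "k \<in> {1, 2, n - 1}"
    and "\<not> order (chirality_group n P \<Phi>) dvd 2 ^ (n + k - 2) * fact (n - 1)"
  shows "infinite {s::nat. s \<ge> 2 \<and>
           (\<forall>\<Psi> \<in> flags (cubic_toroid n s k). mix_chiral n P \<Phi> (cubic_toroid n s k) \<Psi>)}"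
proof -
  let ?X = "order (chirality_group n P \<Phi>)"
  let ?S = "{s::nat. s \<ge> 2 \<and>
    (\<forall>\<Psi> \<in> flags (cubic_toroid n s k). mix_chiral n P \<Phi> (cubic_toroid n s k) \<Psi>)}"
  have P: "rotary_flag n P \<Phi>" using assms(3,2,4) by (rule chiral_polytope_rotary_flag)
  have X: "?X > 0" using assms(1) P by (rule order_chirality_group(2))
  \<comment> \<open>These \<open>s\<close> are 1 modulo the order of the chirality group;
    \<open>Suc m\<close> keeps them at least 2.\<close>
  have "?X * Suc m + 1 \<in> ?S" for m
  proof (rule CollectI, intro conjI ballI)
    let ?s = "?X * Suc m + 1"
    show s: "?s \<ge> 2" using X by simp
    fix \<Psi> assume \<Psi>: "\<Psi> \<in> flags (cubic_toroid n ?s k)"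
    define d where "d = n - 1"
    have n: "n = Suc d" using assms(1) by (simp add: d_def)
    interpret cubic_toroid_params d ?s k
      by unfold_locales (use assms(1,5) n s in auto)
    interpret Q: rotary_flag n Q \<Psi> using rotary_flag_Q \<Psi> n by simp
    show "mix_chiral n P \<Phi> (cubic_toroid n ?s k) \<Psi>"
    proof (rule ccontr)
      assume "\<not> mix_chiral n P \<Phi> (cubic_toroid n ?s k) \<Psi>"
      then have "?X dvd order (rotation_group n Q \<Psi>)"
        using order_chirality_group_dvd[OF assms(1) P Q.rotary_flag_axioms] n by simp
      then have "?X dvd order (Aut Q)" using Q.rotation_group_order_dvd by (rule dvd_trans)
      \<comment> \<open>The exponents match because \<open>n + k - 2 = d + k - 1\<close>.\<close>
      then have "?X dvd (2 ^ (n + k - 2) * fact (n - 1)) * ?s ^ d"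
        unfolding order_automorphism_group_Q using n by simp
      moreover have "coprime ?X ?s"
      proof (rule coprimeI)
        fix c assume "c dvd ?X" "c dvd ?s"
        then show "c dvd 1" using dvd_add_right_iff[of c "?X * Suc m" 1] by (simp only: dvd_mult2)
      qed
      then have "coprime ?X (?s ^ d)" by (rule coprime_power_right_iff[THEN iffD2, OF disjI1])
      ultimately show False using assms(6) by (simp add: coprime_dvd_mult_left_iff)
    qed
  qed
  then have "range (\<lambda>m. ?X * Suc m + 1) \<subseteq> ?S" by blast
  moreover have "inj (\<lambda>m. ?X * Suc m + 1)" using X by (intro injI) simp
  ultimately show ?thesis using infinite_super range_inj_infinite by blast
qed

end
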